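(* Let $\pi\in S_{n+1}$ be of the form $\pi=1\pi'$ where $\pi'$ is a dominant permutation of $\{2,3,\ldots,n+1\}$. Then the Grothendieck polynomial $\mathfrak{G}_\pi$ has saturated Newton polytope (SNP), and the Newton polytope of each (nonzero) homogeneous component of $\mathfrak{G}_\pi$ is a generalized permutahedron. In particular, the Schubert polynomial $\mathfrak{S}_\pi$ has SNP and $\mathrm{Newton}(\mathfrak{S}_\pi)$ is a generalized permutahedron. Moreover, $\mathfrak{S}_\pi$ is the integer point transform of its Newton polytope, i.e. $\mathfrak{S}_\pi=\sum_{p\in \mathrm{Newton}(\mathfrak{S}_\pi)\cap\mathbb{Z}^n}\mathbf{t}^p$.
   Context: $\pi=1\pi'$ means that in one-line notation $\pi(1)=1$ and $\pi(2)\cdots\pi(n+1)$ is the word $\pi'$ in the letters $\{2,\dots,n+1\}$. A permutation is dominant if its (Rothe) diagram is the Young diagram of a partition; equivalently, it avoids the pattern $132$. A pipe dream for $\pi\in S_{n+1}$ is a tiling of an $(n+1)\times(n+1)$ matrix by two kinds of tiles, crosses (the two strands go straight through, one vertically and one horizontally) and elbows (one strand joins the top edge to the left edge of the tile, the other joins the right edge to the bottom edge), such that (1) all tiles in the weak south-east triangle (positions $(i,j)$ with $i+j\ge n+2$) are elbows, and (2) if one writes $1,2,\dots,n+1$ on the top and follows the strands (ignoring second crossings among the same strands), they come out on the left and read $\pi$ from top to bottom. A pipe dream is reduced if no two strands cross twice. $\mathrm{PD}(\pi)$ is the set of all pipe dreams of $\pi$ and $\mathrm{RPD}(\pi)$ the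 set of all reduced ones. For $P\in\mathrm{PD}(\pi)$ the weight is $wt(P)=\prod_{(i,j)\in\mathrm{cross}(P)}t_i$, where $\mathrm{cross}(P)$ is the set of positions (row $i$, column $j$) of the crosses in $P$. Grothendieck polynomial (in this normalization): $\mathfrak{G}_\pi(t_1,\dots,t_n)=\sum_{P\in\mathrm{PD}(\pi)}wt(P)$. Schubert polynomial: its lowest degree homogeneous component, $\mathfrak{S}_\pi(t_1,\dots,t_n)=\sum_{P\in\mathrm{RPD}(\pi)}wt(P)$. For a polynomial $f=\sum_\alpha c_\alpha\mathbf{t}^\alpha$, $\mathrm{Newton}(f)=\mathrm{Conv}\{\alpha:c_\alpha\neq0\}$; $f$ has SNP if the integer points of $\mathrm{Newton}(f)$ are exactly the exponents $\alpha$ with $c_\alpha\ne0$. A generalized permutahedron in $\mathbb{R}^n$ is a polytope of the form $\{\mathbf{t}\in\mathbb{R}^n : \sum_{i\in I}t_i\ge z_I \text{ for } I\subsetneq[n],\ \sum_{i=1}^n t_i=z_{[n]}\}$, where $\{z_I\}_{I\subseteq[n]}$ are real numbers with $z_\emptyset=0$ and $z_{I\cup J}+z_{I\cap J}\ge z_I+z_J$ for all $I,J\subseteq[n]$; here $[n]=\{1,\dots,n\}$. *)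

theory Defs
  imports
    "HOL-Analysis.Analysis"
    "HOL-Analysis.Finite_Function_Topology"
    "HOL-Combinatorics.Permutations"
begin

text \<open>
  Points of $R^n$ are finitely supported functions of type \<^typ>\<open>nat \<Rightarrow>\<^sub>0 real\<close> whose support
  lies in \<^term>\<open>{1..n}\<close>; this type is a real vector space, so the library's convex hull applies.
  Exponent vectors are of type \<^typ>\<open>nat \<Rightarrow>\<^sub>0 nat\<close>, and a polynomial maps each exponent vector to
  its coefficient. Rows, columns, strands and variables are numbered from 1.
\<close>

type_synonym polynomial = "(nat \<Rightarrow>\<^sub>0 nat) \<Rightarrow>\<^sub>0 int"


subsection \<open>Dominant permutations\<close>

text \<open>
  These notions are for permutations of \<^term>\<open>{1..n}\<close>. A word on the letters $2, \dots, n + 1$ is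
  identified with the permutation of \<^term>\<open>{1..n}\<close> obtained by decreasing every letter by 1.
\<close>

definition rothe_diagram :: "nat \<Rightarrow> (nat \<Rightarrow> nat) \<Rightarrow> (nat \<times> nat) set" where
  "rothe_diagram n w = {(i, j). i \<in> {1..n} \<and> j \<in> {1..n} \<and> j < w i \<and> i < inv w j}"

definition is_partition :: "nat list \<Rightarrow> bool" where
  "is_partition l \<longleftrightarrow> sorted_wrt (\<ge>) l \<and> (\<forall>x \<in> set l. 0 < x)"

definition young_diagram :: "nat list \<Rightarrow> (nat \<times> nat) set" where
  "young_diagram l = {(i, j). i \<in> {1..length l} \<and> j \<in> {1..l ! (i - 1)}}"

definition dominant :: "nat \<Rightarrow> (nat \<Rightarrow> nat) \<Rightarrow> bool" where
  "dominant n w \<longleftrightarrow> (\<exists>l. is_partition l \<and> rothe_diagram n w = young_diagram l)"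


subsection \<open>Pipe dreams\<close>

text \<open>
  A tiling of the $m \times m$ matrix is given by the set \<open>D\<close> of positions of its crosses; all other
  tiles are elbows. Strands run downwards and leftwards, so visiting the tiles row by row from the
  top, and from right to left in each row, follows all strands simultaneously. In a state
  \<open>(v, h, cs)\<close>, \<open>v j\<close> is the strand about to enter the next tile of column \<open>j\<close> through its top edge,
  \<open>h i\<close> the strand about to enter the next tile of row \<open>i\<close> through its right edge (after the last
  tile of row \<open>i\<close>: the strand leaving the matrix on the left in row \<open>i\<close>), and \<open>cs\<close> lists the
  unordered pairs of strands that have crossed so far, with repetitions. If \<open>ignore\<close> holds, a cross
  at which two strands meet that have crossed before acts as an elbow.
\<close>

type_synonym strands = "(nat \<Rightarrow> nat) \<times> (nat \<Rightarrow> nat) \<times> nat set list"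

definition pass_tile :: "bool \<Rightarrow> (nat \<times> nat) set \<Rightarrow> nat \<times> nat \<Rightarrow> strands \<Rightarrow> strands" where
  "pass_tile ignore D = (\<lambda>(i, j) (v, h, cs).
     if (i, j) \<in> D \<and> \<not> (ignore \<and> {v j, h i} \<in> set cs)
     then (v, h, {v j, h i} # cs)
     else (v(j := h i), h(i := v j), cs))"

text \<open>
  The strand entering at the top of column \<open>j\<close> is numbered \<open>j\<close>. The strands entering through the
  right side get the numbers above \<open>m\<close>; if all tiles with $i + j > m$ are elbows, these strands
  stay in the south-east triangle.
\<close>

definition follow_strands :: "bool \<Rightarrow> nat \<Rightarrow> (nat \<times> nat) set \<Rightarrow> strands" where
  "follow_strands ignore m D =
     fold (pass_tile ignore D) [(i, j). i \<leftarrow> [1..<Suc m], j \<leftarrow> rev [1..<Suc m]]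
       (\<lambda>j. j, \<lambda>i. m + i, [])"

definition left_reading :: "nat \<Rightarrow> (nat \<times> nat) set \<Rightarrow> nat \<Rightarrow> nat" where
  "left_reading m D = fst (snd (follow_strands True m D))"

text \<open>
  The pipe dreams of a permutation in $S_m$. The positions of the forced elbows are those with
  $i + j \ge m + 1$.
\<close>

definition PD :: "nat \<Rightarrow> (nat \<Rightarrow> nat) \<Rightarrow> (nat \<times> nat) set set" where
  "PD m \<pi> = {D. D \<subseteq> {1..m} \<times> {1..m} \<and> (\<forall>(i, j) \<in> D. i + j < m + 1) \<and>
                (\<forall>i \<in> {1..m}. left_reading m D i = \<pi> i)}"

definition reduced :: "nat \<Rightarrow> (nat \<times> nat) set \<Rightarrow> bool" where
  "reduced m D \<longleftrightarrow> distinct (snd (snd (follow_strands False m D)))"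

definition RPD :: "nat \<Rightarrow> (nat \<Rightarrow> nat) \<Rightarrow> (nat \<times> nat) set set" where
  "RPD m \<pi> = {D \<in> PD m \<pi>. reduced m D}"


subsection \<open>Grothendieck and Schubert polynomials\<close>

definition var :: "nat \<Rightarrow> polynomial" where
  "var i = Poly_Mapping.single (Poly_Mapping.single i 1) 1"

definition wt :: "(nat \<times> nat) set \<Rightarrow> polynomial" where
  "wt D = (\<Prod>(i, j) \<in> D. var i)"

definition grothendieck :: "nat \<Rightarrow> (nat \<Rightarrow> nat) \<Rightarrow> polynomial" where
  "grothendieck m \<pi> = (\<Sum>D \<in> PD m \<pi>. wt D)"

definition schubert :: "nat \<Rightarrow> (nat \<Rightarrow> nat) \<Rightarrow> polynomial" where
  "schubert m \<pi> = (\<Sum>D \<in> RPD m \<pi>. wt D)"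

definition total_degree :: "(nat \<Rightarrow>\<^sub>0 nat) \<Rightarrow> nat" where
  "total_degree \<alpha> = (\<Sum>i \<in> Poly_Mapping.keys \<alpha>. Poly_Mapping.lookup \<alpha> i)"

definition homogeneous_component :: "nat \<Rightarrow> polynomial \<Rightarrow> polynomial" where
  "homogeneous_component d f =
     (\<Sum>\<alpha> \<in> {\<alpha> \<in> Poly_Mapping.keys f. total_degree \<alpha> = d}.
        Poly_Mapping.single \<alpha> (Poly_Mapping.lookup f \<alpha>))"


subsection \<open>Newton polytopes\<close>

definition real_vec :: "(nat \<Rightarrow>\<^sub>0 nat) \<Rightarrow> (nat \<Rightarrow>\<^sub>0 real)" where
  "real_vec \<alpha> = Poly_Mapping.map real \<alpha>"

definition newton :: "polynomial \<Rightarrow> (nat \<Rightarrow>\<^sub>0 real) set" where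
  "newton f = convex hull (real_vec ` Poly_Mapping.keys f)"

definition integer_points :: "(nat \<Rightarrow>\<^sub>0 real) set \<Rightarrow> (nat \<Rightarrow>\<^sub>0 real) set" where
  "integer_points S = {p \<in> S. \<forall>i. Poly_Mapping.lookup p i \<in> \<int>}"

definition SNP :: "polynomial \<Rightarrow> bool" where
  "SNP f \<longleftrightarrow> integer_points (newton f) = real_vec ` Poly_Mapping.keys f"

definition generalized_permutahedron :: "nat \<Rightarrow> (nat \<Rightarrow>\<^sub>0 real) set \<Rightarrow> bool" where
  "generalized_permutahedron n S \<longleftrightarrow>
     (\<exists>z :: nat set \<Rightarrow> real.
        z {} = 0 \<and>
        (\<forall>I J. I \<subseteq> {1..n} \<longrightarrow> J \<subseteq> {1..n} \<longrightarrow> z (I \<union> J) + z (I \<inter> J) \<ge> z I + z J) \<and>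
        S = {t. Poly_Mapping.keys t \<subseteq> {1..n} \<and>
                (\<forall>I. I \<subset> {1..n} \<longrightarrow> (\<Sum>i \<in> I. Poly_Mapping.lookup t i) \<ge> z I) \<and>
                (\<Sum>i = 1..n. Poly_Mapping.lookup t i) = z {1..n}})"

text \<open>
  The monomial of an integer point. Only points with nonnegative coordinates are meant, and all
  points of a Newton polytope of a polynomial are of this kind.
\<close>

definition monomial_at :: "(nat \<Rightarrow>\<^sub>0 real) \<Rightarrow> polynomial" where
  "monomial_at p = Poly_Mapping.single (Poly_Mapping.map (\<lambda>x. nat \<lfloor>x\<rfloor>) p) 1"

definition integer_point_transform :: "(nat \<Rightarrow>\<^sub>0 real) set \<Rightarrow> polynomial" where
  "integer_point_transform S = (\<Sum>p \<in> integer_points S. monomial_at p)"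

end

theory Submission
  imports Defs
begin

text \<open>
  Reading the tiles row by row turns a pipe dream into a 0-Hecke word. For $\pi = 1\pi'$ with $\pi'$
  dominant with diagram $\lambda$, tracking this word shows that the pipe dreams are given by
  noncrossing sets of elbows in $\lambda$ enlarged by one row and one column. Recording for every
  column the row of its first elbow, such a set is determined by the number of columns assigned to
  each row, together with the rows that contain an ineffective cross (none in the reduced case). A
  greedy argument describes the possible numbers by linear inequalities on prefix sums, so the
  exponent vectors of the Grothendieck polynomial are exactly the integer points of a polyhedron,
  whence SNP. Its slices of fixed degree have only integral bounds on coordinates and on prefix sums;
  such polytopes are integral and are generalized permutahedra. Reduced pipe dreams are determined by
  their exponent vectors, so all coefficients of the Schubert polynomial are 1.
\<close>

subsection \<open>Pipe dreams as 0-Hecke words\<close>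

text \<open>The obstacle is that repeated crossings are ignored, so a tile cannot be judged locally.
  Monotonicity replaces locality: inversions of the front word are never undone, and since \<pi>'
  avoids 132, of two remaining letters that are inverted the smaller one lies below the next letter
  to leave. This excludes crosses outside the enlarged diagram and forces the columns beyond the
  current row length to have had an elbow before. The only cross that can be ineffective in a row is
  then the one in the last covered column that the row reaches. Hence the number of crosses in a row
  is its length minus 1, minus the number of first elbows in it, plus 1 if it has an ineffective
  cross. The prefix bounds come from this count: the first elbows below row k are limited by the
  length of the next row, and the ineffective crosses up to row k are limited both by k - 1 and by
  their total number. The latter is determined by the degree, which is why generalized permutahedra
  are obtained degree by degree.\<close>

text \<open>
  The front word lists the strands along the boundary between visited and unvisited tiles: first the
  strands that have left rows $1, \dots, r$, then those on top of the unvisited columns of row $r + 1$,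
  then the one entering the current tile from the right, then those below the visited columns. A
  cross in row $i$ and column $j$ swaps the positions $i + j - 1$ and $i + j$, and it is ignored exactly
  if these are already inverted. The parameters of \<open>hecke_tile\<close> are $i - 1$ and $j - 1$.
\<close>

definition hecke_tile :: "(nat \<times> nat) set \<Rightarrow> nat \<Rightarrow> nat \<Rightarrow> (nat \<Rightarrow> nat) \<Rightarrow> nat \<Rightarrow> nat" where
  "hecke_tile D r k f =
     (if (Suc r, Suc k) \<in> D \<and> f (Suc (r + k)) < f (Suc (Suc (r + k)))
      then f \<circ> Transposition.transpose (Suc (r + k)) (Suc (Suc (r + k))) else f)"

primrec hecke_row :: "(nat \<times> nat) set \<Rightarrow> nat \<Rightarrow> nat \<Rightarrow> (nat \<Rightarrow> nat) \<Rightarrow> nat \<Rightarrow> nat" where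
  "hecke_row D r 0 f = f"
| "hecke_row D r (Suc k) f = hecke_row D r k (hecke_tile D r k f)"

primrec front :: "(nat \<times> nat) set \<Rightarrow> nat \<Rightarrow> nat \<Rightarrow> nat \<Rightarrow> nat" where
  "front D m 0 = id"
| "front D m (Suc r) = hecke_row D r m (front D m r)"

text \<open>Inversions are pairs of letters, not of positions: a swap at an ascent then only adds
  one pair, and the pairs can be compared with those of strands that have crossed.\<close>

definition invs :: "(nat \<Rightarrow> nat) \<Rightarrow> (nat \<times> nat) set" where
  "invs f = {(f p, f q) | p q. p < q \<and> f q < f p}"

lemma invs_id [simp]: "invs id = {}"
  by (auto simp: invs_def)

lemma invs_swap:
  assumes "f p < f (Suc p)"
  shows "invs (f \<circ> Transposition.transpose p (Suc p)) = insert (f (Suc p), f p) (invs f)" (is "?L = ?R")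
proof
  let ?t = "Transposition.transpose p (Suc p)"
  have *: "?t x < ?t y" if "x < y" "(x, y) \<noteq> (p, Suc p)" for x y
    using that by (auto simp: Transposition.transpose_def)
  show "?L \<subseteq> ?R"
  proof
    fix z assume "z \<in> ?L"
    then obtain x y where z: "z = (f (?t x), f (?t y))" "x < y" "f (?t y) < f (?t x)"
      by (auto simp: invs_def)
    then show "z \<in> ?R"
      using *[of x y] by (cases "(x, y) = (p, Suc p)") (auto simp: invs_def)
  qed
  show "?R \<subseteq> ?L"
  proof
    fix z assume "z \<in> ?R"
    then consider "z = (f (Suc p), f p)" | x y where "z = (f x, f y)" "x < y" "f y < f x"
      by (auto simp: invs_def)
    then show "z \<in> ?L"
    proof cases
      case 1
      then have "z = ((f \<circ> ?t) p, (f \<circ> ?t) (Suc p))" "(f \<circ> ?t) (Suc p) < (f \<circ> ?t) p"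
        using assms by auto
      then show ?thesis unfolding invs_def by blast
    next
      case 2
      then have "(x, y) \<noteq> (p, Suc p)" using assms by auto
      then have "?t x < ?t y" using * 2 by blast
      moreover have "z = ((f \<circ> ?t) (?t x), (f \<circ> ?t) (?t y))"
        "(f \<circ> ?t) (?t y) < (f \<circ> ?t) (?t x)"
        using 2 by auto
      ultimately show ?thesis unfolding invs_def by blast
    qed
  qed
qed

lemma inj_hecke_tile: "inj f \<Longrightarrow> inj (hecke_tile D r k f)"
  by (simp add: hecke_tile_def inj_compose)

lemma inj_hecke_row: "inj f \<Longrightarrow> inj (hecke_row D r k f)"
  by (induction k arbitrary: f) (auto simp: inj_hecke_tile)

lemma inj_front: "inj (front D m r)"
  by (induction r) (auto simp: inj_hecke_row)

lemma invs_hecke_tile: "invs f \<subseteq> invs (hecke_tile D r k f)"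
  by (auto simp: hecke_tile_def invs_swap)

lemma invs_hecke_row: "invs f \<subseteq> invs (hecke_row D r k f)"
proof (induction k arbitrary: f)
  case (Suc k)
  then show ?case using invs_hecke_tile[of f D r k] by fastforce
qed simp

lemma invs_front_mono: "r \<le> s \<Longrightarrow> invs (front D m r) \<subseteq> invs (front D m s)"
  by (induction s rule: dec_induct) (use invs_hecke_row in fastforce)+

lemma hecke_tile_fixes: "p \<le> r \<Longrightarrow> hecke_tile D r k f p = f p"
  by (auto simp: hecke_tile_def Transposition.transpose_def)

lemma hecke_row_fixes: "p \<le> r \<Longrightarrow> hecke_row D r k f p = f p"
  by (induction k arbitrary: f) (auto simp: hecke_tile_fixes)

lemma front_fixes: "r \<le> s \<Longrightarrow> p \<le> r \<Longrightarrow> front D m s p = front D m r p"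
  by (induction s rule: dec_induct) (auto simp: hecke_row_fixes)

lemma hecke_tile_large:
  assumes "\<forall>(i, j) \<in> D. i + j \<le> m" "m < p"
  shows "hecke_tile D r k f p = f p"
  using assms by (auto simp: hecke_tile_def Transposition.transpose_def)

lemma hecke_row_large:
  assumes "\<forall>(i, j) \<in> D. i + j \<le> m" "m < p"
  shows "hecke_row D r k f p = f p"
  by (induction k arbitrary: f) (auto simp: hecke_tile_large[OF assms])

lemma front_large:
  assumes "\<forall>(i, j) \<in> D. i + j \<le> m" "m < p"
  shows "front D m r p = p"
  by (induction r) (auto simp: hecke_row_large[OF assms])

text \<open>The invariant inside row r + 1 while the columns 1, ..., k are still unvisited. It gives
  every strand its position in the front word; \<open>distinct cs\<close> expresses that each
  inverted pair was recorded only once.\<close>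

definition follows :: "nat \<Rightarrow> nat \<Rightarrow> nat \<Rightarrow> (nat \<Rightarrow> nat) \<Rightarrow> strands \<Rightarrow> bool" where
  "follows m r k f = (\<lambda>(v, h, cs). inj f \<and>
     (\<forall>j \<in> {1..k}. v j = f (r + j)) \<and> (\<forall>j \<in> {k<..m}. v j = f (Suc r + j)) \<and>
     h (Suc r) = f (Suc r + k) \<and> (\<forall>i \<in> {1..r}. h i = f i) \<and> (\<forall>i > Suc r. h i = f (m + i)) \<and>
     set cs = (\<lambda>(a, b). {a, b}) ` invs f \<and> distinct cs)"

lemma follows_iff:
  "follows m r k f (v, h, cs) \<longleftrightarrow> inj f \<and>
     (\<forall>j. j \<in> {1..k} \<longrightarrow> v j = f (r + j)) \<and> (\<forall>j. j \<in> {k<..m} \<longrightarrow> v j = f (Suc (r + j))) \<and>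
     h (Suc r) = f (Suc (r + k)) \<and> (\<forall>i. i \<in> {1..r} \<longrightarrow> h i = f i) \<and>
     (\<forall>i. i > Suc r \<longrightarrow> h i = f (m + i)) \<and>
     set cs = (\<lambda>(a, b). {a, b}) ` invs f \<and> distinct cs"
  unfolding follows_def prod.case add_Suc Ball_def by blast

text \<open>The top entry of the tile has position p and the right entry p + 1; afterwards the left
  exit has position p and the bottom exit p + 1. Hence an elbow leaves the word unchanged and a
  cross swaps two letters. By injectivity of the word, the two strands have crossed before exactly
  if the word descends at p.\<close>

lemma follows_tile:
  assumes s: "follows m r (Suc k) f s" and k: "k < m"
  shows "follows m r k (hecke_tile D r k f) (pass_tile True D (Suc r, Suc k) s)"
proof -
  obtain v h cs where s_eq: "s = (v, h, cs)" by (cases s)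
  define p where "p = Suc (r + k)"
  have inj: "inj f" and v1: "\<And>j. j \<in> {1..Suc k} \<Longrightarrow> v j = f (r + j)"
    and v2: "\<And>j. j \<in> {Suc k<..m} \<Longrightarrow> v j = f (Suc (r + j))"
    and h1: "h (Suc r) = f (Suc p)" and h2: "\<And>i. i \<in> {1..r} \<Longrightarrow> h i = f i"
    and h3: "\<And>i. i > Suc r \<Longrightarrow> h i = f (m + i)"
    and cs: "set cs = (\<lambda>(a, b). {a, b}) ` invs f" and dist: "distinct cs"
    using s[unfolded s_eq follows_iff] unfolding p_def add_Suc_right by simp_all
  have vk: "v (Suc k) = f p" using v1[of "Suc k"] by (simp add: p_def)
  have ne: "f p \<noteq> f (Suc p)" using inj by (simp add: inj_eq)
  have crossed: "{v (Suc k), h (Suc r)} \<in> set cs \<longleftrightarrow> f (Suc p) < f p"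
  proof
    assume "{v (Suc k), h (Suc r)} \<in> set cs"
    then have "\<exists>z \<in> invs f. {f p, f (Suc p)} = (\<lambda>(a, b). {a, b}) z"
      unfolding cs vk h1 image_iff .
    then obtain x y where xy: "x < y" "f y < f x" "{f p, f (Suc p)} = {f x, f y}"
      unfolding invs_def mem_Collect_eq by (elim bexE CollectE exE conjE) (simp only: prod.case)
    from xy(3) consider "f p = f x" "f (Suc p) = f y" | "f p = f y" "f (Suc p) = f x"
      unfolding doubleton_eq_iff by blast
    then show "f (Suc p) < f p"
    proof cases
      case 2
      then have "p = y" "Suc p = x" using inj by (simp_all add: inj_eq)
      then show ?thesis using xy by simp
    qed (use xy in simp)
  next
    assume "f (Suc p) < f p"
    then have "(f p, f (Suc p)) \<in> invs f" unfolding invs_def by blast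
    from imageI[OF this, of "\<lambda>(a, b). {a, b}"] show "{v (Suc k), h (Suc r)} \<in> set cs"
      unfolding cs vk h1 prod.case .
  qed
  show ?thesis
  proof (cases "(Suc r, Suc k) \<in> D \<and> f p < f (Suc p)")
    case True
    define g where "g = f \<circ> Transposition.transpose p (Suc p)"
    have g: "g p = f (Suc p)" "g (Suc p) = f p" "\<And>q. q \<noteq> p \<Longrightarrow> q \<noteq> Suc p \<Longrightarrow> g q = f q"
      by (auto simp: g_def)
    have "\<not> {v (Suc k), h (Suc r)} \<in> set cs" using True by (simp add: crossed)
    then have pt: "pass_tile True D (Suc r, Suc k) s = (v, h, {v (Suc k), h (Suc r)} # cs)"
      using True by (simp add: s_eq pass_tile_def)
    have ht: "hecke_tile D r k f = g" using True by (simp add: hecke_tile_def p_def g_def)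
    have "inj g" unfolding g_def by (simp add: inj inj_compose)
    moreover have "v j = g (r + j)" if "j \<in> {1..k}" for j
      using v1[of j] that g(3)[of "r + j"] by (auto simp: p_def)
    moreover have "v j = g (Suc (r + j))" if "j \<in> {k<..m}" for j
    proof (cases "j = Suc k")
      case True
      then show ?thesis using vk g(2) by (simp add: p_def)
    next
      case False
      then show ?thesis using v2[of j] that g(3)[of "Suc (r + j)"] by (auto simp: p_def)
    qed
    moreover have "h (Suc r) = g (Suc (r + k))" using h1 g(1) by (simp add: p_def)
    moreover have "h i = g i" if "i \<in> {1..r}" for i
      using h2[of i] that g(3)[of i] by (auto simp: p_def)
    moreover have "h i = g (m + i)" if "i > Suc r" for i
      using h3[of i] that k g(3)[of "m + i"] by (auto simp: p_def)
    moreover have "set ({v (Suc k), h (Suc r)} # cs) = (\<lambda>(a, b). {a, b}) ` invs g"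
      using True by (auto simp: g_def invs_swap cs vk h1)
    moreover have "distinct ({v (Suc k), h (Suc r)} # cs)"
      using True dist by (simp add: crossed)
    ultimately show ?thesis unfolding pt ht follows_iff by blast
  next
    case False
    then have "\<not> ((Suc r, Suc k) \<in> D \<and> \<not> {v (Suc k), h (Suc r)} \<in> set cs)"
      using ne by (auto simp: crossed)
    then have pt: "pass_tile True D (Suc r, Suc k) s =
        (v(Suc k := h (Suc r)), h(Suc r := v (Suc k)), cs)"
      by (auto simp: s_eq pass_tile_def)
    have ht: "hecke_tile D r k f = f" using False by (auto simp: hecke_tile_def p_def)
    show ?thesis
      unfolding follows_iff pt ht
    proof (intro conjI allI impI)
      fix j assume "j \<in> {1..k}"
      then show "(v(Suc k := h (Suc r))) j = f (r + j)" using v1[of j] by simp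
    next
      fix j assume "j \<in> {k<..m}"
      then show "(v(Suc k := h (Suc r))) j = f (Suc (r + j))"
        using v2[of j] h1 by (cases "j = Suc k") (simp_all add: p_def)
    next
      show "(h(Suc r := v (Suc k))) (Suc r) = f (Suc (r + k))" by (simp add: vk p_def)
    next
      fix i assume "i \<in> {1..r}"
      then show "(h(Suc r := v (Suc k))) i = f i" using h2[of i] by simp
    next
      fix i assume "Suc r < i"
      then show "(h(Suc r := v (Suc k))) i = f (m + i)" using h3[of i] by simp
    qed (fact inj cs dist)+
  qed
qed

lemma follows_row:
  assumes "follows m r k f s" "k \<le> m"
  shows "follows m r 0 (hecke_row D r k f)
           (fold (pass_tile True D) (map (Pair (Suc r)) (rev [1..<Suc k])) s)"
  using assms
proof (induction k arbitrary: f s)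
  case (Suc k)
  then show ?case
    using follows_tile[of m r k f s D] by (simp add: Suc.IH)
qed simp

lemma follows_next_row:
  assumes "follows m r 0 f s"
  shows "follows m (Suc r) m f s"
  using assms by (cases s) (auto simp: follows_iff le_Suc_eq add.commute[of m r])

lemma fold_tiles_Suc:
  "fold g [(i, j). i \<leftarrow> [1..<Suc (Suc r)], j \<leftarrow> js] s =
   fold g (map (Pair (Suc r)) js) (fold g [(i, j). i \<leftarrow> [1..<Suc r], j \<leftarrow> js] s)"
  by (simp add: comp_def)

lemma follows_front:
  "follows m r m (front D m r)
     (fold (pass_tile True D) [(i, j). i \<leftarrow> [1..<Suc r], j \<leftarrow> rev [1..<Suc m]]
       (\<lambda>j. j, \<lambda>i. m + i, []))"
proof (induction r)
  case 0
  then show ?case by (simp add: follows_iff flip: id_def)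
next
  case (Suc r)
  show ?case
    unfolding fold_tiles_Suc front.simps
    by (intro follows_next_row follows_row Suc.IH) simp
qed

lemma follow_strands_front:
  obtains v h cs where "follow_strands True m D = (v, h, cs)" "follows m m m (front D m m) (v, h, cs)"
  using follows_front[of m m D] unfolding follow_strands_def
  by (cases "fold (pass_tile True D) [(i, j). i \<leftarrow> [1..<Suc m], j \<leftarrow> rev [1..<Suc m]]
       (\<lambda>j. j, \<lambda>i. m + i, [])") metis

lemma left_reading_eq_front:
  assumes "i \<in> {1..m}"
  shows "left_reading m D i = front D m m i"
  using follow_strands_front[of m D] assms
  unfolding left_reading_def follows_iff by (metis fst_conv snd_conv)

lemma card_unordered: "card ((\<lambda>(a, b). {a, b}) ` invs f) = card (invs f)"
proof (rule card_image, rule inj_onI)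
  fix x y assume "x \<in> invs f" "y \<in> invs f" "(\<lambda>(a, b). {a, b}) x = (\<lambda>(a, b). {a, b}) y"
  then show "x = y"
    by (cases x; cases y) (auto simp: invs_def doubleton_eq_iff)
qed

lemma length_crossings:
  "length (snd (snd (follow_strands True m D))) = card (invs (front D m m))"
  using follow_strands_front[of m D] card_unordered[of "front D m m"]
  unfolding follows_iff by (metis snd_conv distinct_card)

lemma PD_iff_front:
  assumes "\<pi> permutes {1..m}"
  shows "D \<in> PD m \<pi> \<longleftrightarrow>
    D \<subseteq> {1..m} \<times> {1..m} \<and> (\<forall>(i, j) \<in> D. i + j \<le> m) \<and> front D m m = \<pi>"
proof -
  have *: "(\<forall>i \<in> {1..m}. front D m m i = \<pi> i) \<longleftrightarrow> front D m m = \<pi>"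
    if "\<forall>(i, j) \<in> D. i + j \<le> m"
  proof
    assume a: "\<forall>i \<in> {1..m}. front D m m i = \<pi> i"
    show "front D m m = \<pi>"
    proof
      fix p
      have "front D m m 0 = 0" using front_fixes[of 0 m 0 D m] by simp
      then show "front D m m p = \<pi> p"
        using a front_large[OF that, of p m] assms
        by (cases "p \<in> {1..m}") (auto simp: permutes_not_in not_le Suc_le_eq)
    qed
  qed auto
  show ?thesis
    unfolding PD_def using * by (auto simp: left_reading_eq_front less_Suc_eq_le)
qed

section \<open>Reducedness by counting crosses and inversions\<close>

lemma pass_tile_apply:
  "pass_tile ignore D (i, j) (v, h, cs) =
     (if (i, j) \<in> D \<and> \<not> (ignore \<and> {v j, h i} \<in> set cs) then (v, h, {v j, h i} # cs)
      else (v(j := h i), h(i := v j), cs))"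
  by (simp add: pass_tile_def)

text \<open>The runs with and without \<open>ignore\<close> agree until two strands meet at a cross
  a second time. From then on the former has recorded fewer crossings than there were crosses, and
  the list of the latter keeps its repetition.\<close>

lemma fold_pass_tile_reduced:
  fixes D :: "(nat \<times> nat) set" and xs :: "(nat \<times> nat) list" and v h :: "nat \<Rightarrow> nat"
  defines "t \<equiv> fold (pass_tile True D) xs (v, h, [])"
    and "t' \<equiv> fold (pass_tile False D) xs (v, h, [])"
    and "k \<equiv> length (filter (\<lambda>x. x \<in> D) xs)"
  shows "t' = t \<and> length (snd (snd t)) = k \<and> distinct (snd (snd t)) \<or>
         length (snd (snd t)) < k \<and> \<not> distinct (snd (snd t'))"
  unfolding assms
proof (induction xs rule: rev_induct)
  case (snoc x xs)
  obtain v1 h1 cs1 where t: "fold (pass_tile True D) xs (v, h, []) = (v1, h1, cs1)"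
    by (metis surj_pair)
  obtain v2 h2 cs2 where t': "fold (pass_tile False D) xs (v, h, []) = (v2, h2, cs2)"
    by (metis surj_pair)
  show ?case
    using snoc.IH by (cases x) (auto simp: t t' pass_tile_apply)
qed simp

lemma reduced_iff:
  assumes "D \<subseteq> {1..m} \<times> {1..m}"
  shows "reduced m D \<longleftrightarrow> card D = card (invs (front D m m))"
proof -
  define xs where "xs = [(i, j). i \<leftarrow> [1..<Suc m], j \<leftarrow> rev [1..<Suc m]]"
  have xs: "xs = List.product [1..<Suc m] (rev [1..<Suc m])"
    unfolding xs_def product_concat_map ..
  have "distinct xs" unfolding xs by (intro distinct_product) simp_all
  moreover have "set xs = {1..m} \<times> {1..m}"
    unfolding xs set_product set_rev set_upt by auto
  then have "set (filter (\<lambda>x. x \<in> D) xs) = D" using assms by auto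
  ultimately have "length (filter (\<lambda>x. x \<in> D) xs) = card D"
    using distinct_card[of "filter (\<lambda>x. x \<in> D) xs"] by simp
  then show ?thesis
    using fold_pass_tile_reduced[of D xs "\<lambda>j. j" "\<lambda>i. m + i"] length_crossings[of m D]
    unfolding reduced_def follow_strands_def xs_def[symmetric] by (metis less_irrefl)
qed

subsection \<open>The effect of one row\<close>

definition succ_in :: "nat set \<Rightarrow> nat \<Rightarrow> nat" where
  "succ_in C j = (LEAST c. c \<in> C \<and> j < c)"

text \<open>
  The increasing word \<open>T\<close> with each block \<open>[c, d)\<close> between consecutive elements \<open>c < d\<close> of \<open>C\<close>
  rotated so that its largest letter comes first. The front words arising from pipe dreams of a
  permutation $1\pi'$ have this shape, where \<open>C\<close> is the set of columns with an elbow so far.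
\<close>

definition rotated :: "(nat \<Rightarrow> nat) \<Rightarrow> nat set \<Rightarrow> nat \<Rightarrow> nat" where
  "rotated T C j = (if j \<in> C then T (succ_in C j - 1) else T (j - 1))"

definition cofin :: "nat set \<Rightarrow> bool" where
  "cofin C \<longleftrightarrow> (\<exists>b. {b<..} \<subseteq> C)"

lemma succ_in:
  assumes "cofin C"
  shows "succ_in C j \<in> C" "j < succ_in C j"
proof -
  obtain b where "{b<..} \<subseteq> C" using assms by (auto simp: cofin_def)
  then have "\<exists>c. c \<in> C \<and> j < c" by (intro exI[of _ "Suc (b + j)"]) auto
  from LeastI_ex[OF this] show "succ_in C j \<in> C" "j < succ_in C j"
    by (auto simp: succ_in_def)
qed

lemma succ_in_le: "c \<in> C \<Longrightarrow> j < c \<Longrightarrow> succ_in C j \<le> c"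
  by (simp add: succ_in_def Least_le)

lemma succ_in_eqI:
  "c \<in> C \<Longrightarrow> j < c \<Longrightarrow> (\<And>d. d \<in> C \<Longrightarrow> j < d \<Longrightarrow> c \<le> d) \<Longrightarrow> succ_in C j = c"
  unfolding succ_in_def by (rule Least_equality) auto

lemma succ_in_cong:
  assumes "\<And>d. j < d \<Longrightarrow> d \<in> C \<longleftrightarrow> d \<in> C'"
  shows "succ_in C j = succ_in C' j"
  unfolding succ_in_def using assms by (metis (no_types, lifting))

text \<open>
  In row \<open>r + 1\<close>, \<open>car k\<close> is the strand entering column \<open>k\<close> from the right, \<open>w k\<close> the one entering
  it from above and \<open>w' k\<close> the one leaving it downwards.
\<close>

lemma hecke_row_compute:
  fixes w car w' :: "nat \<Rightarrow> nat"
  assumes step: "\<And>k. 1 \<le> k \<Longrightarrow> k \<le> m \<Longrightarrow>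
      (if (Suc r, k) \<in> D \<and> w k < car k then w' k = w k \<and> car (k - 1) = car k
       else w' k = car k \<and> car (k - 1) = w k)"
    and "k \<le> m"
    and "\<And>j. 1 \<le> j \<Longrightarrow> j \<le> k \<Longrightarrow> f (r + j) = w j"
    and "f (Suc (r + k)) = car k"
    and "\<And>j. k < j \<Longrightarrow> f (Suc (r + j)) = w' j"
  shows "hecke_row D r k f (Suc r) = car 0 \<and> (\<forall>j \<ge> 1. hecke_row D r k f (Suc (r + j)) = w' j)"
  using assms(2-)
proof (induction k arbitrary: f)
  case (Suc k)
  have car: "f (Suc (Suc (r + k))) = car (Suc k)" and wk: "f (Suc (r + k)) = w (Suc k)"
    using Suc.prems(2)[of "Suc k"] Suc.prems(3) by auto
  show ?case unfolding hecke_row.simps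
  proof (rule Suc.IH)
    show "k \<le> m" using Suc.prems(1) by simp
    show "hecke_tile D r k f (r + j) = w j" if "1 \<le> j" "j \<le> k" for j
      using Suc.prems(2)[of j] that by (auto simp: hecke_tile_def Transposition.transpose_def)
    show "hecke_tile D r k f (Suc (r + k)) = car k"
      using step[of "Suc k"] Suc.prems(1) car wk
      by (auto simp: hecke_tile_def split: if_splits)
    show "hecke_tile D r k f (Suc (r + j)) = w' j" if "k < j" for j
    proof (cases "j = Suc k")
      case True
      then show ?thesis using step[of "Suc k"] Suc.prems(1) car wk
        by (auto simp: hecke_tile_def split: if_splits)
    next
      case False
      then show ?thesis using Suc.prems(4)[of j] that
        by (auto simp: hecke_tile_def Transposition.transpose_def)
    qed
  qed
qed auto

text \<open>The carried and deposited strands exist for an arbitrary word, without a guess for the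
  next one. This is for the converse direction, where the shape of the next word is not yet
  known.\<close>

lemma hecke_row_carry:
  fixes w :: "nat \<Rightarrow> nat"
  assumes f: "\<forall>j \<ge> 1. f (r + j) = w j"
  shows "\<exists>car w'.
    (\<forall>k. 1 \<le> k \<longrightarrow> k \<le> m \<longrightarrow>
      (if (Suc r, k) \<in> D \<and> w k < car k then w' k = w k \<and> car (k - 1) = car k
       else w' k = car k \<and> car (k - 1) = w k)) \<and>
    car m = w (Suc m) \<and> hecke_row D r m f (Suc r) = car (0 :: nat) \<and>
    (\<forall>j. 1 \<le> j \<longrightarrow> hecke_row D r m f (Suc (r + j)) = w' j)"
proof -
  \<comment> \<open>\<open>rc d\<close> is the strand entering column m - d from the right: the
    recursion follows the row from right to left.\<close>
  define rc where "rc = rec_nat (w (Suc m))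
    (\<lambda>d c. if (Suc r, m - d) \<in> D \<and> w (m - d) < c then c else w (m - d))"
  define car where "car k = rc (m - k)" for k
  define w' where "w' k = (if k \<le> m then (if (Suc r, k) \<in> D \<and> w k < car k then w k else car k)
    else w (Suc k))" for k
  have step: "if (Suc r, k) \<in> D \<and> w k < car k then w' k = w k \<and> car (k - 1) = car k
       else w' k = car k \<and> car (k - 1) = w k" if "1 \<le> k" "k \<le> m" for k
  proof -
    have "m - (k - 1) = Suc (m - k)" using that by simp
    then have "car (k - 1) = rc (Suc (m - k))" by (simp only: car_def)
    also have "\<dots> = (if (Suc r, k) \<in> D \<and> w k < car k then car k else w k)"
      using that by (simp add: rc_def car_def)
    finally show ?thesis using that by (simp add: w'_def)
  qed
  have last: "car m = w (Suc m)" by (simp add: car_def rc_def)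
  have "hecke_row D r m f (Suc r) = car 0 \<and> (\<forall>j \<ge> 1. hecke_row D r m f (Suc (r + j)) = w' j)"
  proof (rule hecke_row_compute[where w = w, OF step])
    show "f (Suc (r + m)) = car m" using f[rule_format, of "Suc m"] last by simp
    show "f (Suc (r + j)) = w' j" if "m < j" for j
      using f[rule_format, of "Suc j"] that by (simp add: w'_def)
  qed (use f in auto)
  note res = this
  have steps: "\<forall>k. 1 \<le> k \<longrightarrow> k \<le> m \<longrightarrow>
      (if (Suc r, k) \<in> D \<and> w k < car k then w' k = w k \<and> car (k - 1) = car k
       else w' k = car k \<and> car (k - 1) = w k)"
    by (intro allI impI) (rule step)
  show ?thesis
    by (rule exI[of _ car], rule exI[of _ w']) (use steps last res in blast)
qed

lemma succ_in_Suc: "Suc k \<in> C \<Longrightarrow> succ_in C k = Suc k"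
  by (rule succ_in_eqI) auto

text \<open>Seen from the right: beyond \<mu> all blocks are single columns and all tiles elbows, so
  the word is shifted. Between J and \<mu>, each elbow drops the carried strand, which becomes the
  head of a new block, and each cross lets the carried, larger strand pass. Column J holds the head
  T \<mu> of its block; it is picked up there and passes over all columns further left, which
  contain crosses and smaller letters. \<open>T'\<close> is \<open>T\<close> without the letter that
  leaves.\<close>

lemma hecke_row_rotated:
  fixes D :: "(nat \<times> nat) set" and T :: "nat \<Rightarrow> nat" and r \<mu> :: nat
  defines "F \<equiv> {j. 1 \<le> j \<and> (Suc r, j) \<notin> D}"
  assumes T: "strict_mono T" and C: "{\<mu><..} \<subseteq> C" and J: "J \<in> C" "1 \<le> J" "J \<le> \<mu>"
    and CJ: "\<And>j. J < j \<Longrightarrow> j \<le> \<mu> \<Longrightarrow> j \<notin> C"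
    and F: "{\<mu><..} \<subseteq> F" "\<And>j. j \<in> F \<Longrightarrow> J \<le> j" "\<exists>j \<in> F. j \<le> \<mu>"
    and m: "\<mu> \<le> m" and f: "\<And>j. 1 \<le> j \<Longrightarrow> f (r + j) = rotated T C j"
  defines "T' \<equiv> \<lambda>j. if j < \<mu> then T j else T (Suc j)"
  shows "hecke_row D r m f (Suc r) = T \<mu> \<and>
    (\<forall>j \<ge> 1. hecke_row D r m f (Suc (r + j)) = rotated T' (C \<union> F) j)"
proof -
  define w where "w = rotated T C"
  define w' where "w' = rotated T' (C \<union> F)"
  define car where "car k = (if J \<le> k then T' (succ_in F k - 1) else T \<mu>)" for k
  have T_less: "T x < T y" if "x < y" for x y using T that by (rule strict_monoD)
  have cofin: "cofin C" "cofin F" using C F by (auto simp: cofin_def)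
  have inF: "k \<in> F \<longleftrightarrow> (Suc r, k) \<notin> D" if "1 \<le> k" for k using that by (simp add: F_def)
  have large: "w k = T k" "w' k = T (Suc k)" "succ_in F k = Suc k" if "\<mu> < k" for k
    using that C F(1) by (auto simp: w_def w'_def rotated_def T'_def succ_in_Suc subset_iff)
  have CF: "succ_in (C \<union> F) k = succ_in F k" if "J \<le> k" for k
    by (rule succ_in_cong) (use that CJ F(1) in \<open>auto, metis greaterThan_iff leD le_less_trans not_le subsetD\<close>)
  have "hecke_row D r m f (Suc r) = car 0 \<and> (\<forall>j \<ge> 1. hecke_row D r m f (Suc (r + j)) = w' j)"
  proof (rule hecke_row_compute[where w = w])
    fix k assume k: "1 \<le> k" "k \<le> m"
    consider "\<mu> < k" | "J < k" "k \<le> \<mu>" | "k = J" | "k < J" by linarith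
    then show "if (Suc r, k) \<in> D \<and> w k < car k then w' k = w k \<and> car (k - 1) = car k
       else w' k = car k \<and> car (k - 1) = w k"
    proof cases
      case 1
      then have "k \<in> F" using F(1) by auto
      moreover have "succ_in F (k - 1) = k"
        using \<open>k \<in> F\<close> k succ_in_Suc[of "k - 1" F] by simp
      ultimately show ?thesis
        using 1 large[of k] J inF[OF k(1)] by (auto simp: car_def T'_def)
    next
      case 2
      then have "k \<notin> C" using CJ by blast
      then have w: "w k = T (k - 1)" by (simp add: w_def rotated_def)
      show ?thesis
      proof (cases "k \<in> F")
        case True
        then have "succ_in F (k - 1) = k" using k succ_in_Suc[of "k - 1" F] by simp
        then show ?thesis
          using True 2 w inF[OF k(1)] CF[of k] by (auto simp: car_def T'_def w'_def rotated_def)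
      next
        case False
        have "succ_in F (k - 1) = succ_in F k"
          by (rule succ_in_eqI) (use succ_in[OF cofin(2), of k] False k in
            \<open>auto intro!: succ_in_le, metis Suc_leI Suc_pred le_neq_implies_less less_eq_Suc_le\<close>)
        moreover have "T (k - 1) < T' (succ_in F k - 1)"
          using succ_in(2)[OF cofin(2), of k] k by (auto simp: T'_def intro!: T_less)
        ultimately show ?thesis
          using False 2 w inF[OF k(1)] \<open>k \<notin> C\<close> by (auto simp: car_def T'_def w'_def rotated_def)
      qed
    next
      case 3
      have "succ_in C J = Suc \<mu>"
        by (rule succ_in_eqI) (use C J CJ in \<open>auto simp: not_less_eq_eq[symmetric]\<close>)
      then have w: "w k = T \<mu>" using 3 J by (simp add: w_def rotated_def)
      have w': "w' k = car k" using 3 J CF[of k] by (simp add: w'_def rotated_def car_def)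
      have "\<not> J \<le> k - 1" using 3 J by linarith
      then have c: "car (k - 1) = T \<mu>" by (simp add: car_def)
      show ?thesis
      proof (cases "k \<in> F")
        case True
        then show ?thesis using w w' c inF[OF k(1)] by simp
      next
        case False
        \<comment> \<open>An elbow between J and \<mu> has made the carried strand smaller than T
          \<mu>, so the cross in column J meets an inverted pair and acts as an elbow.\<close>
        then obtain j where "j \<in> F" "j \<le> \<mu>" "k < j" using F(2,3) 3 by (metis le_neq_implies_less)
        then have "succ_in F k \<le> \<mu>" using succ_in_le by fastforce
        then have "car k < T \<mu>"
          using 3 J succ_in(2)[OF cofin(2), of k] by (auto simp: car_def T'_def intro!: T_less)
        then show ?thesis using w w' c by simp
      qed
    next
      case 4
      then have kF: "k \<notin> F" using F(2) by force
      have le: "succ_in C k \<le> J" using J 4 by (intro succ_in_le) auto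
      have eq: "succ_in (C \<union> F) k = succ_in C k"
        by (rule succ_in_eqI) (use succ_in[OF cofin(1), of k] le F(2) in
          \<open>auto intro: succ_in_le dest: le_trans\<close>)
      have "w k < T \<mu>"
        using le J 4 succ_in(2)[OF cofin(1), of k] by (auto simp: w_def rotated_def intro!: T_less)
      moreover have "w' k = w k"
        using kF eq le J 4 succ_in(2)[OF cofin(1), of k] by (auto simp: w_def w'_def rotated_def T'_def)
      moreover have "car k = T \<mu>" "car (k - 1) = T \<mu>" using 4 by (auto simp: car_def)
      ultimately show ?thesis using kF inF[OF k(1)] by simp
    qed
  next
    have "Suc m \<in> F" using m F(1) by auto
    then show "f (Suc (r + m)) = car m"
      using f[of "Suc m"] large[of "Suc m"] m J by (simp add: car_def w_def T'_def succ_in_Suc)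
  next
    fix j assume "m < j"
    then show "f (Suc (r + j)) = w' j"
      using f[of "Suc j"] large[of "Suc j"] large[of j] m by (simp add: w_def)
  qed (use f in \<open>auto simp: w_def\<close>)
  moreover have "car 0 = T \<mu>" using J by (simp add: car_def)
  ultimately show ?thesis by (simp add: w'_def)
qed

subsection \<open>Pipe dreams of $1\pi'$ row by row\<close>

lemma succ_in_skip: "Suc k \<notin> C \<Longrightarrow> succ_in C k = succ_in C (Suc k)"
  unfolding succ_in_def by (metis (no_types, opaque_lifting) Suc_lessD Suc_lessI)

definition cover :: "(nat \<times> nat) set \<Rightarrow> nat \<Rightarrow> nat set" where
  "cover D r = {j. 1 \<le> j \<and> (\<exists>i \<in> {1..r}. (i, j) \<notin> D)}"

lemma cover_Suc: "cover D (Suc r) = cover D r \<union> {j. 1 \<le> j \<and> (Suc r, j) \<notin> D}"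
proof -
  have "{1..Suc r} = insert (Suc r) {1..r}" by auto
  then show ?thesis unfolding cover_def by auto
qed

lemma cofin_cover:
  assumes "D \<subseteq> {1..m} \<times> {1..m}" "1 \<le> r"
  shows "cofin (cover D r)"
  unfolding cofin_def cover_def
  by (rule exI[of _ m]) (use assms in \<open>force intro: bexI[of _ 1]\<close>)

text \<open>
  Row \<open>i\<close> of the diagram of $\pi'$ has \<open>mu (i + 1) - 1\<close> boxes. The lengths \<open>mu 1, mu 2, \<dots>\<close> are those
  of the enlarged diagram outside of which a pipe dream has only elbows.
\<close>

locale one_dominant =
  fixes n :: nat and \<pi> mu :: "nat \<Rightarrow> nat"
  assumes perm: "\<pi> permutes {1..Suc n}"
    and fix1: "\<pi> (Suc 0) = Suc 0"
    and mu_pos: "\<And>i. 0 < mu i"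
    and mu_Suc: "\<And>i. mu (Suc i) \<le> mu i"
    and mu_last: "mu (Suc n) = Suc 0"
    and mu_12: "mu (Suc 0) = mu (Suc (Suc 0))"
    and mu_le: "\<And>r. 1 \<le> r \<Longrightarrow> r \<le> n \<Longrightarrow> r + mu (Suc r) \<le> Suc n"
    and smaller: "\<And>r. 1 \<le> r \<Longrightarrow> r \<le> n \<Longrightarrow>
      {x \<in> {1..Suc n}. x < \<pi> (Suc r) \<and> x \<notin> \<pi> ` {1..Suc r}} = {2..mu (Suc r)}"
begin

lemma mu_antimono: "i \<le> j \<Longrightarrow> mu j \<le> mu i"
  by (induction rule: dec_induct) (use mu_Suc le_trans in blast)+

lemma \<pi>_inj: "\<pi> x = \<pi> y \<longleftrightarrow> x = y"
  using perm by (metis permutes_inj injD)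

lemma avoids_132:
  assumes "1 < i" "i < p" "p < q" "\<pi> i < \<pi> q" "\<pi> q < \<pi> p"
  shows False
proof -
  have "p \<le> Suc n"
  proof (rule ccontr)
    assume "\<not> p \<le> Suc n"
    then have "\<pi> p = p" "\<pi> q = q" using perm assms by (auto simp: permutes_not_in)
    then show False using assms by simp
  qed
  then have \<pi>p: "\<pi> p \<in> {1..Suc n}" using assms permutes_in_image[OF perm, of p] by auto
  have \<pi>q: "\<pi> q \<in> {1..Suc n}" using assms \<pi>p by auto
  have sm: "x \<in> {2..mu j} \<longleftrightarrow> x \<in> {1..Suc n} \<and> x < \<pi> j \<and> x \<notin> \<pi> ` {1..j}"
    if "1 < j" "j \<le> p" for x j
  proof -
    have "Suc (j - 1) = j" "1 \<le> j - 1" "j - 1 \<le> n" using that \<open>p \<le> Suc n\<close> by linarith+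
    then show ?thesis using smaller[of "j - 1"] by (metis (no_types, lifting) mem_Collect_eq)
  qed
  have "\<pi> q \<notin> \<pi> ` {1..p}" using assms by (auto simp: \<pi>_inj)
  then have "\<pi> q \<in> {2..mu p}" using sm[of p "\<pi> q"] \<pi>q assms by linarith
  then have "\<pi> q \<in> {2..mu i}" using mu_antimono[of i p] assms by simp
  then have "\<pi> q < \<pi> i" using sm[of i "\<pi> q"] assms by linarith
  then show False using assms by simp
qed

text \<open>\<open>letters r\<close> enumerates increasingly the letters that have not left the matrix in the rows up to \<open>r\<close>.\<close>

primrec letters :: "nat \<Rightarrow> nat \<Rightarrow> nat" where
  "letters 0 = Suc"
| "letters (Suc r) = (if r = 0 then Suc
     else (\<lambda>j. if j < mu (Suc r) then letters r j else letters r (Suc j)))"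

lemma strict_mono_letters: "strict_mono (letters r)"
proof (induction r)
  case 0
  then show ?case by (simp add: strict_mono_Suc_iff)
next
  case (Suc r)
  then show ?case
    by (auto simp: strict_mono_Suc_iff) (meson lessI less_trans)
qed

text \<open>By \<open>smaller\<close>, the remaining letters below \<open>\<pi> (Suc r)\<close> are
  2, ..., \<open>mu (Suc r)\<close>, and counting them gives the index. The range is a hypothesis
  because the induction that proves it uses this lemma.\<close>

lemma letters_target_aux:
  assumes r: "1 \<le> r" "r \<le> n" and range: "letters r ` {1..} = {2..} - \<pi> ` {1..r}"
  shows "letters r (mu (Suc r)) = \<pi> (Suc r)"
proof -
  have \<pi>r: "\<pi> (Suc r) \<in> {1..Suc n}" using r permutes_in_image[OF perm, of "Suc r"] by auto
  have "\<pi> (Suc r) \<noteq> \<pi> (Suc 0)" using r by (simp add: \<pi>_inj)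
  then have "\<pi> (Suc r) \<in> letters r ` {1..}"
    unfolding range using \<pi>r by (auto simp: fix1 \<pi>_inj)
  then obtain k where k: "1 \<le> k" "\<pi> (Suc r) = letters r k" by auto
  have less: "letters r x < letters r y \<longleftrightarrow> x < y" for x y
    using strict_mono_letters by (rule strict_mono_less)
  have "letters r ` {1..<k} = {x \<in> letters r ` {1..}. x < \<pi> (Suc r)}"
    by (auto simp: k less)
  also have "\<dots> = {x \<in> {1..Suc n}. x < \<pi> (Suc r) \<and> x \<notin> \<pi> ` {1..Suc r}}"
  proof -
    have "\<pi> (Suc 0) \<in> \<pi> ` {1..Suc r}" by (rule imageI) simp
    then have "2 \<le> x" if "x \<in> {1..Suc n}" "x \<notin> \<pi> ` {1..Suc r}" for x
      using that fix1 by (cases "x = 1") auto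
    then show ?thesis
      unfolding range using \<pi>r by (auto simp: le_Suc_eq)
  qed
  also have "\<dots> = {2..mu (Suc r)}" using smaller r by simp
  finally have "card (letters r ` {1..<k}) = card {2..mu (Suc r)}" by simp
  moreover have "inj_on (letters r) {1..<k}"
    using strict_mono_letters[of r] by (auto simp: strict_mono_eq intro: inj_onI)
  ultimately have "k - 1 = mu (Suc r) - 1"
    by (simp add: card_image)
  then have "k = mu (Suc r)" using k(1) mu_pos[of "Suc r"] by linarith
  then show ?thesis using k by simp
qed

lemma letters_range:
  assumes "1 \<le> r" "r \<le> Suc n"
  shows "letters r ` {1..} = {2..} - \<pi> ` {1..r}"
  using assms
proof (induction r rule: nat_induct_at_least)
  case base
  have "x \<in> Suc ` {1..}" if "x \<in> {2..}" for x
    using that by (intro image_eqI[of _ _ "x - 1"]) auto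
  then have "Suc ` {1..} = {2..}" by auto
  then show ?case using fix1 by auto
next
  case (Suc r)
  have range: "letters r ` {1..} = {2..} - \<pi> ` {1..r}" using Suc by auto
  have target: "letters r (mu (Suc r)) = \<pi> (Suc r)"
    using letters_target_aux[OF _ _ range] Suc by simp
  let ?g = "\<lambda>j. if j < mu (Suc r) then j else Suc j"
  have l: "letters (Suc r) = letters r \<circ> ?g" using Suc.hyps by (simp add: fun_eq_iff)
  have "?g ` {1..} = {1..} - {mu (Suc r)}"
  proof
    show "{1..} - {mu (Suc r)} \<subseteq> ?g ` {1..}"
    proof
      fix x assume x: "x \<in> {1..} - {mu (Suc r)}"
      show "x \<in> ?g ` {1..}"
      proof (cases "x < mu (Suc r)")
        case True
        then show ?thesis using x by (intro image_eqI[of _ _ x]) auto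
      next
        case False
        then show ?thesis using x mu_pos[of "Suc r"] by (intro image_eqI[of _ _ "x - 1"]) auto
      qed
    qed
  qed auto
  then have "letters (Suc r) ` {1..} = letters r ` ({1..} - {mu (Suc r)})"
    unfolding l image_comp[symmetric] by simp
  also have "\<dots> = letters r ` {1..} - {letters r (mu (Suc r))}"
    using image_set_diff[OF strict_mono_imp_inj_on[OF strict_mono_letters], of r "{1..}" "{mu (Suc r)}"]
    by simp
  also have "\<dots> = {2..} - \<pi> ` {1..Suc r}"
    unfolding range target using Suc.hyps by (simp add: atLeastAtMostSuc_conv) blast
  finally show ?case .
qed

lemma letters_target: "1 \<le> r \<Longrightarrow> r \<le> n \<Longrightarrow> letters r (mu (Suc r)) = \<pi> (Suc r)"
  using letters_target_aux[OF _ _ letters_range] by simp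

text \<open>
  The condition on row \<open>r + 1\<close> under which the strand leaving it is the right one. Here \<open>J\<close> is the
  last column of the row that has an elbow further up; all columns to its left must be crosses, and
  a cross in column \<open>J\<close> itself is always ineffective if the row is to be correct.
\<close>

definition good_row :: "(nat \<times> nat) set \<Rightarrow> nat \<Rightarrow> bool" where
  "good_row D r \<longleftrightarrow> {mu (Suc r)<..} \<subseteq> cover D r \<and> (\<forall>j > mu (Suc r). (Suc r, j) \<notin> D) \<and>
     (\<exists>J \<in> cover D r. J \<le> mu (Suc r) \<and> (\<forall>j \<in> {J<..mu (Suc r)}. j \<notin> cover D r) \<and>
        (\<forall>j \<in> {1..<J}. (Suc r, j) \<in> D) \<and> (\<exists>j \<in> {J..mu (Suc r)}. (Suc r, j) \<notin> D))"

definition state :: "(nat \<times> nat) set \<Rightarrow> nat \<Rightarrow> bool" where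
  "state D r \<longleftrightarrow> (\<forall>j \<ge> 1. front D (Suc n) r (r + j) = rotated (letters r) (cover D r) j)"

text \<open>The strand entering column k in the first row comes from the top of the next elbow
  column to the right, so it is \<open>succ_in F k\<close>. It exceeds k, hence every cross of this
  row is effective.\<close>

lemma state_first_row:
  assumes D: "D \<subseteq> {1..Suc n} \<times> {1..Suc n}" and 11: "(1, 1) \<notin> D"
  shows "front D (Suc n) 1 1 = 1 \<and> state D 1"
proof -
  define F where "F = cover D 1"
  have F: "j \<in> F \<longleftrightarrow> (Suc 0, j) \<notin> D" if "1 \<le> j" for j using that by (auto simp: F_def cover_def)
  have cofin: "cofin F" unfolding F_def using D by (intro cofin_cover[of _ "Suc n"]) auto
  have large: "j \<in> F" if "Suc n < j" for j using D that F[of j] by auto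
  have "hecke_row D 0 (Suc n) id (Suc 0) = succ_in F 0 \<and>
    (\<forall>j \<ge> 1. hecke_row D 0 (Suc n) id (Suc (0 + j)) = rotated Suc F j)"
  proof (rule hecke_row_compute[where w = id and car = "succ_in F"])
    fix k :: nat assume k: "1 \<le> k" "k \<le> Suc n"
    then obtain k' where k': "k = Suc k'" by (cases k) auto
    show "if (Suc 0, k) \<in> D \<and> id k < succ_in F k
      then rotated Suc F k = id k \<and> succ_in F (k - 1) = succ_in F k
      else rotated Suc F k = succ_in F k \<and> succ_in F (k - 1) = id k"
      using F[OF k(1)] succ_in(2)[OF cofin, of k] succ_in_Suc[of k' F] succ_in_skip[of k' F]
      by (auto simp: rotated_def k')
  next
    show "id (Suc (0 + Suc n)) = succ_in F (Suc n)" by (simp add: succ_in_Suc large)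
    show "id (Suc (0 + j)) = rotated Suc F j" if "Suc n < j" for j
      using that by (simp add: rotated_def large succ_in_Suc)
  qed auto
  moreover have "succ_in F 0 = 1" using succ_in_Suc[of 0 F] F[of 1] 11 by simp
  ultimately show ?thesis by (simp add: state_def F_def)
qed

lemma state_Suc:
  assumes D: "D \<subseteq> {1..Suc n} \<times> {1..Suc n}" and r: "1 \<le> r" "r \<le> n"
    and st: "state D r" and good: "good_row D r"
  shows "front D (Suc n) (Suc r) (Suc r) = \<pi> (Suc r) \<and> state D (Suc r)"
proof -
  let ?\<mu> = "mu (Suc r)" and ?F = "{j. 1 \<le> j \<and> (Suc r, j) \<notin> D}"
  from good obtain J where J: "J \<in> cover D r" "J \<le> ?\<mu>" "\<forall>j \<in> {J<..?\<mu>}. j \<notin> cover D r"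
    "\<forall>j \<in> {1..<J}. (Suc r, j) \<in> D" "\<exists>j \<in> {J..?\<mu>}. (Suc r, j) \<notin> D"
    and large: "{?\<mu><..} \<subseteq> cover D r" "\<forall>j > ?\<mu>. (Suc r, j) \<notin> D"
    unfolding good_row_def by blast
  have J1: "1 \<le> J" using J(1) by (simp add: cover_def)
  have "hecke_row D r (Suc n) (front D (Suc n) r) (Suc r) = letters r ?\<mu> \<and>
    (\<forall>j \<ge> 1. hecke_row D r (Suc n) (front D (Suc n) r) (Suc (r + j)) =
       rotated (\<lambda>j. if j < ?\<mu> then letters r j else letters r (Suc j)) (cover D r \<union> ?F) j)"
  proof (rule hecke_row_rotated)
    show "J \<in> cover D r" "1 \<le> J" "J \<le> ?\<mu>" by fact+
    show "?\<mu> \<le> Suc n" using mu_le[OF r] by simp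
    show "{?\<mu><..} \<subseteq> ?F" using large(2) mu_pos[of "Suc r"] by auto
    show "J \<le> j" if "j \<in> ?F" for j using J(4) that by (metis (mono_tags) atLeastLessThan_iff mem_Collect_eq not_le)
    show "\<exists>j \<in> ?F. j \<le> ?\<mu>" using J(5) J1 by (metis (mono_tags, lifting) atLeastAtMost_iff le_trans mem_Collect_eq)
  qed (use st J large strict_mono_letters in \<open>auto simp: state_def\<close>)
  moreover have "letters (Suc r) = (\<lambda>j. if j < ?\<mu> then letters r j else letters r (Suc j))"
    using r by simp
  ultimately show ?thesis
    by (simp add: state_def cover_Suc letters_target[OF r] del: letters.simps)
qed

section \<open>Necessity of the row conditions\<close>

text \<open>
  Inversions of the front word persist until the end. Since $\pi'$ avoids 132 and the letter
  \<open>\<pi> (r + 1)\<close> leaves before all others, the two letters of a later inversion cannot both exceed it.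
\<close>

lemma later_inversion:
  assumes fr: "front D (Suc n) (Suc n) = \<pi>" and r: "1 \<le> r" "r \<le> s" "s \<le> Suc n"
    and xy: "r < x" "x < y" "front D (Suc n) s y < front D (Suc n) s x"
  shows "front D (Suc n) s y < \<pi> (Suc r)"
proof (rule ccontr)
  let ?f = "front D (Suc n) s"
  assume not_less: "\<not> ?thesis"
  have "(?f x, ?f y) \<in> invs ?f" using xy unfolding invs_def by blast
  then have "(?f x, ?f y) \<in> invs \<pi>" using invs_front_mono[OF r(3), of D "Suc n"] fr by auto
  then obtain p q where pq: "\<pi> p = ?f x" "\<pi> q = ?f y" "p < q" unfolding invs_def by auto
  have "r < p"
  proof (rule ccontr)
    assume "\<not> r < p"
    then have "\<pi> p = ?f p" using front_fixes[of s "Suc n" p D "Suc n"] fr r by simp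
    then have "p = x" using pq inj_front[of D "Suc n" s] by (simp add: inj_eq)
    then show False using xy \<open>\<not> r < p\<close> by simp
  qed
  moreover have "p \<noteq> Suc r" using not_less pq xy by auto
  ultimately have "Suc r < p" by simp
  moreover have "\<pi> (Suc r) < \<pi> q"
    using not_less pq \<pi>_inj[of "Suc r" q] \<open>Suc r < p\<close> by linarith
  ultimately show False using avoids_132[of "Suc r" p q] pq xy r by simp
qed

lemma letters_less: "letters r x < letters r y \<longleftrightarrow> x < y"
  using strict_mono_letters by (rule strict_mono_less)

text \<open>A violated clause either produces an inversion of two letters not below
  \<open>\<pi> (Suc r)\<close>, contrary to \<open>later_inversion\<close>, or lets a wrong letter
  leave the row.\<close>

lemma good_row_necessary:
  assumes D: "D \<subseteq> {1..Suc n} \<times> {1..Suc n}" and r: "1 \<le> r" "r \<le> n"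
    and st: "state D r" and 11: "(1, 1) \<notin> D" and fr: "front D (Suc n) (Suc n) = \<pi>"
  shows "good_row D r"
proof -
  define \<mu> where "\<mu> = mu (Suc r)"
  define C where "C = cover D r"
  define w where "w = rotated (letters r) C"
  define T where "T = letters r"
  have T_less: "T x < T y \<longleftrightarrow> x < y" for x y unfolding T_def by (rule letters_less)
  have T\<mu>: "T \<mu> = \<pi> (Suc r)" using letters_target[OF r] by (simp add: \<mu>_def T_def)
  have w: "front D (Suc n) r (r + j) = w j" if "1 \<le> j" for j
    using st that by (simp add: state_def w_def C_def)
  have w_inj: "x = y" if "w x = w y" "1 \<le> x" "1 \<le> y" for x y
    using w[of x] w[of y] that inj_front[of D "Suc n" r] by (metis add_left_cancel injD)
  have cofin: "cofin C" unfolding C_def using D r by (intro cofin_cover[of _ "Suc n"])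
  have 1: "1 \<in> C" using 11 r by (auto simp: C_def cover_def)
  have \<mu>: "1 \<le> \<mu>" "\<mu> \<le> n" using mu_pos[of "Suc r"] mu_le[OF r] r by (auto simp: \<mu>_def)

  \<comment> \<open>A column j beyond \<mu> without an elbow would lie in a block with an earlier
    head c. Then the larger letter of the head precedes T (j - 1), which is not below T
    \<mu>.\<close>
  have C_large: "j \<in> C" if "\<mu> < j" for j
  proof (rule ccontr)
    assume j: "j \<notin> C"
    define c where "c = Max {c \<in> C. c < j}"
    have "1 < j" using that \<mu> by simp
    then have "c \<in> {c \<in> C. c < j}" unfolding c_def using 1 by (intro Max_in) auto
    moreover have c_max: "d \<le> c" if "d \<in> C" "d < j" for d
      unfolding c_def using that by (intro Max_ge) auto
    ultimately have c: "c \<in> C" "c < j" "1 \<le> c" by (auto simp: C_def cover_def)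
    have "\<not> succ_in C c \<le> j" using succ_in[OF cofin, of c] c_max j by (metis le_neq_implies_less not_less)
    then have "w j < w c" using c j T_less by (simp add: w_def rotated_def T_def[symmetric])
    then have "w j < \<pi> (Suc r)"
      using later_inversion[OF fr r(1) order.refl _ _ _, of "r + c" "r + j"] c r w[of c] w[of j] by simp
    then show False using j that T_less by (simp add: w_def rotated_def T_def[symmetric] flip: T\<mu>)
  qed
  have w_large: "w j = T j" if "\<mu> < j" for j
    using that C_large[of j] C_large[of "Suc j"] by (simp add: w_def rotated_def T_def succ_in_Suc)

  have w_all: "\<forall>j \<ge> 1. front D (Suc n) r (r + j) = w j" using w by blast
  obtain car w' where step_all: "\<forall>k. 1 \<le> k \<longrightarrow> k \<le> Suc n \<longrightarrow>
      (if (Suc r, k) \<in> D \<and> w k < car k then w' k = w k \<and> car (k - 1) = car k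
       else w' k = car k \<and> car (k - 1) = w k)"
    and last: "car (Suc n) = w (Suc (Suc n))"
    and out: "hecke_row D r (Suc n) (front D (Suc n) r) (Suc r) = car 0"
    and w'_all: "\<forall>j. 1 \<le> j \<longrightarrow> hecke_row D r (Suc n) (front D (Suc n) r) (Suc (r + j)) = w' j"
    using hecke_row_carry[where f = "front D (Suc n) r" and r = r and w = w and m = "Suc n" and D = D, OF w_all]
    by (elim exE conjE)
  note step = step_all[rule_format] and w' = w'_all[rule_format]
  have "front D (Suc n) (Suc r) (Suc r) = \<pi> (Suc r)"
    using front_fixes[of "Suc r" "Suc n" "Suc r" D "Suc n"] fr r by simp
  then have car0: "car 0 = T \<mu>" using out T\<mu> by simp

  \<comment> \<open>The rightmost cross j0 beyond \<mu> leaves T j0 in its column and passes on the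
    larger T (j0 + 1). This is not the letter that leaves the row, so it is dropped further left: an
    inversion of letters above T \<mu>.\<close>
  have F_large: "(Suc r, j) \<notin> D" if "\<mu> < j" for j
  proof
    assume "(Suc r, j) \<in> D"
    define j0 where "j0 = Max {j. (Suc r, j) \<in> D}"
    have fin: "finite {j. (Suc r, j) \<in> D}"
      by (rule finite_subset[of _ "{1..Suc n}"]) (use D in auto)
    have "(Suc r, j0) \<in> D" "\<mu> < j0"
      using Max_in[OF fin] Max_ge[OF fin, of j] \<open>(Suc r, j) \<in> D\<close> that
      by (auto simp: j0_def[symmetric])
    moreover from this have "j0 \<le> Suc n" using D by auto
    ultimately have j0: "(Suc r, j0) \<in> D" "\<mu> < j0" "j0 \<le> Suc n" by auto
    have "(Suc r, Suc j0) \<notin> D" using Max_ge[OF fin, of "Suc j0"] by (auto simp: j0_def[symmetric])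
    then have car: "car j0 = T (Suc j0)"
      using step[of "Suc j0"] last w_large[of "Suc j0"] j0 by (cases "j0 = Suc n") auto
    have step0: "w' j0 = T j0" "car (j0 - 1) = T (Suc j0)"
      using step[of j0] j0 car w_large[of j0] T_less[of j0 "Suc j0"] by simp_all
    have carry: "car k = car 0 \<or> (\<exists>p \<in> {1..k}. w' p = car k)" if "k \<le> Suc n" for k
      using that
    proof (induction k)
      case (Suc k)
      then show ?case using step[of "Suc k"] by (cases "w' (Suc k) = car (Suc k)") (auto split: if_splits)
    qed simp
    have "car (j0 - 1) \<noteq> car 0" using step0 car0 T_less[of \<mu> "Suc j0"] j0 by auto
    moreover have "j0 - 1 \<le> Suc n" using j0 by simp
    ultimately have "\<exists>p \<in> {1..j0 - 1}. w' p = T (Suc j0)" using carry[of "j0 - 1"] step0(2) by metis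
    then obtain p where p: "p \<in> {1..j0 - 1}" "w' p = T (Suc j0)" by blast
    have "front D (Suc n) (Suc r) (Suc r + j0) < \<pi> (Suc r)"
      using p j0 r w'[of p] w'[of j0] step0 T_less[of j0 "Suc j0"]
      by (intro later_inversion[OF fr r(1), of _ "Suc r + p"]) auto
    then show False using w'[of j0] step0 T_less[of j0 \<mu>] j0 by (simp flip: T\<mu>)
  qed

  define J where "J = Max {c \<in> C. c \<le> \<mu>}"
  have "J \<in> {c \<in> C. c \<le> \<mu>}" unfolding J_def using 1 \<mu> by (intro Max_in) auto
  then have J: "J \<in> C" "J \<le> \<mu>" "1 \<le> J" by (auto simp: C_def cover_def)
  have J_max: "j \<notin> C" if "J < j" "j \<le> \<mu>" for j
  proof
    assume "j \<in> C"
    then have "j \<le> J" unfolding J_def using that by (intro Max_ge) auto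
    then show False using that by simp
  qed
  have "succ_in C J = Suc \<mu>"
    by (rule succ_in_eqI) (use J J_max C_large in \<open>auto simp: not_less_eq_eq[symmetric]\<close>)
  then have wJ: "w J = T \<mu>" using J by (simp add: w_def rotated_def T_def)

  \<comment> \<open>After an elbow in column j, the carried letter always stems from one of the
    columns 1, ..., j. It cannot be T \<mu>, which sits in column J.\<close>
  have F_small: "(Suc r, j) \<in> D" if "1 \<le> j" "j < J" for j
  proof (rule ccontr)
    assume j: "(Suc r, j) \<notin> D"
    have "\<exists>p \<in> {1..j}. car k = w p" if "k < j" for k
      using that
    proof (induction "j - k" arbitrary: k)
      case (Suc d)
      show ?case
      proof (cases "Suc k = j")
        case True
        then show ?thesis using step[of j] j \<open>j < J\<close> J \<mu> by auto
      next
        case False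
        then have "\<exists>p \<in> {1..j}. car (Suc k) = w p" using Suc by auto
        then show ?thesis using step[of "Suc k"] Suc.prems \<open>j < J\<close> J \<mu> by (auto split: if_splits)
      qed
    qed simp
    from this[of 0] have "\<exists>p \<in> {1..j}. w p = w J" using that car0 wJ by force
    then obtain p where "p \<in> {1..j}" "w p = w J" by blast
    then show False using w_inj[of p J] that by simp
  qed

  \<comment> \<open>With crosses only, T (\<mu> + 1) would pass over smaller letters all the way and
    leave the row.\<close>
  have "\<exists>j \<in> {J..\<mu>}. (Suc r, j) \<notin> D"
  proof (rule ccontr)
    assume "\<not> ?thesis"
    then have all: "(Suc r, j) \<in> D" if "1 \<le> j" "j \<le> \<mu>" for j
      using F_small that by (metis atLeastAtMost_iff not_le)
    have w_le: "w j < T (Suc \<mu>)" if "1 \<le> j" "j \<le> \<mu>" for j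
    proof (cases "j \<in> C")
      case True
      have "succ_in C j \<le> Suc \<mu>" using that C_large by (intro succ_in_le) auto
      then show ?thesis using True succ_in(2)[OF cofin, of j]
        by (auto simp: w_def rotated_def T_less simp flip: T_def)
    next
      case False
      then show ?thesis using that by (auto simp: w_def rotated_def T_less simp flip: T_def)
    qed
    have "car k = T (Suc \<mu>)" if "k \<le> \<mu>" for k
      using that
    proof (induction "\<mu> - k" arbitrary: k)
      case 0
      then have "k = \<mu>" by simp
      then show ?case using step[of "Suc \<mu>"] F_large[of "Suc \<mu>"] w_large[of "Suc \<mu>"] \<mu> by simp
    next
      case (Suc d)
      then show ?case using Suc.hyps(1)[of "Suc k"] step[of "Suc k"] all[of "Suc k"] w_le[of "Suc k"] \<mu>
        by (auto split: if_splits)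
    qed
    then have "car 0 = T (Suc \<mu>)" by simp
    then show False using car0 T_less[of \<mu> "Suc \<mu>"] by simp
  qed
  moreover have "{\<mu><..} \<subseteq> C" "\<forall>j > \<mu>. (Suc r, j) \<notin> D" "\<forall>j \<in> {J<..\<mu>}. j \<notin> C"
    "\<forall>j \<in> {1..<J}. (Suc r, j) \<in> D"
    using C_large F_large J_max F_small by auto
  ultimately show ?thesis
    unfolding good_row_def \<mu>_def[symmetric] C_def[symmetric] using J by blast
qed

text \<open>In the first row the carried letter exceeds the index of the column it enters. A cross
  in the corner would thus be effective, and a letter other than 1 would leave.\<close>

lemma first_cell_elbow:
  assumes fr: "front D (Suc n) (Suc n) = \<pi>"
  shows "(1, 1) \<notin> D"
proof
  assume 11: "(1, 1) \<in> D"
  have id_all: "\<forall>j \<ge> 1. id (0 + j) = (id j :: nat)" by simp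
  obtain car w' where step_all: "\<forall>k. 1 \<le> k \<longrightarrow> k \<le> Suc n \<longrightarrow>
      (if (Suc 0, k) \<in> D \<and> id k < car k then w' k = id k \<and> car (k - 1) = car k
       else w' k = car k \<and> car (k - 1) = id k)"
    and last: "car (Suc n) = id (Suc (Suc n))"
    and out: "hecke_row D 0 (Suc n) id (Suc 0) = car 0"
    using hecke_row_carry[where f = id and r = 0 and w = id and m = "Suc n" and D = D, OF id_all]
    by (elim exE conjE)
  note step = step_all[rule_format]
  have "k < car k" if "k \<le> Suc n" for k
    using that
  proof (induction "Suc n - k" arbitrary: k)
    case 0
    then show ?case using last by simp
  next
    case (Suc d)
    then have "k \<le> n" by linarith
    then have "Suc k < car (Suc k)" using Suc by simp
    then show ?case using step[of "Suc k"] \<open>k \<le> n\<close> by (auto split: if_splits)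
  qed
  from this[of 1] have "car 0 > 1" using step[of 1] 11 by auto
  moreover have "front D (Suc n) (Suc 0) (Suc 0) = \<pi> (Suc 0)"
    using front_fixes[of "Suc 0" "Suc n" "Suc 0" D "Suc n"] fr by simp
  ultimately show False using out fix1 by simp
qed

text \<open>In one direction the conditions are extracted row by row, because their necessity in a
  row presupposes the state reached after the rows above. In the other direction the states yield
  the exit letters.\<close>

lemma PD_iff_good:
  "D \<in> PD (Suc n) \<pi> \<longleftrightarrow> D \<subseteq> {1..Suc n} \<times> {1..Suc n} \<and> (\<forall>(i, j) \<in> D. i + j \<le> Suc n) \<and>
     (1, 1) \<notin> D \<and> (\<forall>r \<in> {1..n}. good_row D r)" (is "?L \<longleftrightarrow> ?R")
proof
  assume ?L
  then have D: "D \<subseteq> {1..Suc n} \<times> {1..Suc n}" "\<forall>(i, j) \<in> D. i + j \<le> Suc n"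
    and fr: "front D (Suc n) (Suc n) = \<pi>"
    by (auto simp: PD_iff_front[OF perm] simp del: front.simps)
  note 11 = first_cell_elbow[OF fr]
  have "state D (Suc r)" if "r \<le> n" for r
    using that
  proof (induction r)
    case 0
    then show ?case using state_first_row[OF D(1) 11] by simp
  next
    case (Suc r)
    then have "state D (Suc r)" by simp
    then show ?case
      using state_Suc[OF D(1), of "Suc r"] good_row_necessary[OF D(1) _ _ _ 11 fr, of "Suc r"] Suc.prems
      by simp
  qed
  then have "good_row D r" if "r \<in> {1..n}" for r
    using good_row_necessary[OF D(1) _ _ _ 11 fr, of r] that by (cases r) auto
  then show ?R using D 11 by blast
next
  assume R: ?R
  then have D: "D \<subseteq> {1..Suc n} \<times> {1..Suc n}" "\<forall>(i, j) \<in> D. i + j \<le> Suc n" and 11: "(1, 1) \<notin> D"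
    and good: "\<And>r. 1 \<le> r \<Longrightarrow> r \<le> n \<Longrightarrow> good_row D r" by auto
  have *: "state D (Suc r) \<and> front D (Suc n) (Suc r) (Suc r) = \<pi> (Suc r)" if "r \<le> n" for r
    using that
  proof (induction r)
    case 0
    then show ?case using state_first_row[OF D(1) 11] fix1 by simp
  next
    case (Suc r)
    then have "state D (Suc r)" by simp
    then show ?case
      using state_Suc[OF D(1), of "Suc r"] good[of "Suc r"] Suc.prems by simp
  qed
  have "left_reading (Suc n) D i = \<pi> i" if "i \<in> {1..Suc n}" for i
  proof -
    have "front D (Suc n) (Suc n) i = front D (Suc n) i i"
      using that by (intro front_fixes) auto
    also have "\<dots> = \<pi> i" using *[of "i - 1"] that by (cases i) (auto simp del: front.simps)
    finally show ?thesis using left_reading_eq_front[OF that] by simp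
  qed
  then show ?L unfolding PD_def using D by (auto simp: less_Suc_eq_le)
qed

lemma reduced_iff_card:
  assumes "D \<in> PD (Suc n) \<pi>"
  shows "reduced (Suc n) D \<longleftrightarrow> card D = card (invs \<pi>)"
  using assms reduced_iff[of D "Suc n"] by (auto simp: PD_iff_front[OF perm] simp del: front.simps)

end

subsection \<open>Noncrossing assignments of columns to rows\<close>

text \<open>In terms of elbows: a column j' to the right of j that is covered before row \<tau> j
  must lie beyond the end of this row, since the row has only crosses to the left of its last
  covered column.\<close>

definition noncrossing :: "(nat \<Rightarrow> nat) \<Rightarrow> nat \<Rightarrow> (nat \<Rightarrow> nat) \<Rightarrow> bool" where
  "noncrossing mu c \<tau> \<longleftrightarrow> (\<forall>j \<in> {2..c}. j \<le> mu (\<tau> j)) \<and>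
     (\<forall>j \<in> {2..c}. \<forall>j' \<in> {2..c}. j < j' \<longrightarrow> \<tau> j' < \<tau> j \<longrightarrow> mu (\<tau> j) < j')"

lemma noncrossingD:
  "noncrossing mu c \<tau> \<Longrightarrow> j \<in> {2..c} \<Longrightarrow> j' \<in> {2..c} \<Longrightarrow> j < j' \<Longrightarrow> \<tau> j' < \<tau> j \<Longrightarrow> mu (\<tau> j) < j'"
  unfolding noncrossing_def by blast

lemma noncrossing_le: "noncrossing mu c \<tau> \<Longrightarrow> j \<in> {2..c} \<Longrightarrow> j \<le> mu (\<tau> j)"
  unfolding noncrossing_def by blast

text \<open>
  The last column has to go to the last row that reaches it and still has a positive count. This
  greedy rule also explains uniqueness.
\<close>

lemma noncrossing_exists:
  fixes mu p :: "nat \<Rightarrow> nat"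
  assumes "(\<Sum>i = 1..n. p i) = c" and "\<And>k. k \<in> {1..n} \<Longrightarrow> (\<Sum>i = k..n. p i) < mu k"
  shows "\<exists>\<tau>. noncrossing mu (Suc c) \<tau> \<and> \<tau> ` {2..Suc c} \<subseteq> {1..n} \<and>
    (\<forall>i \<in> {1..n}. card {j \<in> {2..Suc c}. \<tau> j = i} = p i)"
  using assms
proof (induction c arbitrary: p)
  case 0
  then show ?case by (auto simp: noncrossing_def)
next
  case (Suc c)
  define S where "S = {i \<in> {1..n}. Suc (Suc c) \<le> mu i \<and> 0 < p i}"
  have "S \<noteq> {}"
  proof -
    have "{i \<in> {1..n}. 0 < p i} \<noteq> {}"
    proof
      assume "{i \<in> {1..n}. 0 < p i} = {}"
      then have "(\<Sum>i = 1..n. p i) = 0" by auto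
      then show False using Suc.prems(1) by simp
    qed
    \<comment> \<open>All positive counts belong to rows from k on, so the bound on the sum from k
      on says that row k reaches column c + 2.\<close>
    define k where "k = Min {i \<in> {1..n}. 0 < p i}"
    have "k \<in> {i \<in> {1..n}. 0 < p i}"
      unfolding k_def using \<open>_ \<noteq> {}\<close> by (intro Min_in) auto
    then have k: "k \<in> {1..n}" "0 < p k" by auto
    have "p i = 0" if "i \<in> {1..n}" "i < k" for i
    proof (rule ccontr)
      assume "p i \<noteq> 0"
      then have "k \<le> i" unfolding k_def using that by (intro Min_le) auto
      then show False using that by simp
    qed
    then have "(\<Sum>i = 1..n. p i) = (\<Sum>i = k..n. p i)"
      using k by (intro sum.mono_neutral_right) auto
    then have "Suc c < mu k" using Suc.prems k(1) by metis
    then have "k \<in> S" using k by (simp add: S_def)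
    then show ?thesis by blast
  qed
  define m where "m = Max S"
  have "m \<in> S" unfolding m_def using \<open>S \<noteq> {}\<close> by (intro Max_in) (auto simp: S_def)
  then have m: "m \<in> {1..n}" "Suc (Suc c) \<le> mu m" "0 < p m" by (auto simp: S_def)
  have m_max: "i \<le> m" if "i \<in> S" for i
    unfolding m_def using that by (intro Max_ge) (auto simp: S_def)
  define p' where "p' = p(m := p m - 1)"
  have p: "p i = p' i + (if i = m then 1 else 0)" for i using m by (simp add: p'_def)
  have "(\<Sum>i = 1..n. p i) = (\<Sum>i = 1..n. p' i) + 1"
    unfolding p sum.distrib using m by simp
  then have "(\<Sum>i = 1..n. p' i) = c" using Suc.prems by simp
  moreover have "(\<Sum>i = k..n. p' i) < mu k" if "k \<in> {1..n}" for k
  proof -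
    have "(\<Sum>i = k..n. p' i) \<le> (\<Sum>i = k..n. p i)" by (intro sum_mono) (simp add: p)
    then show ?thesis using Suc.prems(2)[OF that] by simp
  qed
  ultimately obtain \<tau> where \<tau>: "noncrossing mu (Suc c) \<tau>" "\<tau> ` {2..Suc c} \<subseteq> {1..n}"
    "\<forall>i \<in> {1..n}. card {j \<in> {2..Suc c}. \<tau> j = i} = p' i"
    using Suc.IH[of p'] by blast
  define \<tau>' where "\<tau>' = \<tau>(Suc (Suc c) := m)"
  have atLeast: "{2..Suc (Suc c)} = insert (Suc (Suc c)) {2..Suc c}" by auto
  have \<tau>': "\<tau>' j = \<tau> j" if "j \<in> {2..Suc c}" for j using that by (auto simp: \<tau>'_def)
  \<comment> \<open>A row that owns a column and reaches the new one has a positive count, so it was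
    a candidate for \<open>m\<close>.\<close>
  have top: "\<tau> j \<le> m" if "j \<in> {2..Suc c}" "Suc (Suc c) \<le> mu (\<tau> j)" for j
  proof -
    have "card {x \<in> {2..Suc c}. \<tau> x = \<tau> j} \<noteq> 0" using that by auto
    moreover have "\<tau> j \<in> {1..n}" using that \<tau>(2) by blast
    ultimately have "0 < p' (\<tau> j)" using \<tau>(3) by (metis gr0I)
    then have "\<tau> j \<in> S" using that \<open>\<tau> j \<in> {1..n}\<close> p[of "\<tau> j"] by (auto simp: S_def)
    then show ?thesis by (rule m_max)
  qed
  have "noncrossing mu (Suc (Suc c)) \<tau>'"
    unfolding noncrossing_def
  proof (intro conjI ballI impI)
    fix j assume "j \<in> {2..Suc (Suc c)}"
    then show "j \<le> mu (\<tau>' j)"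
      using \<tau>(1) m unfolding noncrossing_def by (cases "j = Suc (Suc c)") (auto simp: \<tau>'_def)
  next
    fix j j' assume j: "j \<in> {2..Suc (Suc c)}" "j' \<in> {2..Suc (Suc c)}" "j < j'" "\<tau>' j' < \<tau>' j"
    show "mu (\<tau>' j) < j'"
    proof (cases "j' = Suc (Suc c)")
      case True
      then have "m < \<tau> j" using j \<tau>'[of j] by (simp add: \<tau>'_def)
      then show ?thesis using top[of j] j True \<tau>'[of j] by (auto simp: not_le[symmetric])
    next
      case False
      then show ?thesis using \<tau>(1) j \<tau>'[of j] \<tau>'[of j'] unfolding noncrossing_def by auto
    qed
  qed
  moreover have "\<tau>' ` {2..Suc (Suc c)} \<subseteq> {1..n}"
    using \<tau>(2) m by (auto simp: \<tau>'_def)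
  moreover have "card {j \<in> {2..Suc (Suc c)}. \<tau>' j = i} = p i" if "i \<in> {1..n}" for i
  proof -
    have "{j \<in> {2..Suc (Suc c)}. \<tau>' j = i} =
      (if i = m then insert (Suc (Suc c)) {j \<in> {2..Suc c}. \<tau> j = i} else {j \<in> {2..Suc c}. \<tau> j = i})"
      unfolding atLeast by (auto simp: \<tau>'_def)
    then show ?thesis using \<tau>(3) that by (auto simp: p)
  qed
  ultimately show ?case by blast
qed

lemma noncrossing_unique:
  assumes "noncrossing mu c \<tau>" "noncrossing mu c \<tau>'"
    and "\<And>i. card {j \<in> {2..c}. \<tau> j = i} = card {j \<in> {2..c}. \<tau>' j = i}"
    and "j \<in> {2..c}"
  shows "\<tau> j = \<tau>' j"
  using assms
proof (induction c)
  case (Suc c)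
  \<comment> \<open>If \<open>\<sigma>'\<close> puts the top column into a later row than
    \<open>\<sigma>\<close> does, equal counts make \<open>\<sigma>\<close> use that row for a
    smaller column. Noncrossing of \<open>\<sigma>\<close> then makes the row too short for the top
    column.\<close>
  have top: "\<not> \<sigma> (Suc c) < \<sigma>' (Suc c)"
    if "noncrossing mu (Suc c) \<sigma>" "noncrossing mu (Suc c) \<sigma>'" "2 \<le> Suc c"
      "\<And>i. card {j \<in> {2..Suc c}. \<sigma> j = i} = card {j \<in> {2..Suc c}. \<sigma>' j = i}" for \<sigma> \<sigma>'
  proof
    assume less: "\<sigma> (Suc c) < \<sigma>' (Suc c)"
    have "card {j \<in> {2..Suc c}. \<sigma>' j = \<sigma>' (Suc c)} \<noteq> 0" using that(3) by auto
    then have "card {j \<in> {2..Suc c}. \<sigma> j = \<sigma>' (Suc c)} \<noteq> 0" using that(4) by simp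
    then have "{j \<in> {2..Suc c}. \<sigma> j = \<sigma>' (Suc c)} \<noteq> {}" by (metis card.empty)
    then obtain j where j: "j \<in> {2..Suc c}" "\<sigma> j = \<sigma>' (Suc c)" by blast
    then have "j < Suc c" using less by (cases "j = Suc c") auto
    then have "mu (\<sigma> j) < Suc c" using noncrossingD[OF that(1), of j "Suc c"] that(3) j less by simp
    then show False using noncrossing_le[OF that(2), of "Suc c"] that(3) j(2) by simp
  qed
  have c: "2 \<le> Suc c" using Suc.prems by auto
  have eq: "\<tau> (Suc c) = \<tau>' (Suc c)"
    using top[OF Suc.prems(1,2) c Suc.prems(3)] top[OF Suc.prems(2,1) c Suc.prems(3)[symmetric]]
    by simp
  show ?case
  proof (cases "j = Suc c")
    case False
    have count: "card {j \<in> {2..Suc c}. \<sigma> j = i} =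
      card {j \<in> {2..c}. \<sigma> j = i} + (if \<sigma> (Suc c) = i then 1 else 0)" for \<sigma> i
    proof -
      have "{j \<in> {2..Suc c}. \<sigma> j = i} =
        (if \<sigma> (Suc c) = i then insert (Suc c) {j \<in> {2..c}. \<sigma> j = i} else {j \<in> {2..c}. \<sigma> j = i})"
        using c by (auto simp: le_Suc_eq)
      then show ?thesis by auto
    qed
    show ?thesis
    proof (rule Suc.IH)
      show "noncrossing mu c \<tau>" "noncrossing mu c \<tau>'"
        using Suc.prems(1,2) unfolding noncrossing_def by auto
      show "card {j \<in> {2..c}. \<tau> j = i} = card {j \<in> {2..c}. \<tau>' j = i}" for i
        using Suc.prems(3)[of i] count[of \<tau> i] count[of \<tau>' i] eq by simp
      show "j \<in> {2..c}" using Suc.prems(4) False by auto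
    qed
  qed (use eq in simp)
qed simp

section \<open>Pipe dreams as assignments of columns with ineffective crosses\<close>

context one_dominant
begin

text \<open>
  Pipe dreams are encoded by the row \<open>\<tau> j\<close> of the first elbow in each column \<open>j\<close> and the set \<open>e\<close> of
  rows with an ineffective cross. Column 1 always has its first elbow in row 1, so \<open>\<tau> 1\<close> is
  irrelevant.
\<close>

definition last_covered :: "(nat \<Rightarrow> nat) \<Rightarrow> nat \<Rightarrow> nat" where
  "last_covered \<tau> i = Max (insert 1 {j \<in> {2..mu i}. \<tau> j < i})"

definition dream :: "(nat \<Rightarrow> nat) \<Rightarrow> nat set \<Rightarrow> (nat \<times> nat) set" where
  "dream \<tau> e = {(i, j). i \<in> {1..n} \<and> j \<in> {1..mu i} \<and> \<not> (2 \<le> j \<and> \<tau> j = i) \<and>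
     \<not> (j = last_covered \<tau> i \<and> i \<notin> e)}"

text \<open>Row 1 has no ineffective cross because its corner is an elbow. In any other row such a
  cross replaces the elbow in the last covered column, so the row needs a first elbow further
  right.\<close>

definition valid :: "(nat \<Rightarrow> nat) \<Rightarrow> nat set \<Rightarrow> bool" where
  "valid \<tau> e \<longleftrightarrow> noncrossing mu (mu 1) \<tau> \<and> \<tau> ` {2..mu 1} \<subseteq> {1..n} \<and> e \<subseteq> {2..n} \<and>
     e \<subseteq> \<tau> ` {2..mu 1}"

lemma mu_le_mu1: "1 \<le> i \<Longrightarrow> mu i \<le> mu 1"
  by (rule mu_antimono)

lemma last_covered:
  shows "last_covered \<tau> i = 1 \<or> (2 \<le> last_covered \<tau> i \<and> \<tau> (last_covered \<tau> i) < i)"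
    and "1 \<le> last_covered \<tau> i" "last_covered \<tau> i \<le> mu i"
    and "2 \<le> j \<Longrightarrow> j \<le> mu i \<Longrightarrow> \<tau> j < i \<Longrightarrow> j \<le> last_covered \<tau> i"
proof -
  let ?S = "insert 1 {j \<in> {2..mu i}. \<tau> j < i}"
  have "last_covered \<tau> i \<in> ?S" unfolding last_covered_def by (intro Max_in) auto
  then show "last_covered \<tau> i = 1 \<or> (2 \<le> last_covered \<tau> i \<and> \<tau> (last_covered \<tau> i) < i)"
    "1 \<le> last_covered \<tau> i" "last_covered \<tau> i \<le> mu i"
    using mu_pos[of i] by auto
  show "j \<le> last_covered \<tau> i" if "2 \<le> j" "j \<le> mu i" "\<tau> j < i"
    unfolding last_covered_def using that by (intro Max_ge) auto
qed

lemma last_covered_eqI: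
  assumes "J = 1 \<or> (2 \<le> J \<and> \<tau> J < i)" "J \<le> mu i"
    and "\<And>j. J < j \<Longrightarrow> j \<le> mu i \<Longrightarrow> \<not> \<tau> j < i"
  shows "last_covered \<tau> i = J"
proof (rule order.antisym)
  show "last_covered \<tau> i \<le> J"
    using last_covered(1,3)[of \<tau> i] assms(1) assms(3)[of "last_covered \<tau> i"] by force
  show "J \<le> last_covered \<tau> i"
    using assms(1,2) last_covered(2)[of \<tau> i] last_covered(4)[of J i \<tau>] by metis
qed

lemma dream_cong:
  assumes "\<And>j. j \<in> {2..mu 1} \<Longrightarrow> \<tau> j = \<tau>' j"
  shows "dream \<tau> e = dream \<tau>' e"
proof -
  have eq: "\<tau> j = \<tau>' j" if "1 \<le> i" "2 \<le> j" "j \<le> mu i" for i j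
    using assms that mu_le_mu1[of i] by auto
  then have last: "last_covered \<tau> i = last_covered \<tau>' i" if "1 \<le> i" for i
    unfolding last_covered_def using that
    by (intro arg_cong[where f = Max] arg_cong2[where f = insert] refl Collect_cong)
      (metis One_nat_def atLeastAtMost_iff)
  have "(i, j) \<in> dream \<tau> e \<longleftrightarrow> (i, j) \<in> dream \<tau>' e" for i j
    using eq[of i j] last[of i] by (auto simp: dream_def)
  then show ?thesis by auto
qed

text \<open>The elbows of row i inside the enlarged diagram are its first elbows and, unless i is in
  \<open>e\<close>, the one in the last covered column.\<close>

lemma card_dream_row:
  assumes "valid \<tau> e" "i \<in> {1..n}"
  shows "card {j. (i, j) \<in> dream \<tau> e} + card {j \<in> {2..mu 1}. \<tau> j = i} + 1 = mu i + (if i \<in> e then 1 else 0)"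
proof -
  have nc: "noncrossing mu (mu 1) \<tau>" using assms by (simp add: valid_def)
  let ?J = "last_covered \<tau> i"
  let ?E = "{j \<in> {2..mu 1}. \<tau> j = i}"
  have E: "?E \<subseteq> {1..mu i}" using noncrossing_le[OF nc] by auto
  have J: "?J \<in> {1..mu i}" "?J \<notin> ?E" using last_covered(1-3)[of \<tau> i] by auto
  have row: "{j. (i, j) \<in> dream \<tau> e} = {1..mu i} - (?E \<union> (if i \<in> e then {} else {?J}))"
    using assms(2) mu_le_mu1[of i] by (auto simp: dream_def)
  have "card {j. (i, j) \<in> dream \<tau> e} + card (?E \<union> (if i \<in> e then {} else {?J})) = mu i"
    unfolding row using E J card_mono[of "{1..mu i}" "?E \<union> (if i \<in> e then {} else {?J})"]
    by (subst card_Diff_subset) (auto split: if_splits)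
  then show ?thesis using J by (auto split: if_splits)
qed

lemma PD_imp_dream:
  assumes "D \<in> PD (Suc n) \<pi>"
  shows "\<exists>\<tau> e. valid \<tau> e \<and> D = dream \<tau> e"
proof -
  have D: "D \<subseteq> {1..Suc n} \<times> {1..Suc n}" "\<forall>(i, j) \<in> D. i + j \<le> Suc n" and 11: "(1, 1) \<notin> D"
    and good: "\<And>r. r \<in> {1..n} \<Longrightarrow> good_row D r"
    using assms unfolding PD_iff_good by auto
  define \<tau> where "\<tau> j = (LEAST i. 1 \<le> i \<and> (i, j) \<notin> D)" for j
  define e where "e = {i \<in> {2..n}. (i, last_covered \<tau> i) \<in> D}"
  \<comment> \<open>Row n + 2 lies outside the matrix, so \<tau> is defined for every
    column.\<close>
  have ex: "\<exists>i. 1 \<le> i \<and> (i, j) \<notin> D" for j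
    using D(1) by (intro exI[of _ "Suc (Suc n)"]) auto
  have \<tau>: "1 \<le> \<tau> j" "(\<tau> j, j) \<notin> D" for j
    using LeastI_ex[OF ex[of j]] by (auto simp: \<tau>_def)
  have \<tau>_le: "\<tau> j \<le> i" if "1 \<le> i" "(i, j) \<notin> D" for i j
    unfolding \<tau>_def using that by (intro Least_le) auto
  have cover: "j \<in> cover D r \<longleftrightarrow> 1 \<le> j \<and> \<tau> j \<le> r" for j r
    unfolding cover_def mem_Collect_eq
    using \<tau>[of j] \<tau>_le[of _ j] by (meson atLeastAtMost_iff order.trans)
  have \<tau>1: "\<tau> 1 = 1" using \<tau>_le[of 1 1] 11 \<tau>(1)[of 1] by simp
  \<comment> \<open>Row n + 1 is included; its length is 1, so all columns from 2 on are covered by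
    row n.\<close>
  have large: "\<tau> j < i" if "2 \<le> i" "i \<le> Suc n" "mu i < j" for i j
  proof -
    have "i - 1 \<in> {1..n}" "Suc (i - 1) = i" using that by auto
    then have "good_row D (i - 1)" "Suc (i - 1) = i" using good by blast+
    then have "j \<in> cover D (i - 1)" using that unfolding good_row_def by auto
    then show ?thesis using cover that by auto
  qed
  have row: "(\<forall>j > mu i. (i, j) \<notin> D) \<and> (\<forall>j \<in> {1..<last_covered \<tau> i}. (i, j) \<in> D) \<and>
      (\<exists>j \<in> {last_covered \<tau> i..mu i}. (i, j) \<notin> D)" if "2 \<le> i" "i \<le> n" for i
  proof -
    have i: "Suc (i - 1) = i" using that by simp
    have "i - 1 \<in> {1..n}" using that by auto
    then have "good_row D (i - 1)" by (rule good)
    then obtain J where J: "J \<in> cover D (i - 1)" "J \<le> mu i" "\<forall>j \<in> {J<..mu i}. j \<notin> cover D (i - 1)"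
      "\<forall>j > mu i. (i, j) \<notin> D" "\<forall>j \<in> {1..<J}. (i, j) \<in> D" "\<exists>j \<in> {J..mu i}. (i, j) \<notin> D"
      unfolding good_row_def i by blast
    have "last_covered \<tau> i = J"
    proof (rule last_covered_eqI)
      have "1 \<le> J" "\<tau> J \<le> i - 1" using J(1) cover by auto
      then show "J = 1 \<or> (2 \<le> J \<and> \<tau> J < i)" using that by linarith
      show "\<not> \<tau> j < i" if "J < j" "j \<le> mu i" for j
        using J(3) that cover[of j "i - 1"] by auto
    qed (rule J(2))
    then show ?thesis using J by simp
  qed
  have last1: "last_covered \<tau> 1 = 1"
    using last_covered(1)[of \<tau> 1] \<tau>(1)[of "last_covered \<tau> 1"] by auto
  have beyond: "(i, j) \<notin> D" if "i \<in> {1..n}" "mu i < j" for i j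
  proof (cases "i = 1")
    case True
    \<comment> \<open>The row conditions start with row 2. Since row 1 has the same length, the
      columns beyond it are those that must be covered before row 2.\<close>
    have "\<tau> j < 2" using large[of 2 j] that True mu_12 by (simp add: numeral_2_eq_2)
    then have "\<tau> j = 1" using \<tau>(1)[of j] by simp
    then show ?thesis using \<tau>(2)[of j] True by simp
  next
    case False
    then show ?thesis using row[of i] that by auto
  qed
  have \<tau>_n: "\<tau> j \<le> n" if "2 \<le> j" "j \<le> mu 1" for j
  proof -
    have "1 \<le> n" using that mu_last by (cases n) auto
    then show ?thesis using large[of "Suc n" j] mu_last that by simp
  qed
  have nc: "noncrossing mu (mu 1) \<tau>"
    unfolding noncrossing_def
  proof (intro conjI ballI impI)
    fix j assume j: "j \<in> {2..mu 1}"
    show "j \<le> mu (\<tau> j)"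
    proof (rule ccontr)
      assume a: "\<not> j \<le> mu (\<tau> j)"
      then have "2 \<le> \<tau> j" using j \<tau>(1)[of j] by (cases "\<tau> j = 1") auto
      then show False using large[of "\<tau> j" j] \<tau>_n[of j] j a by auto
    qed
  next
    fix j j' assume j: "j \<in> {2..mu 1}" "j' \<in> {2..mu 1}" "j < j'" "\<tau> j' < \<tau> j"
    show "mu (\<tau> j) < j'"
    proof (rule ccontr)
      assume "\<not> ?thesis"
      then have "j' \<le> last_covered \<tau> (\<tau> j)" using j by (intro last_covered(4)) auto
      moreover have "2 \<le> \<tau> j" "\<tau> j \<le> n" using j \<tau>(1)[of j'] \<tau>_n[of j] by auto
      ultimately have "(\<tau> j, j) \<in> D" using row[of "\<tau> j"] j by auto
      then show False using \<tau>(2) by blast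
    qed
  qed
  have "e \<subseteq> \<tau> ` {2..mu 1}"
  proof
    fix i assume "i \<in> e"
    then have i: "i \<in> {2..n}" "(i, last_covered \<tau> i) \<in> D" by (auto simp: e_def)
    have "\<exists>j \<in> {last_covered \<tau> i..mu i}. (i, j) \<notin> D" using row[of i] i by simp
    then obtain j where j: "last_covered \<tau> i \<le> j" "j \<le> mu i" "(i, j) \<notin> D" by auto
    then have "j \<noteq> last_covered \<tau> i" using i by auto
    then have "last_covered \<tau> i < j" "2 \<le> j" using j(1) last_covered(2)[of \<tau> i] by linarith+
    then have "\<not> \<tau> j < i" using last_covered(4)[of j i \<tau>] j by auto
    then have "\<tau> j = i" using \<tau>_le[of i j] j i by auto
    moreover have "j \<in> {2..mu 1}" using j \<open>2 \<le> j\<close> mu_le_mu1[of i] i by auto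
    ultimately show "i \<in> \<tau> ` {2..mu 1}" by blast
  qed
  then have valid: "valid \<tau> e"
    unfolding valid_def using nc \<tau>(1) \<tau>_n by (auto simp: e_def)
  have "(i, j) \<in> D \<longleftrightarrow> (i, j) \<in> dream \<tau> e" for i j
  proof
    assume ij: "(i, j) \<in> D"
    then have i: "i \<in> {1..n}" and "1 \<le> j" using D by force+
    moreover have "j \<le> mu i" using beyond[OF i, of j] ij by (auto simp: not_le[symmetric])
    moreover have "\<tau> j \<noteq> i" using \<tau>(2) ij by blast
    moreover have "\<not> (j = last_covered \<tau> i \<and> i \<notin> e)"
    proof
      assume a: "j = last_covered \<tau> i \<and> i \<notin> e"
      then have "i = 1" using i ij by (auto simp: e_def)
      then show False using a ij 11 last1 by simp
    qed
    ultimately show "(i, j) \<in> dream \<tau> e" by (simp add: dream_def)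
  next
    assume d: "(i, j) \<in> dream \<tau> e"
    then have i: "i \<in> {1..n}" and j: "1 \<le> j" "j \<le> mu i" by (auto simp: dream_def)
    show "(i, j) \<in> D"
    proof (rule ccontr)
      assume ij: "(i, j) \<notin> D"
      then have le: "\<tau> j \<le> i" using \<tau>_le i by auto
      show False
      proof (cases "\<tau> j < i")
        case True
        then have i2: "2 \<le> i" using \<tau>(1)[of j] by simp
        have "j \<le> last_covered \<tau> i"
          using last_covered(2)[of \<tau> i] last_covered(4)[of j i \<tau>] True j by (cases "j = 1") auto
        moreover have "\<not> j < last_covered \<tau> i" using row[OF i2] i j ij by auto
        ultimately have "j = last_covered \<tau> i" by simp
        then show False using d ij i i2 by (auto simp: dream_def e_def)
      next
        case False
        then have "\<tau> j = i" using le by simp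
        then show False using d \<tau>1 j last1 by (cases "j = 1") (auto simp: dream_def e_def)
      qed
    qed
  qed
  then have "D = dream \<tau> e" by auto
  then show ?thesis using valid by blast
qed

lemma dream_in_PD:
  assumes v: "valid \<tau> e"
  shows "dream \<tau> e \<in> PD (Suc n) \<pi>"
proof -
  let ?D = "dream \<tau> e" and ?J = "last_covered \<tau>"
  have nc: "noncrossing mu (mu 1) \<tau>" and range: "\<And>j. j \<in> {2..mu 1} \<Longrightarrow> \<tau> j \<in> {1..n}"
    and e: "e \<subseteq> {2..n}" "e \<subseteq> \<tau> ` {2..mu 1}"
    using v unfolding valid_def image_subset_iff by blast+
  have early: "\<tau> j < i" if "j \<in> {2..mu 1}" "mu i < j" for i j
  proof (rule ccontr)
    assume "\<not> ?thesis"
    then have "mu (\<tau> j) \<le> mu i" by (intro mu_antimono) simp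
    then show False using noncrossing_le[OF nc that(1)] that by simp
  qed
  have not_early: "?J i < j" if "j \<in> {2..mu 1}" "\<tau> j = i" for i j
  proof (rule ccontr)
    assume "\<not> ?thesis"
    then have "j \<le> ?J i" by simp
    then have J: "2 \<le> ?J i" "\<tau> (?J i) < i" using last_covered(1)[of \<tau> i] that by auto
    then have "j < ?J i" using that \<open>j \<le> ?J i\<close> by (cases "j = ?J i") auto
    moreover have "?J i \<le> mu 1" using last_covered(3)[of \<tau> i] mu_le_mu1[of i] range that by force
    ultimately have "mu (\<tau> j) < ?J i" using noncrossingD[OF nc that(1), of "?J i"] J that by auto
    then show False using last_covered(3)[of \<tau> i] that by simp
  qed
  have nonempty: "\<exists>j \<in> {?J i..mu i}. (i, j) \<notin> ?D" if "i \<in> {1..n}" for i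
  proof (cases "i \<in> e")
    case True
    then obtain j where j: "j \<in> {2..mu 1}" "\<tau> j = i" using e by blast
    then show ?thesis
      using not_early[OF j] noncrossing_le[OF nc j(1)] by (intro bexI[of _ j]) (auto simp: dream_def)
  next
    case False
    then show ?thesis
      using last_covered(3)[of \<tau> i] by (intro bexI[of _ "?J i"]) (auto simp: dream_def)
  qed
  have last1: "?J 1 = 1"
    using last_covered(1,3)[of \<tau> 1] range[of "?J 1"] by force
  have 11: "(1, 1) \<notin> ?D" using last1 e by (auto simp: dream_def)
  have cover: "j \<in> cover ?D r \<longleftrightarrow> j = 1 \<or> (2 \<le> j \<and> (mu 1 < j \<or> \<tau> j \<le> r))"
    if r: "1 \<le> r" "r \<le> n" for j r
  proof -
    consider "j = 0" | "j = 1" | "mu 1 < j" "2 \<le> j" | "j \<in> {2..mu 1}" by fastforce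
    then show ?thesis
    proof cases
      case 1
      then show ?thesis by (simp add: cover_def)
    next
      case 2
      then show ?thesis using 11 r by (auto simp: cover_def)
    next
      case 3
      then have "(1, j) \<notin> ?D" by (simp add: dream_def)
      then show ?thesis using 3 r by (auto simp: cover_def)
    next
      case 4
      have "j \<in> cover ?D r \<longleftrightarrow> \<tau> j \<le> r"
      proof
        assume "j \<in> cover ?D r"
        then obtain i where i: "i \<in> {1..r}" "(i, j) \<notin> ?D" by (auto simp: cover_def)
        then have "mu i < j \<or> \<tau> j = i \<or> j = ?J i" using 4 r by (auto simp: dream_def)
        then have "\<tau> j \<le> i"
          using early[OF 4, of i] last_covered(1)[of \<tau> i] 4 by auto
        then show "\<tau> j \<le> r" using i by simp
      next
        assume "\<tau> j \<le> r"
        moreover have "(\<tau> j, j) \<notin> ?D" using 4 by (auto simp: dream_def)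
        ultimately show "j \<in> cover ?D r" using range[OF 4] 4 unfolding cover_def by auto
      qed
      then show ?thesis using 4 by auto
    qed
  qed
  have good: "good_row ?D r" if r: "r \<in> {1..n}" for r
  proof -
    have cov: "j \<in> cover ?D r \<longleftrightarrow> j = 1 \<or> (2 \<le> j \<and> (mu 1 < j \<or> \<tau> j < Suc r))" for j
      using cover[of r j] r by (simp add: less_Suc_eq_le)
    let ?J = "last_covered \<tau> (Suc r)"
    have "j \<in> cover ?D r" if "mu (Suc r) < j" for j
    proof -
      have "2 \<le> j" using that mu_pos[of "Suc r"] by simp
      then show ?thesis unfolding cov using early[of j "Suc r"] that by (cases "mu 1 < j") simp_all
    qed
    then have "{mu (Suc r)<..} \<subseteq> cover ?D r" by auto
    moreover have "\<forall>j > mu (Suc r). (Suc r, j) \<notin> ?D" by (auto simp: dream_def)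
    moreover have "?J \<in> cover ?D r" using last_covered(1)[of \<tau> "Suc r"] cov by auto
    moreover have "?J \<le> mu (Suc r)" by (rule last_covered(3))
    moreover have "j \<notin> cover ?D r" if "j \<in> {?J<..mu (Suc r)}" for j
    proof -
      have "2 \<le> j" "j \<le> mu 1"
        using that last_covered(2)[of \<tau> "Suc r"] mu_le_mu1[of "Suc r"] by auto
      then show ?thesis unfolding cov using last_covered(4)[of j "Suc r" \<tau>] that by auto
    qed
    ultimately have cov_facts: "{mu (Suc r)<..} \<subseteq> cover ?D r" "\<forall>j > mu (Suc r). (Suc r, j) \<notin> ?D"
      "?J \<in> cover ?D r" "?J \<le> mu (Suc r)" "\<forall>j \<in> {?J<..mu (Suc r)}. j \<notin> cover ?D r"
      by blast+
    moreover have "(\<forall>j \<in> {1..<?J}. (Suc r, j) \<in> ?D) \<and> (\<exists>j \<in> {?J..mu (Suc r)}. (Suc r, j) \<notin> ?D)"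
    proof (cases "r = n")
      case True
      then have "?J = 1" using last_covered(2,3)[of \<tau> "Suc r"] mu_last by simp
      then show ?thesis using True mu_last by (auto simp: dream_def)
    next
      case False
      then have i: "Suc r \<in> {1..n}" using r by auto
      have "(Suc r, j) \<in> ?D" if "j \<in> {1..<?J}" for j
      proof -
        have "j \<le> mu 1" using that last_covered(3)[of \<tau> "Suc r"] mu_le_mu1[of "Suc r"] by simp
        then have "\<not> (2 \<le> j \<and> \<tau> j = Suc r)" using not_early[of j "Suc r"] that by auto
        then show ?thesis
          using that i last_covered(3)[of \<tau> "Suc r"] by (auto simp: dream_def)
      qed
      then show ?thesis using nonempty[OF i] by blast
    qed
    ultimately show ?thesis unfolding good_row_def by blast
  qed
  \<comment> \<open>Only the last tile of a row longer than the next one could leave the staircase.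
    A cross there would sit in the last covered column, and no tile of the row from this column to
    its end would be an elbow.\<close>
  have bound: "i + j \<le> Suc n" if ij: "(i, j) \<in> ?D" for i j
  proof -
    have i: "i \<in> {1..n}" and j: "1 \<le> j" "j \<le> mu i" using ij by (auto simp: dream_def)
    have next_mu: "i + mu (Suc i) \<le> Suc n" using mu_le i by simp
    show ?thesis
    proof (cases "mu (Suc i) < mu i \<and> j = mu i")
      case False
      show ?thesis
      proof (cases "i = 1")
        case True
        then show ?thesis using next_mu j mu_12 by simp
      next
        case False
        then have "1 \<le> i - 1" "i - 1 \<le> n" "Suc (i - 1) = i" using i by auto
        then have "i - 1 + mu i \<le> Suc n" using mu_le[of "i - 1"] by metis
        then show ?thesis
          using next_mu j \<open>\<not> (mu (Suc i) < mu i \<and> j = mu i)\<close> i by (cases "j = mu i") auto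
      qed
    next
      case True
      then have jc: "j \<in> {2..mu 1}" using mu_pos[of "Suc i"] mu_le_mu1[of i] i j by auto
      have "\<tau> j < Suc i" using early[OF jc, of "Suc i"] True by simp
      moreover have "\<tau> j \<noteq> i" using ij jc by (auto simp: dream_def)
      ultimately have "\<tau> j < i" by simp
      then have "?J i = j" using last_covered(3)[of \<tau> i] last_covered(4)[of j i \<tau>] jc j True by simp
      then show ?thesis using nonempty[OF i] ij True by auto
    qed
  qed
  have "?D \<subseteq> {1..Suc n} \<times> {1..Suc n}"
    using bound by (force simp: dream_def)
  then show ?thesis unfolding PD_iff_good using bound 11 good by auto
qed

end

subsection \<open>Polytopes given by bounds on coordinates and prefix sums\<close>

abbreviation "lkp \<equiv> Poly_Mapping.lookup"

lemma lookup_scaleR: "lkp (r *\<^sub>R x) i = r *\<^sub>R lkp x i"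
proof -
  have "finite {i. r *\<^sub>R lkp x i \<noteq> 0}"
    by (rule finite_subset[OF _ finite_lookup[of x]]) auto
  then show ?thesis by (simp add: scaleR_poly_mapping_def)
qed

definition point :: "nat \<Rightarrow> (nat \<Rightarrow> 'a::comm_monoid_add) \<Rightarrow> nat \<Rightarrow>\<^sub>0 'a" where
  "point n f = (\<Sum>i = 1..n. Poly_Mapping.single i (f i))"

lemma lookup_point: "lkp (point n f) i = (if i \<in> {1..n} then f i else 0)"
  by (simp add: point_def lookup_sum lookup_single when_def sum.delta)

lemma keys_point: "Poly_Mapping.keys (point n f) \<subseteq> {1..n}"
  by (auto simp: in_keys_iff lookup_point split: if_splits)

text \<open>In terms of the prefix sums, the constraints concern only single values and differences
  of neighbours. Together with the integer type of the bounds this makes the polytope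
  integral.\<close>

definition chain_polytope :: "nat \<Rightarrow> (nat \<Rightarrow> int) \<Rightarrow> (nat \<Rightarrow> int) \<Rightarrow> int \<Rightarrow> (nat \<Rightarrow>\<^sub>0 real) set" where
  "chain_polytope n u M S = {x. Poly_Mapping.keys x \<subseteq> {1..n} \<and> (\<forall>i \<in> {1..n}. lkp x i \<le> u i) \<and>
     (\<forall>k \<in> {1..n}. (\<Sum>i = 1..k. lkp x i) \<le> M k) \<and> (\<Sum>i = 1..n. lkp x i) = S}"

lemma keys_scaleR_add:
  fixes x y :: "'a \<Rightarrow>\<^sub>0 real"
  assumes "Poly_Mapping.keys x \<subseteq> A" "Poly_Mapping.keys y \<subseteq> A"
  shows "Poly_Mapping.keys (r *\<^sub>R x + s *\<^sub>R y) \<subseteq> A"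
proof
  fix i assume "i \<in> Poly_Mapping.keys (r *\<^sub>R x + s *\<^sub>R y)"
  then have "r * lkp x i + s * lkp y i \<noteq> 0" by (simp add: in_keys_iff lookup_add lookup_scaleR)
  then have "lkp x i \<noteq> 0 \<or> lkp y i \<noteq> 0" by auto
  then show "i \<in> A" using assms by (meson in_keys_iff subsetD)
qed

lemma convex_chain_polytope: "convex (chain_polytope n u M S)"
proof (rule convexI)
  fix x y and r s :: real
  assume xy: "x \<in> chain_polytope n u M S" "y \<in> chain_polytope n u M S"
    and rs: "0 \<le> r" "0 \<le> s" "r + s = 1"
  have le: "r * a + s * b \<le> c" if "a \<le> c" "b \<le> c" for a b c :: real
    using convex_bound_le[OF that rs] by simp
  have sum: "(\<Sum>i = 1..k. lkp (r *\<^sub>R x + s *\<^sub>R y) i) = r * (\<Sum>i = 1..k. lkp x i) + s * (\<Sum>i = 1..k. lkp y i)" for k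
    by (simp add: lookup_add lookup_scaleR sum.distrib sum_distrib_left)
  have total: "r * of_int S + s * of_int S = of_int S" using rs by (metis distrib_right mult_1)
  show "r *\<^sub>R x + s *\<^sub>R y \<in> chain_polytope n u M S"
    unfolding chain_polytope_def mem_Collect_eq sum lookup_add lookup_scaleR real_scaleR_def
    using xy total unfolding chain_polytope_def
    by (intro conjI ballI le keys_scaleR_add) simp_all
qed

definition prefix_sum :: "(nat \<Rightarrow>\<^sub>0 real) \<Rightarrow> nat \<Rightarrow> real" where
  "prefix_sum x k = (\<Sum>i = 1..k. lkp x i)"

lemma prefix_sum_Suc: "prefix_sum x (Suc k) = prefix_sum x k + lkp x (Suc k)"
  by (simp add: prefix_sum_def)

lemma prefix_sum_0 [simp]: "prefix_sum x 0 = 0"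
  by (simp add: prefix_sum_def)

lemma chain_polytope_iff:
  "x \<in> chain_polytope n u M S \<longleftrightarrow> Poly_Mapping.keys x \<subseteq> {1..n} \<and>
     (\<forall>k < n. prefix_sum x (Suc k) - prefix_sum x k \<le> u (Suc k)) \<and>
     (\<forall>k \<in> {1..n}. prefix_sum x k \<le> M k) \<and> prefix_sum x n = S"
proof -
  have "(\<forall>i \<in> {1..n}. lkp x i \<le> u i) \<longleftrightarrow> (\<forall>k < n. lkp x (Suc k) \<le> u (Suc k))"
    unfolding image_Suc_lessThan[symmetric] by auto
  then show ?thesis
    unfolding chain_polytope_def mem_Collect_eq prefix_sum_Suc add_diff_cancel_left'
    by (simp add: prefix_sum_def)
qed

text \<open>
  Moving all non-integral prefix sums by the same amount, up or down, until one of them becomes an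
  integer stays inside the polytope, because the bounds are integers. The point lies between the two
  points reached.
\<close>

lemma chain_polytope_integral:
  assumes "x \<in> chain_polytope n u M S"
  shows "x \<in> convex hull integer_points (chain_polytope n u M S)"
  using assms
proof (induction "card {k \<in> {1..n}. prefix_sum x k \<notin> \<int>}" arbitrary: x rule: less_induct)
  case less
  let ?P = "chain_polytope n u M S"
  define F where "F = {k \<in> {1..n}. prefix_sum x k \<notin> \<int>}"
  have x: "Poly_Mapping.keys x \<subseteq> {1..n}"
    "\<And>k. k < n \<Longrightarrow> prefix_sum x (Suc k) - prefix_sum x k \<le> u (Suc k)"
    "\<And>k. k \<in> {1..n} \<Longrightarrow> prefix_sum x k \<le> M k" "prefix_sum x n = S"
    using less.prems by (auto simp: chain_polytope_iff)
  have F_iff: "prefix_sum x k \<in> \<int> \<longleftrightarrow> k \<notin> F" if "k \<le> n" for k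
    using that by (cases "k = 0") (auto simp: F_def)
  have fin: "finite F" by (simp add: F_def)
  show ?case
  proof (cases "F = {}")
    case True
    have "lkp x i \<in> \<int>" for i
    proof (cases "i \<in> {1..n}")
      case True
      then have "lkp x i = prefix_sum x i - prefix_sum x (i - 1)"
        using prefix_sum_Suc[of x "i - 1"] by simp
      moreover have "prefix_sum x i \<in> \<int>" "prefix_sum x (i - 1) \<in> \<int>"
        using F_iff[of i] F_iff[of "i - 1"] \<open>F = {}\<close> True by auto
      ultimately show ?thesis by simp
    next
      case False
      then have "lkp x i = 0" using x(1) by (auto simp: in_keys_iff)
      then show ?thesis by simp
    qed
    then have "x \<in> integer_points ?P" using less.prems by (simp add: integer_points_def)
    then show ?thesis by (rule hull_inc)
  next
    case False
    \<comment> \<open>The direction whose prefix sums are the indicator of \<open>F\<close>; its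
      coordinates are differences of neighbouring indicators.\<close>
    define d where "d = point n (\<lambda>i. of_bool (i \<in> F) - of_bool (i - 1 \<in> F) :: real)"
    have d_keys: "Poly_Mapping.keys d \<subseteq> {1..n}" unfolding d_def by (rule keys_point)
    have d: "prefix_sum d k = of_bool (k \<in> F)" if "k \<le> n" for k
      using that
    proof (induction k)
      case 0
      then show ?case by (simp add: F_def)
    next
      case (Suc k)
      then show ?case by (simp add: prefix_sum_Suc d_def lookup_point)
    qed
    have shifted: "prefix_sum (x + r *\<^sub>R d) k = prefix_sum x k + r * prefix_sum d k" for r k
      by (simp add: prefix_sum_def lookup_add lookup_scaleR sum.distrib sum_distrib_left)
    have hull: "x + r *\<^sub>R d \<in> convex hull integer_points ?P"
      if r: "\<And>k. k \<in> F \<Longrightarrow> \<lfloor>prefix_sum x k\<rfloor> \<le> prefix_sum x k + r \<and> prefix_sum x k + r \<le> \<lceil>prefix_sum x k\<rceil>"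
        and ex: "\<exists>k \<in> F. prefix_sum x k + r \<in> \<int>" for r
    proof (rule less.hyps)
      let ?y = "x + r *\<^sub>R d"
      have y: "prefix_sum ?y k = prefix_sum x k + (if k \<in> F then r else 0)" if "k \<le> n" for k
        using that by (simp add: shifted d)
      obtain k0 where "k0 \<in> F" "prefix_sum x k0 + r \<in> \<int>" using ex by blast
      then have "k0 \<notin> {k \<in> {1..n}. prefix_sum ?y k \<notin> \<int>}" "k0 \<in> F"
        using y[of k0] by (auto simp: F_def)
      moreover have "k \<in> F" if "k \<in> {1..n}" "prefix_sum ?y k \<notin> \<int>" for k
        using y[of k] F_iff[of k] that by (cases "k \<in> F") simp_all
      then have "{k \<in> {1..n}. prefix_sum ?y k \<notin> \<int>} \<subseteq> F" by blast
      ultimately have "{k \<in> {1..n}. prefix_sum ?y k \<notin> \<int>} \<subset> F" by blast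
      then show "card {k \<in> {1..n}. prefix_sum ?y k \<notin> \<int>} < card {k \<in> {1..n}. prefix_sum x k \<notin> \<int>}"
        unfolding F_def[symmetric] using fin by (rule psubset_card_mono[rotated])
      have "Poly_Mapping.keys ?y \<subseteq> {1..n}"
        using keys_scaleR_add[OF x(1) d_keys, of 1 r] by simp
      moreover have "prefix_sum ?y (Suc k) - prefix_sum ?y k \<le> u (Suc k)" if "k < n" for k
      proof -
        consider "Suc k \<in> F \<longleftrightarrow> k \<in> F" | "Suc k \<in> F" "k \<notin> F" | "Suc k \<notin> F" "k \<in> F" by blast
        then show ?thesis
        proof cases
          case 1
          then show ?thesis using x(2)[OF that] that by (simp add: y)
        next
          case 2
          \<comment> \<open>Only one of two neighbouring prefix sums moves. The other is an integer,
            so the resulting bound on the moving one is an integer and survives rounding.\<close>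
          have "prefix_sum x k \<in> \<int>" using F_iff[of k] 2 that by simp
          then obtain c where c: "prefix_sum x k = of_int c" by (rule Ints_cases)
          then have "prefix_sum x (Suc k) \<le> of_int (c + u (Suc k))" using x(2)[OF that] by simp
          then have "\<lceil>prefix_sum x (Suc k)\<rceil> \<le> c + u (Suc k)" by (simp only: ceiling_le_iff)
          then have "prefix_sum x (Suc k) + r \<le> of_int (c + u (Suc k))"
            using r[OF 2(1)] by (meson of_int_le_iff order.trans)
          then show ?thesis using 2 c that by (simp add: y)
        next
          case 3
          have "prefix_sum x (Suc k) \<in> \<int>" using F_iff[of "Suc k"] 3 that by simp
          then obtain c where c: "prefix_sum x (Suc k) = of_int c" by (rule Ints_cases)
          then have "of_int (c - u (Suc k)) \<le> prefix_sum x k" using x(2)[OF that] by simp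
          then have "c - u (Suc k) \<le> \<lfloor>prefix_sum x k\<rfloor>" by (simp only: le_floor_iff)
          then have "of_int (c - u (Suc k)) \<le> prefix_sum x k + r"
            using r[OF 3(2)] by (meson of_int_le_iff order.trans)
          then show ?thesis using 3 c that by (simp add: y)
        qed
      qed
      moreover have "prefix_sum ?y k \<le> M k" if "k \<in> {1..n}" for k
      proof (cases "k \<in> F")
        case True
        have "\<lceil>prefix_sum x k\<rceil> \<le> M k" using x(3)[OF that] by (simp add: ceiling_le_iff)
        then have "prefix_sum x k + r \<le> M k" using r[OF True] by (meson of_int_le_iff order.trans)
        then show ?thesis using True that by (simp add: y)
      qed (use x(3) that in \<open>simp add: y\<close>)
      moreover have "prefix_sum ?y n = S" using x(4) F_iff[of n] by (simp add: y)
      ultimately show "?y \<in> ?P" by (simp add: chain_polytope_iff)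
    qed
    define \<alpha> where "\<alpha> = Min ((\<lambda>k. \<lceil>prefix_sum x k\<rceil> - prefix_sum x k) ` F)"
    define \<beta> where "\<beta> = Min ((\<lambda>k. prefix_sum x k - \<lfloor>prefix_sum x k\<rfloor>) ` F)"
    have "\<alpha> \<in> (\<lambda>k. \<lceil>prefix_sum x k\<rceil> - prefix_sum x k) ` F"
      unfolding \<alpha>_def using False fin by (intro Min_in) auto
    then obtain ka where ka: "ka \<in> F" "\<alpha> = \<lceil>prefix_sum x ka\<rceil> - prefix_sum x ka" by blast
    have "\<beta> \<in> (\<lambda>k. prefix_sum x k - \<lfloor>prefix_sum x k\<rfloor>) ` F"
      unfolding \<beta>_def using False fin by (intro Min_in) auto
    then obtain kb where kb: "kb \<in> F" "\<beta> = prefix_sum x kb - \<lfloor>prefix_sum x kb\<rfloor>" by blast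
    have \<alpha>_le: "\<alpha> \<le> \<lceil>prefix_sum x k\<rceil> - prefix_sum x k" and \<beta>_le: "\<beta> \<le> prefix_sum x k - \<lfloor>prefix_sum x k\<rfloor>"
      if "k \<in> F" for k
      using that fin by (auto simp: \<alpha>_def \<beta>_def intro!: Min_le)
    have ka_n: "prefix_sum x ka \<notin> \<int>" and kb_n: "prefix_sum x kb \<notin> \<int>"
      using ka(1) kb(1) by (auto simp: F_def)
    have "\<alpha> \<noteq> 0" using ka_n ka(2) by (metis Ints_of_int eq_iff_diff_eq_0)
    then have \<alpha>: "0 < \<alpha>" using ka(2) le_of_int_ceiling[of "prefix_sum x ka"] by linarith
    have "\<beta> \<noteq> 0" using kb_n kb(2) by (metis Ints_of_int eq_iff_diff_eq_0)
    then have \<beta>: "0 < \<beta>" using kb(2) of_int_floor_le[of "prefix_sum x kb"] by linarith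
    have "x + \<alpha> *\<^sub>R d \<in> convex hull integer_points ?P"
    proof (rule hull)
      show "\<lfloor>prefix_sum x k\<rfloor> \<le> prefix_sum x k + \<alpha> \<and> prefix_sum x k + \<alpha> \<le> \<lceil>prefix_sum x k\<rceil>" if "k \<in> F" for k
        using \<alpha>_le[OF that] \<alpha> of_int_floor_le[of "prefix_sum x k"] by linarith
      show "\<exists>k \<in> F. prefix_sum x k + \<alpha> \<in> \<int>" using ka by (intro bexI[of _ ka]) auto
    qed
    moreover have "x + (- \<beta>) *\<^sub>R d \<in> convex hull integer_points ?P"
    proof (rule hull)
      show "\<lfloor>prefix_sum x k\<rfloor> \<le> prefix_sum x k + - \<beta> \<and> prefix_sum x k + - \<beta> \<le> \<lceil>prefix_sum x k\<rceil>" if "k \<in> F" for k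
        using \<beta>_le[OF that] \<beta> le_of_int_ceiling[of "prefix_sum x k"] by linarith
      show "\<exists>k \<in> F. prefix_sum x k + - \<beta> \<in> \<int>" using kb by (intro bexI[of _ kb]) auto
    qed
    \<comment> \<open>With these weights the shifts by \<alpha> and by -\<beta> cancel.\<close>
    ultimately have "(\<beta> / (\<alpha> + \<beta>)) *\<^sub>R (x + \<alpha> *\<^sub>R d) + (\<alpha> / (\<alpha> + \<beta>)) *\<^sub>R (x + (- \<beta>) *\<^sub>R d)
      \<in> convex hull integer_points ?P"
      using \<alpha> \<beta> by (intro convexD[OF convex_convex_hull]) (auto simp: add_divide_distrib[symmetric])
    moreover have "(\<beta> / (\<alpha> + \<beta>)) *\<^sub>R (x + \<alpha> *\<^sub>R d) + (\<alpha> / (\<alpha> + \<beta>)) *\<^sub>R (x + (- \<beta>) *\<^sub>R d) = x"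
    proof -
      have "(\<beta> / (\<alpha> + \<beta>)) + (\<alpha> / (\<alpha> + \<beta>)) = 1" using \<alpha> \<beta> by (simp add: add_divide_distrib[symmetric])
      moreover have "(\<beta> / (\<alpha> + \<beta>)) *\<^sub>R (x + \<alpha> *\<^sub>R d) + (\<alpha> / (\<alpha> + \<beta>)) *\<^sub>R (x + (- \<beta>) *\<^sub>R d)
        = ((\<beta> / (\<alpha> + \<beta>)) + (\<alpha> / (\<alpha> + \<beta>))) *\<^sub>R x"
        by (simp add: algebra_simps)
      ultimately show ?thesis by simp
    qed
    ultimately show ?thesis by simp
  qed
qed

lemma newton_chain_polytope:
  assumes "real_vec ` Poly_Mapping.keys f = integer_points (chain_polytope n u M S)"
  shows "newton f = chain_polytope n u M S"
proof
  show "newton f \<subseteq> chain_polytope n u M S"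
    unfolding newton_def assms by (rule hull_minimal) (auto simp: integer_points_def convex_chain_polytope)
  show "chain_polytope n u M S \<subseteq> newton f"
    unfolding newton_def assms using chain_polytope_integral by blast
qed

text \<open>
  Put \<open>a = u - x\<close>. The suffix sums of \<open>a\<close> from \<open>k\<close> on are bounded by \<open>U k\<close>, and the maximum of \<open>a\<close>
  summed over a set \<open>I\<close> is attained by putting as much as possible at \<open>Min I\<close>, which gives \<open>f I\<close>.
\<close>

lemma generalized_permutahedron_chain_polytope:
  assumes "chain_polytope n u M S \<noteq> {}"
  shows "generalized_permutahedron n (chain_polytope n u M S)"
proof -
  let ?P = "chain_polytope n u M S"
  \<comment> \<open>The sum of u - x from k on is the sum of u from k on, minus S, plus the prefix
    sum of x up to k - 1. Bounding the latter by \<open>M (k - 1)\<close> gives \<open>U k\<close>;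
    for k = 1 it is empty.\<close>
  define U :: "nat \<Rightarrow> real" where
    "U k = (\<Sum>i = k..n. u i) - S + (if k \<le> 1 then 0 else M (k - 1))" for k
  \<comment> \<open>As u - x is nonnegative, its sum over a set with minimum k is at most the sum
    from l on for every l up to k.\<close>
  define V where "V k = Min (U ` {1..k})" for k
  define f where "f I = (if I = {} then 0 else V (Min I))" for I
  define z where "z I = (\<Sum>i \<in> I. real_of_int (u i)) - f I" for I
  have tail: "(\<Sum>i = k..n. u i - lkp t i) \<le> U k"
    if t: "\<forall>k \<in> {1..n}. (\<Sum>i = 1..k. lkp t i) \<le> M k" "(\<Sum>i = 1..n. lkp t i) = S" and k: "k \<in> {1..n}"
    for t :: "nat \<Rightarrow>\<^sub>0 real" and k
  proof (cases "k = 1")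
    case True
    then show ?thesis using t(2) unfolding U_def sum_subtractf by simp
  next
    case False
    then have k1: "k - 1 \<in> {1..n}" "1 < k" using k by auto
    have "(\<Sum>i = 1..n. lkp t i) = (\<Sum>i = 1..k - 1. lkp t i) + (\<Sum>i = k..n. lkp t i)"
      using k sum.ub_add_nat[of 1 "k - 1" "lkp t" "n - (k - 1)"] by simp
    moreover have "U k = (\<Sum>i = k..n. real_of_int (u i)) - S + M (k - 1)"
      using k1 unfolding U_def by simp
    ultimately show ?thesis
      using t(1)[rule_format, OF k1(1)] t(2) unfolding sum_subtractf by linarith
  qed
  have V_le: "V k \<le> U l" if "l \<in> {1..k}" for k l unfolding V_def using that by (intro Min_le) auto
  have V_ge: "c \<le> V k" if "1 \<le> k" "\<And>l. l \<in> {1..k} \<Longrightarrow> c \<le> U l" for c k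
    unfolding V_def using that by (intro Min.boundedI) auto
  have V_anti: "V l \<le> V k" if "1 \<le> k" "k \<le> l" for k l
    using that by (intro V_ge V_le) auto
  \<comment> \<open>A point of the polytope gives nonnegativity of \<open>U\<close>, on which
    submodularity of \<open>f\<close> for disjoint sets rests, and later that S is at most
    \<open>M n\<close>.\<close>
  obtain x where x: "x \<in> ?P" using assms by blast
  have U_nonneg: "0 \<le> U k" if "k \<in> {1..n}" for k
  proof -
    have "0 \<le> (\<Sum>i = k..n. u i - lkp x i)"
      using x that by (intro sum_nonneg) (auto simp: chain_polytope_def)
    also have "\<dots> \<le> U k" using x that by (intro tail) (auto simp: chain_polytope_def)
    finally show ?thesis .
  qed
  have V_nonneg: "0 \<le> V k" if "k \<in> {1..n}" for k
    using that U_nonneg by (intro V_ge) auto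
  \<comment> \<open>The union has the smaller of the two minima, a nonempty intersection has a
    minimum not below the larger one, and \<open>V\<close> is antitone.\<close>
  have f_mono: "f (I \<union> J) + f (I \<inter> J) \<le> f I + f J"
    if IJ: "I \<subseteq> {1..n}" "J \<subseteq> {1..n}" "I \<noteq> {}" "J \<noteq> {}" "Min I \<le> Min J" for I J
  proof -
    have fin: "finite I" "finite J" using IJ(1,2) finite_subset by blast+
    have J1: "1 \<le> Min J" "Min J \<in> {1..n}" using Min_in[OF fin(2) IJ(4)] IJ(2) by auto
    have "f (I \<union> J) = f I" using IJ fin by (simp add: f_def Min_Un min_def)
    moreover have "f (I \<inter> J) \<le> f J"
    proof (cases "I \<inter> J = {}")
      case True
      then show ?thesis using IJ V_nonneg J1 by (simp add: f_def)
    next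
      case False
      then have "Min J \<le> Min (I \<inter> J)" using fin by (intro Min_antimono) auto
      then show ?thesis using IJ False V_anti J1 by (simp add: f_def)
    qed
    ultimately show ?thesis by simp
  qed
  have sub: "f (I \<union> J) + f (I \<inter> J) \<le> f I + f J" if "I \<subseteq> {1..n}" "J \<subseteq> {1..n}" for I J
  proof -
    consider "I = {} \<or> J = {}" | "I \<noteq> {}" "J \<noteq> {}" "Min I \<le> Min J" | "I \<noteq> {}" "J \<noteq> {}" "Min J \<le> Min I"
      by linarith
    then show ?thesis
    proof cases
      case 1
      then show ?thesis by (auto simp: f_def)
    next
      case 2
      then show ?thesis using f_mono that by blast
    next
      case 3
      then have "f (J \<union> I) + f (J \<inter> I) \<le> f J + f I" using f_mono that by blast
      then show ?thesis unfolding Un_commute[of J] Int_commute[of J] by simp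
    qed
  qed
  have modular: "(\<Sum>i \<in> I \<union> J. real_of_int (u i)) + (\<Sum>i \<in> I \<inter> J. real_of_int (u i)) =
      (\<Sum>i \<in> I. real_of_int (u i)) + (\<Sum>i \<in> J. real_of_int (u i))"
    if "I \<subseteq> {1..n}" "J \<subseteq> {1..n}" for I J
    using that by (intro sum.union_inter) (auto intro: finite_subset)
  have super: "z (I \<union> J) + z (I \<inter> J) \<ge> z I + z J" if "I \<subseteq> {1..n}" "J \<subseteq> {1..n}" for I J
    using sub[OF that] modular[OF that] unfolding z_def by simp
  have zn: "z {1..n} = S"
  proof (cases "n = 0")
    case True
    have "(\<Sum>i = 1..n. lkp x i) = S" using x unfolding chain_polytope_def by blast
    then show ?thesis using True by (simp add: z_def f_def)
  next
    case False
    then have "Min {1..n} = 1" by (intro Min_eqI) auto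
    then have "f {1..n} = U 1" using False by (simp add: f_def V_def)
    then show ?thesis unfolding z_def by (simp add: U_def)
  qed
  have "t \<in> ?P \<longleftrightarrow> Poly_Mapping.keys t \<subseteq> {1..n} \<and>
      (\<forall>I. I \<subset> {1..n} \<longrightarrow> (\<Sum>i \<in> I. lkp t i) \<ge> z I) \<and> (\<Sum>i = 1..n. lkp t i) = z {1..n}" for t
  proof
    assume t: "t \<in> ?P"
    have "(\<Sum>i \<in> I. lkp t i) \<ge> z I" if I: "I \<subseteq> {1..n}" for I
    proof (cases "I = {}")
      case False
      have fin: "finite I" using I finite_subset by blast
      have m: "Min I \<in> {1..n}" using Min_in[OF fin False] I by auto
      have "(\<Sum>i \<in> I. u i - lkp t i) \<le> V (Min I)"
      proof (rule V_ge)
        fix l assume l: "l \<in> {1..Min I}"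
        then have "I \<subseteq> {l..n}" using I Min_le[OF fin] by fastforce
        then have "(\<Sum>i \<in> I. u i - lkp t i) \<le> (\<Sum>i = l..n. u i - lkp t i)"
          using t l by (intro sum_mono2) (auto simp: chain_polytope_def)
        also have "\<dots> \<le> U l" using t l m by (intro tail) (auto simp: chain_polytope_def)
        finally show "(\<Sum>i \<in> I. u i - lkp t i) \<le> U l" .
      qed (use m in simp)
      then show ?thesis using False by (simp add: z_def f_def sum_subtractf)
    qed (simp add: z_def f_def)
    then show "Poly_Mapping.keys t \<subseteq> {1..n} \<and>
      (\<forall>I. I \<subset> {1..n} \<longrightarrow> (\<Sum>i \<in> I. lkp t i) \<ge> z I) \<and> (\<Sum>i = 1..n. lkp t i) = z {1..n}"
      using t zn by (auto simp: chain_polytope_def)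
  next
    assume "Poly_Mapping.keys t \<subseteq> {1..n} \<and>
      (\<forall>I. I \<subset> {1..n} \<longrightarrow> (\<Sum>i \<in> I. lkp t i) \<ge> z I) \<and> (\<Sum>i = 1..n. lkp t i) = z {1..n}"
    then have t: "Poly_Mapping.keys t \<subseteq> {1..n}" "\<And>I. I \<subset> {1..n} \<Longrightarrow> z I \<le> (\<Sum>i \<in> I. lkp t i)"
      "(\<Sum>i = 1..n. lkp t i) = S"
      using zn by auto
    have upper: "lkp t i \<le> u i" if i: "i \<in> {1..n}" for i
    proof -
      \<comment> \<open>Subtracting the constraint for all coordinates but i from the total gives
        the upper bound at i, because \<open>f\<close> of this set is at most
        \<open>U 1\<close>.\<close>
      let ?I = "{1..n} - {i}"
      have "f ?I \<le> U 1"
      proof (cases "?I = {}")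
        case True
        then show ?thesis using U_nonneg[of 1] i unfolding f_def by simp
      next
        case False
        have "Min ?I \<in> ?I" by (rule Min_in[OF _ False]) simp
        then have "1 \<in> {1..Min ?I}" by (metis DiffD1 atLeastAtMost_iff order.refl)
        then have "V (Min ?I) \<le> U 1" by (rule V_le)
        then show ?thesis using False unfolding f_def by simp
      qed
      moreover have "?I \<subset> {1..n}" using i by blast
      then have "z ?I \<le> (\<Sum>i \<in> ?I. lkp t i)" by (rule t(2))
      moreover have "(\<Sum>j = 1..n. lkp t j) = lkp t i + (\<Sum>j \<in> ?I. lkp t j)"
        "(\<Sum>j = 1..n. real_of_int (u j)) = u i + (\<Sum>j \<in> ?I. real_of_int (u j))"
        by (rule sum.remove[OF finite_atLeastAtMost i])+
      moreover have "U 1 = (\<Sum>j = 1..n. real_of_int (u j)) - S" by (simp add: U_def)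
      ultimately show ?thesis using t(3) unfolding z_def by linarith
    qed
    have "(\<Sum>i = 1..k. lkp t i) \<le> M k" if k: "k \<in> {1..n}" for k
    proof (cases "k = n")
      case True
      have "(\<Sum>i = 1..n. lkp x i) \<le> M n" "(\<Sum>i = 1..n. lkp x i) = S"
        using x k True unfolding chain_polytope_def by blast+
      then show ?thesis using True t(3) by simp
    next
      case False
      \<comment> \<open>The constraint for a final segment, subtracted from the total, is the prefix
        bound.\<close>
      let ?I = "{Suc k..n}"
      have I: "?I \<noteq> {}" "Min ?I = Suc k" using k False by (auto intro: Min_eqI)
      have "z ?I \<le> (\<Sum>i \<in> ?I. lkp t i)" using k by (intro t(2)) auto
      moreover have "f ?I \<le> U (Suc k)" using I V_le[of "Suc k" "Suc k"] by (simp add: f_def)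
      moreover have "(\<Sum>i = 1..n. lkp t i) = (\<Sum>i = 1..k. lkp t i) + (\<Sum>i = Suc k..n. lkp t i)"
        using k sum.ub_add_nat[of 1 k "lkp t" "n - k"] by simp
      moreover have "U (Suc k) = (\<Sum>i = Suc k..n. real_of_int (u i)) - S + M k"
        using k by (simp add: U_def)
      ultimately show ?thesis using t(3) unfolding z_def by linarith
    qed
    then show "t \<in> ?P" using t upper by (simp add: chain_polytope_def)
  qed
  then have "?P = {t. Poly_Mapping.keys t \<subseteq> {1..n} \<and>
      (\<forall>I. I \<subset> {1..n} \<longrightarrow> (\<Sum>i \<in> I. lkp t i) \<ge> z I) \<and> (\<Sum>i = 1..n. lkp t i) = z {1..n}}"
    by blast
  then show ?thesis
    unfolding generalized_permutahedron_def using super by (intro exI[of _ z]) (auto simp: z_def f_def)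
qed

subsection \<open>Exponent vectors\<close>

definition exponent :: "(nat \<times> nat) set \<Rightarrow> nat \<Rightarrow>\<^sub>0 nat" where
  "exponent D = (\<Sum>(i, j) \<in> D. Poly_Mapping.single i 1)"

lemma lookup_exponent:
  assumes "finite D"
  shows "lkp (exponent D) i = card {j. (i, j) \<in> D}"
proof -
  have "lkp (exponent D) i = (\<Sum>x \<in> D. if fst x = i then 1 else 0)"
    unfolding exponent_def lookup_sum
    by (intro sum.cong) (auto simp: lookup_single when_def split: prod.splits)
  also have "\<dots> = card {x \<in> D. fst x = i}" using assms by (simp add: sum.If_cases Int_def)
  also have "{x \<in> D. fst x = i} = Pair i ` {j. (i, j) \<in> D}" by auto
  finally show ?thesis by (simp add: card_image inj_on_def)
qed

lemma wt_eq_single: "finite D \<Longrightarrow> wt D = Poly_Mapping.single (exponent D) 1"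
  unfolding wt_def exponent_def
proof (induction D rule: finite_induct)
  case (insert x D)
  then show ?case by (cases x) (simp add: var_def mult_single)
qed simp

lemma lookup_sum_single:
  "finite A \<Longrightarrow> lkp (\<Sum>x \<in> A. Poly_Mapping.single (g x) (1 :: int)) \<alpha> = int (card {x \<in> A. g x = \<alpha>})"
  by (auto simp: lookup_sum lookup_single when_def sum.If_cases intro!: arg_cong[where f = card])

text \<open>The coefficients are multiplicities, so no monomial cancels.\<close>

lemma keys_sum_single:
  assumes "finite A"
  shows "Poly_Mapping.keys (\<Sum>x \<in> A. Poly_Mapping.single (g x) (1 :: int)) = g ` A"
  using assms by (auto simp: in_keys_iff lookup_sum_single card_eq_0_iff)

lemma keys_homogeneous_component:
  "Poly_Mapping.keys (homogeneous_component d f) = {\<alpha> \<in> Poly_Mapping.keys f. total_degree \<alpha> = d}"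
  by (auto simp: homogeneous_component_def in_keys_iff lookup_sum lookup_single when_def sum.delta
      split: if_splits)

lemma finite_PD: "finite (PD m \<pi>)"
  by (rule finite_subset[of _ "Pow ({1..m} \<times> {1..m})"]) (auto simp: PD_def)

lemma PD_finite: "D \<in> PD m \<pi> \<Longrightarrow> finite D"
  by (rule finite_subset[of _ "{1..m} \<times> {1..m}"]) (auto simp: PD_def)

lemma grothendieck_eq: "grothendieck m \<pi> = (\<Sum>D \<in> PD m \<pi>. Poly_Mapping.single (exponent D) 1)"
  unfolding grothendieck_def by (intro sum.cong refl wt_eq_single PD_finite)

lemma schubert_eq: "schubert m \<pi> = (\<Sum>D \<in> RPD m \<pi>. Poly_Mapping.single (exponent D) 1)"
  unfolding schubert_def by (intro sum.cong refl wt_eq_single) (auto simp: RPD_def intro: PD_finite)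

lemma lookup_real_vec: "lkp (real_vec \<alpha>) i = real (lkp \<alpha> i)"
  by (simp add: real_vec_def map.rep_eq when_def)

lemma keys_real_vec: "Poly_Mapping.keys (real_vec \<alpha>) = Poly_Mapping.keys \<alpha>"
  by (auto simp: in_keys_iff lookup_real_vec)

lemma inj_real_vec: "inj real_vec"
  by (rule injI) (metis lookup_real_vec of_nat_eq_iff poly_mapping_eqI)

lemma monomial_at_real_vec: "monomial_at (real_vec \<alpha>) = Poly_Mapping.single \<alpha> 1"
proof -
  have "Poly_Mapping.map (\<lambda>x. nat \<lfloor>x\<rfloor>) (real_vec \<alpha>) = \<alpha>"
    by (rule poly_mapping_eqI) (simp add: map.rep_eq lookup_real_vec when_def)
  then show ?thesis by (simp add: monomial_at_def)
qed

lemma integer_point_transform_real_vec: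
  assumes "integer_points S = real_vec ` K"
  shows "integer_point_transform S = (\<Sum>\<alpha> \<in> K. Poly_Mapping.single \<alpha> 1)"
  unfolding integer_point_transform_def assms
  by (subst sum.reindex) (auto simp: monomial_at_real_vec inj_on_subset[OF inj_real_vec])

lemma prefix_sum_real_vec: "prefix_sum (real_vec \<alpha>) k = of_int (\<Sum>i = 1..k. int (lkp \<alpha> i))"
  by (simp add: prefix_sum_def lookup_real_vec)

lemma total_degree_eq:
  assumes "Poly_Mapping.keys \<alpha> \<subseteq> {1..n}"
  shows "real (total_degree \<alpha>) = prefix_sum (real_vec \<alpha>) n"
proof -
  have "total_degree \<alpha> = (\<Sum>i = 1..n. lkp \<alpha> i)"
    unfolding total_degree_def using assms by (intro sum.mono_neutral_left) (auto simp: in_keys_iff)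
  then show ?thesis by (simp add: prefix_sum_def lookup_real_vec)
qed

subsection \<open>The exponent vectors of pipe dreams of $1\pi'$\<close>

context one_dominant
begin

definition nu :: "nat \<Rightarrow> int" where
  "nu i = int (mu i) - 1"

text \<open>
  The bound \<open>prefix_bound\<close> comes from counting ineffective crosses, at most one in each row except the
  first; \<open>tail_bound\<close> comes from the columns that the rows after \<open>k\<close> can still cover.
\<close>

definition prefix_bound :: "nat \<Rightarrow> int" where
  "prefix_bound k = (\<Sum>i = 1..k. nu i) - nu 1 + nu (Suc k) + (int k - 1)"

definition tail_bound :: "nat \<Rightarrow> int" where
  "tail_bound k = nu (Suc k) - (\<Sum>i = 1..n. nu i) + (\<Sum>i = 1..k. nu i)"

text \<open>The number of boxes in the diagram of \<pi>', equal to the number of inversions of \<pi>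
  by \<open>card_inversions\<close>.\<close>

definition min_degree :: int where
  "min_degree = (\<Sum>i = 1..n. nu i) - nu 1"

text \<open>The total on the right of the second prefix bound is what distinguishes this polyhedron
  from a \<open>chain_polytope\<close>; in a fixed degree it is a constant. Nonnegativity is
  implied, see \<open>region_nonneg\<close>.\<close>

definition region :: "(nat \<Rightarrow>\<^sub>0 real) set" where
  "region = {x. Poly_Mapping.keys x \<subseteq> {1..n} \<and> (\<forall>i \<in> {1..n}. lkp x i \<le> nu i) \<and>
     (\<forall>k \<in> {1..n}. prefix_sum x k \<le> prefix_bound k \<and> prefix_sum x k \<le> tail_bound k + prefix_sum x n) \<and>
     min_degree \<le> prefix_sum x n}"

lemma nu_last: "nu (Suc n) = 0"
  by (simp add: nu_def mu_last)

lemma real_vec_region_iff: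
  "real_vec \<alpha> \<in> region \<longleftrightarrow> Poly_Mapping.keys \<alpha> \<subseteq> {1..n} \<and>
     (\<forall>i \<in> {1..n}. int (lkp \<alpha> i) \<le> nu i) \<and>
     (\<forall>k \<in> {1..n}. (\<Sum>i = 1..k. int (lkp \<alpha> i)) \<le> prefix_bound k \<and>
        (\<Sum>i = 1..k. int (lkp \<alpha> i)) \<le> tail_bound k + (\<Sum>i = 1..n. int (lkp \<alpha> i))) \<and>
     min_degree \<le> (\<Sum>i = 1..n. int (lkp \<alpha> i))"
proof -
  have "real (lkp \<alpha> i) \<le> nu i \<longleftrightarrow> int (lkp \<alpha> i) \<le> nu i" for i by linarith
  then show ?thesis
    unfolding region_def mem_Collect_eq keys_real_vec prefix_sum_real_vec lookup_real_vec
      of_int_add[symmetric] of_int_le_iff by simp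
qed

lemma sum_split: "k \<le> n \<Longrightarrow> (\<Sum>i = 1..n. f i) = (\<Sum>i = 1..k. f i) + (\<Sum>i = Suc k..n. f i :: int)"
  using sum.ub_add_nat[of 1 k f "n - k"] by simp

lemma exponent_dream:
  assumes v: "valid \<tau> e" and i: "i \<in> {1..n}"
  shows "int (lkp (exponent (dream \<tau> e)) i) =
    nu i - int (card {j \<in> {2..mu 1}. \<tau> j = i}) + (if i \<in> e then 1 else 0)"
  using card_dream_row[OF v i] lookup_exponent[OF PD_finite[OF dream_in_PD[OF v]], of i]
  by (auto simp: nu_def split: if_splits)

lemma keys_exponent_dream:
  assumes "valid \<tau> e"
  shows "Poly_Mapping.keys (exponent (dream \<tau> e)) \<subseteq> {1..n}"
  using lookup_exponent[OF PD_finite[OF dream_in_PD[OF assms]]]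
  by (auto simp: in_keys_iff dream_def)

text \<open>A column whose first elbow lies below row k must fit into row k + 1, as row lengths
  decrease.\<close>

lemma column_counts:
  assumes "valid \<tau> e"
  shows "(\<Sum>i = 1..n. int (card {j \<in> {2..mu 1}. \<tau> j = i})) = nu 1"
    and "k \<le> n \<Longrightarrow> (\<Sum>i = Suc k..n. int (card {j \<in> {2..mu 1}. \<tau> j = i})) \<le> nu (Suc k)"
proof -
  have nc: "noncrossing mu (mu 1) \<tau>" and range: "\<And>j. j \<in> {2..mu 1} \<Longrightarrow> \<tau> j \<in> {1..n}"
    using assms unfolding valid_def image_subset_iff by blast+
  have count: "(\<Sum>i = k..n. int (card {j \<in> {2..mu 1}. \<tau> j = i})) = int (card {j \<in> {2..mu 1}. \<tau> j \<in> {k..n}})" for k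
  proof -
    have "{j \<in> {2..mu 1}. \<tau> j \<in> {k..n}} = (\<Union>i \<in> {k..n}. {j \<in> {2..mu 1}. \<tau> j = i})" by auto
    then show ?thesis by (simp add: card_UN_disjoint disjoint_iff)
  qed
  have "{j \<in> {2..mu 1}. \<tau> j \<in> {1..n}} = {2..mu 1}" using range by blast
  then show "(\<Sum>i = 1..n. int (card {j \<in> {2..mu 1}. \<tau> j = i})) = nu 1"
    unfolding count using mu_pos[of 1] by (simp add: nu_def)
  have "{j \<in> {2..mu 1}. \<tau> j \<in> {Suc k..n}} \<subseteq> {2..mu (Suc k)}"
  proof
    fix j assume j: "j \<in> {j \<in> {2..mu 1}. \<tau> j \<in> {Suc k..n}}"
    then have "mu (\<tau> j) \<le> mu (Suc k)" by (intro mu_antimono) simp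
    then show "j \<in> {2..mu (Suc k)}" using noncrossing_le[OF nc, of j] j by auto
  qed
  then have "card {j \<in> {2..mu 1}. \<tau> j \<in> {Suc k..n}} \<le> card {2..mu (Suc k)}" by (intro card_mono) auto
  then show "(\<Sum>i = Suc k..n. int (card {j \<in> {2..mu 1}. \<tau> j = i})) \<le> nu (Suc k)"
    unfolding count using mu_pos[of "Suc k"] by (simp add: nu_def)
qed

lemma exponent_prefix_sum:
  assumes v: "valid \<tau> e" and k: "k \<le> n"
  shows "(\<Sum>i = 1..k. int (lkp (exponent (dream \<tau> e)) i)) =
    (\<Sum>i = 1..k. nu i) - (\<Sum>i = 1..k. int (card {j \<in> {2..mu 1}. \<tau> j = i})) + int (card (e \<inter> {1..k}))"
proof -
  have "(\<Sum>i = 1..k. int (lkp (exponent (dream \<tau> e)) i)) =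
    (\<Sum>i = 1..k. nu i - int (card {j \<in> {2..mu 1}. \<tau> j = i}) + (if i \<in> e then 1 else 0))"
    using k by (intro sum.cong exponent_dream[OF v]) auto
  then show ?thesis by (simp add: sum.distrib sum_subtractf sum.If_cases Int_commute Int_def)
qed

lemma degree_dream:
  assumes v: "valid \<tau> e"
  shows "(\<Sum>i = 1..n. int (lkp (exponent (dream \<tau> e)) i)) = min_degree + int (card e)"
proof -
  have "e \<inter> {1..n} = e" using v by (force simp: valid_def)
  then show ?thesis
    using exponent_prefix_sum[OF v order.refl] column_counts(1)[OF v] by (simp add: min_degree_def)
qed

text \<open>A row with an ineffective cross also has a first elbow, whence the coordinate bounds. At
  least \<open>nu 1 - nu (Suc k)\<close> first elbows lie in the rows up to k; estimating the
  ineffective crosses there by k - 1 gives the first prefix bound, by \<open>card e\<close> the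
  second.\<close>

lemma exponent_in_region:
  assumes v: "valid \<tau> e"
  shows "real_vec (exponent (dream \<tau> e)) \<in> region"
  unfolding real_vec_region_iff
proof (intro conjI ballI)
  show "Poly_Mapping.keys (exponent (dream \<tau> e)) \<subseteq> {1..n}" by (rule keys_exponent_dream[OF v])
next
  fix i assume i: "i \<in> {1..n}"
  have fin: "finite {j \<in> {2..mu 1}. \<tau> j = i}" by simp
  have "{j \<in> {2..mu 1}. \<tau> j = i} \<noteq> {}" if "i \<in> e"
    using that v unfolding valid_def by blast
  then have "1 \<le> card {j \<in> {2..mu 1}. \<tau> j = i}" if "i \<in> e"
    using that card_0_eq[OF fin] by (metis less_one not_le)
  then have "(if i \<in> e then 1 else 0) \<le> int (card {j \<in> {2..mu 1}. \<tau> j = i})" by auto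
  then show "int (lkp (exponent (dream \<tau> e)) i) \<le> nu i"
    unfolding exponent_dream[OF v i] by linarith
next
  fix k assume k: "k \<in> {1..n}"
  have e2: "e \<subseteq> {2..n}" using v by (simp add: valid_def)
  have "card (e \<inter> {1..k}) \<le> card {2..k}" using e2 by (intro card_mono) auto
  then have E: "int (card (e \<inter> {1..k})) \<le> int k - 1" using k by auto
  have tail: "(\<Sum>i = Suc k..n. int (card {j \<in> {2..mu 1}. \<tau> j = i})) \<le> nu (Suc k)"
    using column_counts(2)[OF v] k by simp
  have p: "(\<Sum>i = 1..k. int (card {j \<in> {2..mu 1}. \<tau> j = i})) +
      (\<Sum>i = Suc k..n. int (card {j \<in> {2..mu 1}. \<tau> j = i})) = nu 1"
    using column_counts(1)[OF v] sum_split[of k "\<lambda>i. int (card {j \<in> {2..mu 1}. \<tau> j = i})"] k by simp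
  show "(\<Sum>i = 1..k. int (lkp (exponent (dream \<tau> e)) i)) \<le> prefix_bound k"
    using exponent_prefix_sum[OF v, of k] k E tail p unfolding prefix_bound_def by simp
  have "card (e \<inter> {1..k}) \<le> card e" using e2 by (intro card_mono) (auto intro: finite_subset)
  then show "(\<Sum>i = 1..k. int (lkp (exponent (dream \<tau> e)) i))
      \<le> tail_bound k + (\<Sum>i = 1..n. int (lkp (exponent (dream \<tau> e)) i))"
    using exponent_prefix_sum[OF v, of k] k tail p unfolding tail_bound_def degree_dream[OF v] min_degree_def
    by simp
next
  show "min_degree \<le> (\<Sum>i = 1..n. int (lkp (exponent (dream \<tau> e)) i))"
    unfolding degree_dream[OF v] by simp
qed

text \<open>An exponent vector of degree \<open>t\<close> above the minimum is realised with ineffective crosses in rows \<open>2, \<dots>, t + 1\<close>.\<close>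

lemma region_exponent:
  assumes R: "real_vec \<alpha> \<in> region"
  shows "\<exists>\<tau> e. valid \<tau> e \<and> exponent (dream \<tau> e) = \<alpha>"
proof -
  let ?x = "\<lambda>k. \<Sum>i = 1..k. int (lkp \<alpha> i)" and ?N = "\<lambda>k. \<Sum>i = 1..k. nu i"
  have keys: "Poly_Mapping.keys \<alpha> \<subseteq> {1..n}"
    and upper: "\<And>i. i \<in> {1..n} \<Longrightarrow> int (lkp \<alpha> i) \<le> nu i"
    and RA: "\<And>k. k \<in> {1..n} \<Longrightarrow> ?x k \<le> prefix_bound k"
    and RB: "\<And>k. k \<in> {1..n} \<Longrightarrow> ?x k \<le> tail_bound k + ?x n"
    and Rmin: "min_degree \<le> ?x n"
    using R unfolding real_vec_region_iff by blast+
  define t where "t = nat (?x n - min_degree)"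
  have t: "int t = ?x n - min_degree" using Rmin by (simp add: t_def)
  \<comment> \<open>The prefix bound for k = n gives at most n - 1 ineffective crosses, so they fit
    into the rows 2, ..., n.\<close>
  have t_n: "n = 0 \<or> Suc t \<le> n"
    using RA[of n] t nu_last by (cases "n = 0") (auto simp: prefix_bound_def min_degree_def)
  have t0: "t = 0" if "n = 0" using t that nu_last unfolding min_degree_def by simp
  \<comment> \<open>Placing the ineffective crosses as high as possible maximises their number up to
    every row and so minimises the number of first elbows needed below it.\<close>
  define e where "e = {2..Suc t}"
  define p where "p i = nat (nu i - int (lkp \<alpha> i)) + (if i \<in> e then 1 else 0)" for i
  have p: "int (p i) = nu i - int (lkp \<alpha> i) + (if i \<in> e then 1 else 0)" if "i \<in> {1..n}" for i
    using upper[OF that] by (simp add: p_def)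
  have e_n: "e \<subseteq> {2..n}" using t_n t0 by (auto simp: e_def)
  have e_count: "int (card (e \<inter> {1..k})) = min (int t) (int k - 1)" if "1 \<le> k" for k
  proof -
    have "e \<inter> {1..k} = {2..min (Suc t) k}" by (auto simp: e_def)
    then show ?thesis using that by (auto simp: min_def)
  qed
  have p_sum: "(\<Sum>i = 1..k. int (p i)) = ?N k - ?x k + int (card (e \<inter> {1..k}))" if "k \<le> n" for k
  proof -
    have "(\<Sum>i = 1..k. int (p i)) = (\<Sum>i = 1..k. nu i - int (lkp \<alpha> i) + (if i \<in> e then 1 else 0))"
      using that by (intro sum.cong p) auto
    then show ?thesis by (simp add: sum.distrib sum_subtractf sum.If_cases Int_commute Int_def)
  qed
  have e_all: "int (card (e \<inter> {1..n})) = int t"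
    using e_count[of n] t_n t0 by (cases "n = 0") auto
  have total: "(\<Sum>i = 1..n. int (p i)) = nu 1"
    using p_sum[of n] e_all t by (simp add: min_degree_def)
  have "(\<Sum>i = 1..n. p i) = mu 1 - 1"
  proof -
    have "int (\<Sum>i = 1..n. p i) = int (mu 1 - 1)"
      using total mu_pos[of 1] by (simp add: nu_def)
    then show ?thesis by (simp only: of_nat_eq_iff)
  qed
  moreover have "(\<Sum>i = k..n. p i) < mu k" if k: "k \<in> {1..n}" for k
  proof -
    have "(\<Sum>i = k..n. int (p i)) \<le> nu k"
    proof (cases "k = 1")
      case True
      then show ?thesis using total by simp
    next
      case False
      then obtain l where l: "k = Suc l" "l \<in> {1..n}" using k by (cases k) auto
      have "(\<Sum>i = k..n. int (p i)) = nu 1 - (?N l - ?x l + min (int t) (int l - 1))"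
        using total sum_split[of l "\<lambda>i. int (p i)"] p_sum[of l] e_count[of l] l by simp
      \<comment> \<open>The two prefix bounds match the two values of the minimum: \<open>RB\<close>
        serves for t and \<open>RA\<close> for l - 1.\<close>
      also have "\<dots> \<le> nu (Suc l)"
        using RA[OF l(2)] RB[OF l(2)] t by (simp add: prefix_bound_def tail_bound_def min_degree_def min_def)
      finally show ?thesis using l by simp
    qed
    then have "int (\<Sum>i = k..n. p i) < int (mu k)" by (simp add: nu_def)
    then show ?thesis by (simp only: of_nat_less_iff)
  qed
  ultimately obtain \<tau> where \<tau>: "noncrossing mu (Suc (mu 1 - 1)) \<tau>" "\<tau> ` {2..Suc (mu 1 - 1)} \<subseteq> {1..n}"
    "\<forall>i \<in> {1..n}. card {j \<in> {2..Suc (mu 1 - 1)}. \<tau> j = i} = p i"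
    using noncrossing_exists[of p n "mu 1 - 1" mu] by blast
  have "Suc (mu 1 - 1) = mu 1" using mu_pos[of 1] by simp
  note \<tau> = \<tau>[unfolded this]
  have "e \<subseteq> \<tau> ` {2..mu 1}"
  proof
    fix i assume i: "i \<in> e"
    then have "i \<in> {1..n}" using e_n by auto
    then have "card {j \<in> {2..mu 1}. \<tau> j = i} \<noteq> 0" using \<tau>(3) i by (simp add: p_def)
    then have "{j \<in> {2..mu 1}. \<tau> j = i} \<noteq> {}" by (metis card.empty)
    then show "i \<in> \<tau> ` {2..mu 1}" by blast
  qed
  then have v: "valid \<tau> e" using \<tau> e_n by (simp add: valid_def)
  have "lkp (exponent (dream \<tau> e)) i = lkp \<alpha> i" for i
  proof (cases "i \<in> {1..n}")
    case True
    then have "int (lkp (exponent (dream \<tau> e)) i) = int (lkp \<alpha> i)"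
      using exponent_dream[OF v True] p[OF True] \<tau>(3) by simp
    then show ?thesis by (simp only: of_nat_eq_iff)
  next
    case False
    then show ?thesis using keys_exponent_dream[OF v] keys by (metis in_keys_iff subsetD)
  qed
  then have "exponent (dream \<tau> e) = \<alpha>" by (rule poly_mapping_eqI)
  then show ?thesis using v by blast
qed

lemma exponents_PD: "exponent ` PD (Suc n) \<pi> = {\<alpha>. real_vec \<alpha> \<in> region}"
proof (intro set_eqI iffI)
  fix \<alpha> assume "\<alpha> \<in> exponent ` PD (Suc n) \<pi>"
  then obtain D where D: "D \<in> PD (Suc n) \<pi>" "\<alpha> = exponent D" by blast
  obtain \<tau> e where "valid \<tau> e" "D = dream \<tau> e" using PD_imp_dream[OF D(1)] by blast
  then show "\<alpha> \<in> {\<alpha>. real_vec \<alpha> \<in> region}" using D exponent_in_region by simp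
next
  fix \<alpha> assume "\<alpha> \<in> {\<alpha>. real_vec \<alpha> \<in> region}"
  then obtain \<tau> e where "valid \<tau> e" "exponent (dream \<tau> e) = \<alpha>" using region_exponent by blast
  then show "\<alpha> \<in> exponent ` PD (Suc n) \<pi>" using dream_in_PD by blast
qed

text \<open>Inversions are counted by their larger letter: the smaller letters to the right of
  position p are 2, ..., \<open>mu p\<close>.\<close>

lemma card_inversions: "int (card (invs \<pi>)) = min_degree"
proof -
  have "invs \<pi> = (SIGMA x : \<pi> ` {2..Suc n}. {y. (x, y) \<in> invs \<pi>})"
  proof -
    have "p \<in> {2..Suc n}" if "p < q" "\<pi> q < \<pi> p" for p q
    proof -
      have "\<pi> 0 = 0" using perm by (simp add: permutes_not_in)
      then have "p \<noteq> 0" using that by (cases "p = 0") auto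
      moreover have "\<pi> q \<noteq> 0" using \<pi>_inj[of q 0] \<open>\<pi> 0 = 0\<close> that by simp
      then have "p \<noteq> 1" using that fix1 by auto
      moreover have "p \<le> Suc n"
      proof (rule ccontr)
        assume "\<not> p \<le> Suc n"
        then have "\<pi> p = p" "\<pi> q = q" using perm that by (auto simp: permutes_not_in)
        then show False using that by simp
      qed
      ultimately show ?thesis by simp
    qed
    then show ?thesis unfolding invs_def by auto
  qed
  also have "card \<dots> = (\<Sum>x \<in> \<pi> ` {2..Suc n}. card {y. (x, y) \<in> invs \<pi>})"
  proof (rule card_SigmaI)
    have "finite {y. (x, y) \<in> invs \<pi>}" for x
      by (rule finite_subset[of _ "{..<x}"]) (auto simp: invs_def)
    then show "\<forall>x \<in> \<pi> ` {2..Suc n}. finite {y. (x, y) \<in> invs \<pi>}" by blast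
  qed simp
  also have "\<dots> = (\<Sum>p = 2..Suc n. card {y. (\<pi> p, y) \<in> invs \<pi>})"
    by (subst sum.reindex) (auto simp: inj_on_def \<pi>_inj)
  also have "\<dots> = (\<Sum>p = 2..Suc n. mu p - 1)"
  proof (rule sum.cong[OF refl])
    fix p assume p: "p \<in> {2..Suc n}"
    have \<pi>p: "\<pi> p \<in> {1..Suc n}" using permutes_in_image[OF perm, of p] p by auto
    have "{y. (\<pi> p, y) \<in> invs \<pi>} = {x \<in> {1..Suc n}. x < \<pi> p \<and> x \<notin> \<pi> ` {1..p}}"
    proof (intro set_eqI iffI)
      fix y assume "y \<in> {y. (\<pi> p, y) \<in> invs \<pi>}"
      then obtain q where q: "y = \<pi> q" "p < q" "\<pi> q < \<pi> p" by (auto simp: invs_def \<pi>_inj)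
      have "q \<in> {1..Suc n}"
      proof (rule ccontr)
        assume "q \<notin> {1..Suc n}"
        then have "\<pi> q = q" "Suc n < q" using perm q p by (auto simp: permutes_not_in)
        then show False using q \<pi>p by auto
      qed
      then have "\<pi> q \<in> {1..Suc n}" using permutes_in_image[OF perm] by blast
      then show "y \<in> {x \<in> {1..Suc n}. x < \<pi> p \<and> x \<notin> \<pi> ` {1..p}}"
        using q by (auto simp: \<pi>_inj)
    next
      fix y assume y: "y \<in> {x \<in> {1..Suc n}. x < \<pi> p \<and> x \<notin> \<pi> ` {1..p}}"
      then obtain q where q: "q \<in> {1..Suc n}" "y = \<pi> q" using permutes_image[OF perm] by blast
      then have "p < q" using y by (force simp: not_le[symmetric])
      then show "y \<in> {y. (\<pi> p, y) \<in> invs \<pi>}" using y q unfolding invs_def by blast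
    qed
    also have "\<dots> = {2..mu p}" using smaller[of "p - 1"] p by (cases p) auto
    finally show "card {y. (\<pi> p, y) \<in> invs \<pi>} = mu p - 1" by simp
  qed
  finally have "int (card (invs \<pi>)) = (\<Sum>p = 2..Suc n. int (mu p - 1))" by simp
  also have "\<dots> = (\<Sum>p = 2..Suc n. nu p)"
    by (rule sum.cong) (use mu_pos in \<open>simp_all add: nu_def of_nat_diff Suc_leI\<close>)
  also have "\<dots> = (\<Sum>p = 1..Suc n. nu p) - nu 1"
    by (simp add: sum.atLeast_Suc_atMost numeral_2_eq_2)
  finally show ?thesis using nu_last by (simp add: min_degree_def)
qed

lemma card_PD:
  assumes "D \<in> PD (Suc n) \<pi>"
  shows "int (card D) = (\<Sum>i = 1..n. int (lkp (exponent D) i))"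
proof -
  have sub: "D \<subseteq> {1..n} \<times> {1..Suc n}"
    using assms by (force simp: PD_def)
  have "D = (SIGMA i : {1..n}. {j. (i, j) \<in> D})" using sub by auto
  moreover have "finite {j. (i, j) \<in> D}" for i
    by (rule finite_subset[of _ "{1..Suc n}"]) (use sub in auto)
  ultimately have "card D = (\<Sum>i = 1..n. card {j. (i, j) \<in> D})"
    using card_SigmaI[of "{1..n}" "\<lambda>i. {j. (i, j) \<in> D}"] by simp
  then show ?thesis using lookup_exponent[OF PD_finite[OF assms]] by simp
qed

text \<open>The degree exceeds the number of inversions by \<open>card e\<close>, and reducedness
  means equality.\<close>

lemma RPD_iff: "D \<in> RPD (Suc n) \<pi> \<longleftrightarrow> (\<exists>\<tau>. valid \<tau> {} \<and> D = dream \<tau> {})"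
proof -
  have "reduced (Suc n) (dream \<tau> e) \<longleftrightarrow> e = {}" if "valid \<tau> e" for \<tau> e
  proof -
    have "finite e" using that finite_subset by (auto simp: valid_def)
    moreover have "int (card (dream \<tau> e)) = min_degree + int (card e)"
      using card_PD[OF dream_in_PD[OF that]] degree_dream[OF that] by simp
    ultimately show ?thesis
      unfolding reduced_iff_card[OF dream_in_PD[OF that]] using card_inversions by auto
  qed
  then show ?thesis unfolding RPD_def using PD_imp_dream dream_in_PD by blast
qed

text \<open>Without ineffective crosses the exponents give the number of columns assigned to each
  row. By \<open>noncrossing_unique\<close> these numbers determine \<tau> on all columns that
  \<open>dream\<close> looks at.\<close>

lemma inj_on_exponent: "inj_on exponent (RPD (Suc n) \<pi>)"
proof (rule inj_onI)
  fix D D' assume "D \<in> RPD (Suc n) \<pi>" "D' \<in> RPD (Suc n) \<pi>" and eq: "exponent D = exponent D'"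
  then obtain \<tau> \<tau>' where \<tau>: "valid \<tau> {}" "D = dream \<tau> {}" and \<tau>': "valid \<tau>' {}" "D' = dream \<tau>' {}"
    by (auto simp: RPD_iff)
  have "card {j \<in> {2..mu 1}. \<tau> j = i} = card {j \<in> {2..mu 1}. \<tau>' j = i}" for i
  proof (cases "i \<in> {1..n}")
    case True
    then show ?thesis using exponent_dream[OF \<tau>(1) True] exponent_dream[OF \<tau>'(1) True] eq \<tau> \<tau>' by simp
  next
    case False
    then have "{j \<in> {2..mu 1}. \<tau> j = i} = {}" "{j \<in> {2..mu 1}. \<tau>' j = i} = {}"
      using \<tau>(1) \<tau>'(1) unfolding valid_def by blast+
    then show ?thesis by (simp only:)
  qed
  then have "\<tau> j = \<tau>' j" if "j \<in> {2..mu 1}" for j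
    using noncrossing_unique[of mu "mu 1" \<tau> \<tau>' j] \<tau>(1) \<tau>'(1) that by (simp add: valid_def)
  then show "D = D'" using \<tau>(2) \<tau>'(2) dream_cong by metis
qed

lemma exponents_RPD:
  "exponent ` RPD (Suc n) \<pi> = {\<alpha>. real_vec \<alpha> \<in> region \<and> prefix_sum (real_vec \<alpha>) n = min_degree}"
proof (intro set_eqI iffI)
  fix \<alpha> assume "\<alpha> \<in> exponent ` RPD (Suc n) \<pi>"
  then obtain \<tau> where \<tau>: "valid \<tau> {}" "\<alpha> = exponent (dream \<tau> {})" by (auto simp: RPD_iff)
  then show "\<alpha> \<in> {\<alpha>. real_vec \<alpha> \<in> region \<and> prefix_sum (real_vec \<alpha>) n = min_degree}"
    using exponent_in_region[OF \<tau>(1)] degree_dream[OF \<tau>(1)]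
    unfolding prefix_sum_real_vec of_int_eq_iff by simp
next
  fix \<alpha> assume \<alpha>: "\<alpha> \<in> {\<alpha>. real_vec \<alpha> \<in> region \<and> prefix_sum (real_vec \<alpha>) n = min_degree}"
  then obtain \<tau> e where v: "valid \<tau> e" "exponent (dream \<tau> e) = \<alpha>" using region_exponent by blast
  then have "(\<Sum>i = 1..n. int (lkp \<alpha> i)) = min_degree"
    using \<alpha> by (simp only: prefix_sum_real_vec of_int_eq_iff mem_Collect_eq)
  then have "card e = 0" using degree_dream[OF v(1)] v(2) by simp
  moreover have "finite e" using v(1) finite_subset by (auto simp: valid_def)
  ultimately have "e = {}" by simp
  then show "\<alpha> \<in> exponent ` RPD (Suc n) \<pi>" using v RPD_iff by blast
qed

lemma RPD_nonempty: "RPD (Suc n) \<pi> \<noteq> {}"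
proof -
  have "valid (\<lambda>_. 1) {}"
  proof -
    have "1 \<le> n" if "2 \<le> mu 1" using mu_last that by (cases "n = 0") auto
    then show ?thesis by (auto simp: valid_def noncrossing_def)
  qed
  then show ?thesis using RPD_iff by blast
qed

section \<open>Convexity, integer points and degree slices of the region\<close>

lemma convex_region: "convex region"
proof (rule convexI)
  fix x y and r s :: real
  assume xy: "x \<in> region" "y \<in> region" and rs: "0 \<le> r" "0 \<le> s" "r + s = 1"
  have le: "r * a + s * b \<le> r * c + s * d" if "a \<le> c" "b \<le> d" for a b c d :: real
    using that rs by (intro add_mono mult_left_mono)
  have const: "r * c + s * c = c" for c :: real using rs by (metis distrib_right mult_1)
  let ?z = "r *\<^sub>R x + s *\<^sub>R y"
  have pre: "prefix_sum ?z k = r * prefix_sum x k + s * prefix_sum y k" for k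
    by (simp add: prefix_sum_def lookup_add lookup_scaleR sum.distrib sum_distrib_left)
  have coord: "lkp ?z i = r * lkp x i + s * lkp y i" for i
    by (simp add: lookup_add lookup_scaleR)
  show "?z \<in> region"
    unfolding region_def mem_Collect_eq pre coord
  proof (intro conjI ballI)
    show "Poly_Mapping.keys ?z \<subseteq> {1..n}"
      using xy by (intro keys_scaleR_add) (auto simp: region_def)
    show "r * lkp x i + s * lkp y i \<le> nu i" if "i \<in> {1..n}" for i
      using le[of "lkp x i" "nu i" "lkp y i" "nu i"] xy that const[of "nu i"] by (simp add: region_def)
    show "r * prefix_sum x k + s * prefix_sum y k \<le> prefix_bound k" if "k \<in> {1..n}" for k
      using le[of "prefix_sum x k" "prefix_bound k" "prefix_sum y k" "prefix_bound k"] xy that const[of "prefix_bound k"]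
      by (simp add: region_def)
    show "r * prefix_sum x k + s * prefix_sum y k \<le> tail_bound k + (r * prefix_sum x n + s * prefix_sum y n)"
      if "k \<in> {1..n}" for k
      using le[of "prefix_sum x k" "tail_bound k + prefix_sum x n" "prefix_sum y k" "tail_bound k + prefix_sum y n"]
        xy that const[of "tail_bound k"] by (simp add: region_def distrib_left)
    show "min_degree \<le> r * prefix_sum x n + s * prefix_sum y n"
      using le[of "min_degree" "prefix_sum x n" "min_degree" "prefix_sum y n"] xy
        const[of "min_degree"] by (simp add: region_def)
  qed
qed

text \<open>By the tail bound, or by \<open>min_degree\<close> if i = 1, the coordinates from i on
  add up to at least the sum of \<open>nu\<close> after i, and those after i contribute at most this
  sum.\<close>

lemma region_nonneg:
  assumes x: "x \<in> region"
  shows "0 \<le> lkp x i"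
proof (cases "i \<in> {1..n}")
  case True
  then obtain k where k: "i = Suc k" "k < n" by (cases i) auto
  let ?N = "\<lambda>k. \<Sum>i = 1..k. nu i"
  have mono: "prefix_sum x l - prefix_sum x (Suc k) \<le> ?N l - ?N (Suc k)" if "Suc k \<le> l" "l \<le> n" for l
    using that
  proof (induction l rule: dec_induct)
    case (step l)
    have "lkp x (Suc l) \<le> nu (Suc l)" using x step by (simp add: region_def)
    then show ?case using step by (simp add: prefix_sum_Suc)
  qed simp
  have "?N n - nu i - ?N k \<le> prefix_sum x n - prefix_sum x k"
  proof (cases "k = 0")
    case True
    then show ?thesis using x k by (simp add: region_def min_degree_def)
  next
    case False
    then have "prefix_sum x k \<le> tail_bound k + prefix_sum x n" using x k by (simp add: region_def)
    then show ?thesis using k by (simp add: tail_bound_def)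
  qed
  moreover have "?N (Suc k) = ?N k + nu i" using k by simp
  ultimately show ?thesis
    using mono[of n] k prefix_sum_Suc[of x k] by simp
next
  case False
  then have "lkp x i = 0" using x by (auto simp: region_def in_keys_iff)
  then show ?thesis by simp
qed

lemma integer_point_real_vec:
  assumes "x \<in> region" "\<forall>i. lkp x i \<in> \<int>"
  shows "x \<in> range real_vec"
proof
  define \<alpha> where "\<alpha> = point n (\<lambda>i. nat \<lfloor>lkp x i\<rfloor>)"
  show "x = real_vec \<alpha>"
  proof (rule poly_mapping_eqI)
    fix i
    have "of_int \<lfloor>lkp x i\<rfloor> = lkp x i" using assms(2) floor_of_int by (metis Ints_cases)
    moreover have "0 \<le> \<lfloor>lkp x i\<rfloor>" using region_nonneg[OF assms(1)] by simp
    ultimately have "real (nat \<lfloor>lkp x i\<rfloor>) = lkp x i" by simp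
    moreover have "lkp x i = 0" if "i \<notin> {1..n}"
      using assms(1) that by (auto simp: region_def in_keys_iff)
    ultimately show "lkp x i = lkp (real_vec \<alpha>) i"
      by (cases "i \<in> {1..n}") (simp_all add: lookup_real_vec \<alpha>_def lookup_point)
  qed
qed simp

text \<open>In degree S the tail bound becomes a constant, so both bounds on a prefix sum merge into
  one.\<close>

definition slice_bound :: "int \<Rightarrow> nat \<Rightarrow> int" where
  "slice_bound S k = min (prefix_bound k) (tail_bound k + S)"

lemma region_slice:
  assumes "min_degree \<le> S"
  shows "chain_polytope n nu (slice_bound S) S = {x \<in> region. prefix_sum x n = S}"
proof -
  have "real_of_int min_degree \<le> S" using assms by simp
  then show ?thesis
    unfolding chain_polytope_def region_def slice_bound_def prefix_sum_def[symmetric]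
    by (auto simp: of_int_min)
qed

lemma integer_points_slice:
  assumes "min_degree \<le> S"
  shows "integer_points (chain_polytope n nu (slice_bound S) S) =
    real_vec ` {\<alpha>. real_vec \<alpha> \<in> region \<and> prefix_sum (real_vec \<alpha>) n = S}"
proof (intro set_eqI iffI)
  fix x assume "x \<in> integer_points (chain_polytope n nu (slice_bound S) S)"
  then have x: "x \<in> region" "prefix_sum x n = S" "\<forall>i. lkp x i \<in> \<int>"
    by (auto simp: integer_points_def region_slice[OF assms])
  then obtain \<alpha> where "x = real_vec \<alpha>" using integer_point_real_vec by blast
  then show "x \<in> real_vec ` {\<alpha>. real_vec \<alpha> \<in> region \<and> prefix_sum (real_vec \<alpha>) n = S}"
    using x by blast
next
  fix x assume "x \<in> real_vec ` {\<alpha>. real_vec \<alpha> \<in> region \<and> prefix_sum (real_vec \<alpha>) n = S}"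
  then show "x \<in> integer_points (chain_polytope n nu (slice_bound S) S)"
    by (auto simp: integer_points_def region_slice[OF assms] lookup_real_vec)
qed

lemma keys_grothendieck: "Poly_Mapping.keys (grothendieck (Suc n) \<pi>) = {\<alpha>. real_vec \<alpha> \<in> region}"
  unfolding grothendieck_eq keys_sum_single[OF finite_PD] by (rule exponents_PD)

text \<open>The exponents are exactly the integer points of a convex set, which therefore contains
  the Newton polytope; this inclusion is enough.\<close>

lemma SNP_grothendieck: "SNP (grothendieck (Suc n) \<pi>)"
  unfolding SNP_def keys_grothendieck
proof (intro set_eqI iffI)
  fix x assume x: "x \<in> integer_points (newton (grothendieck (Suc n) \<pi>))"
  have "newton (grothendieck (Suc n) \<pi>) \<subseteq> region"
    unfolding newton_def keys_grothendieck by (rule hull_minimal) (auto simp: convex_region)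
  then have "x \<in> region" "\<forall>i. lkp x i \<in> \<int>" using x by (auto simp: integer_points_def)
  then show "x \<in> real_vec ` {\<alpha>. real_vec \<alpha> \<in> region}" using integer_point_real_vec by blast
next
  fix x assume x: "x \<in> real_vec ` {\<alpha>. real_vec \<alpha> \<in> region}"
  then have "x \<in> newton (grothendieck (Suc n) \<pi>)"
    unfolding newton_def keys_grothendieck by (rule hull_inc)
  then show "x \<in> integer_points (newton (grothendieck (Suc n) \<pi>))"
    using x by (auto simp: integer_points_def lookup_real_vec)
qed

lemma generalized_permutahedron_component:
  assumes "homogeneous_component d (grothendieck (Suc n) \<pi>) \<noteq> 0"
  shows "generalized_permutahedron n (newton (homogeneous_component d (grothendieck (Suc n) \<pi>)))"
proof -
  let ?f = "homogeneous_component d (grothendieck (Suc n) \<pi>)"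
  have deg: "total_degree \<alpha> = d \<longleftrightarrow> prefix_sum (real_vec \<alpha>) n = of_int (int d)"
    if "real_vec \<alpha> \<in> region" for \<alpha>
    using total_degree_eq[of \<alpha> n] that by (auto simp: real_vec_region_iff)
  have keys: "Poly_Mapping.keys ?f =
      {\<alpha>. real_vec \<alpha> \<in> region \<and> prefix_sum (real_vec \<alpha>) n = of_int (int d)}"
    unfolding keys_homogeneous_component keys_grothendieck using deg by blast
  have "Poly_Mapping.keys ?f \<noteq> {}" using assms by simp
  then obtain \<alpha> where \<alpha>: "real_vec \<alpha> \<in> region" "prefix_sum (real_vec \<alpha>) n = of_int (int d)"
    unfolding keys by blast
  have "real_of_int min_degree \<le> of_int (int d)"
    using \<alpha> unfolding region_def by auto
  then have d: "min_degree \<le> int d" by (simp only: of_int_le_iff)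
  have "newton ?f = chain_polytope n nu (slice_bound (int d)) (int d)"
    by (rule newton_chain_polytope) (simp only: keys integer_points_slice[OF d])
  moreover have "chain_polytope n nu (slice_bound (int d)) (int d) \<noteq> {}"
    unfolding region_slice[OF d] using \<alpha> by blast
  ultimately show ?thesis by (simp add: generalized_permutahedron_chain_polytope)
qed

lemma finite_RPD: "finite (RPD (Suc n) \<pi>)"
  by (rule finite_subset[OF _ finite_PD]) (auto simp: RPD_def)

lemma keys_schubert:
  "Poly_Mapping.keys (schubert (Suc n) \<pi>) =
    {\<alpha>. real_vec \<alpha> \<in> region \<and> prefix_sum (real_vec \<alpha>) n = min_degree}"
  unfolding schubert_eq keys_sum_single[OF finite_RPD] by (rule exponents_RPD)

lemma newton_schubert:
  "newton (schubert (Suc n) \<pi>) = chain_polytope n nu (slice_bound min_degree) min_degree"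
  by (rule newton_chain_polytope) (simp only: keys_schubert integer_points_slice[OF order.refl])

lemma integer_points_schubert:
  "integer_points (newton (schubert (Suc n) \<pi>)) = real_vec ` Poly_Mapping.keys (schubert (Suc n) \<pi>)"
  by (simp only: newton_schubert keys_schubert integer_points_slice[OF order.refl])

lemma generalized_permutahedron_schubert:
  "generalized_permutahedron n (newton (schubert (Suc n) \<pi>))"
proof -
  have "Poly_Mapping.keys (schubert (Suc n) \<pi>) \<noteq> {}"
    unfolding schubert_eq keys_sum_single[OF finite_RPD] using RPD_nonempty by blast
  then have "newton (schubert (Suc n) \<pi>) \<noteq> {}" by (simp add: newton_def)
  then show ?thesis unfolding newton_schubert by (rule generalized_permutahedron_chain_polytope)
qed

lemma schubert_integer_point_transform:
  "schubert (Suc n) \<pi> = integer_point_transform (newton (schubert (Suc n) \<pi>))"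
  unfolding integer_point_transform_real_vec[OF integer_points_schubert]
  unfolding schubert_eq keys_sum_single[OF finite_RPD]
  by (simp add: sum.reindex[OF inj_on_exponent])

end

subsection \<open>Dominant permutations\<close>

lemma dominant_row_lengths:
  assumes \<sigma>: "\<sigma> permutes {1..n}" and dom: "dominant n \<sigma>"
  obtains row where "\<And>i j. (i, j) \<in> rothe_diagram n \<sigma> \<longleftrightarrow> 1 \<le> i \<and> 1 \<le> j \<and> j \<le> row i"
    "\<And>i. 1 \<le> i \<Longrightarrow> row (Suc i) \<le> row i"
proof -
  obtain l where l: "is_partition l" "rothe_diagram n \<sigma> = young_diagram l"
    using dom by (auto simp: dominant_def)
  define row where "row i = (if 1 \<le> i \<and> i \<le> length l then l ! (i - 1) else 0)" for i
  show ?thesis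
  proof (rule that)
    show "(i, j) \<in> rothe_diagram n \<sigma> \<longleftrightarrow> 1 \<le> i \<and> 1 \<le> j \<and> j \<le> row i" for i j
      unfolding l(2) young_diagram_def row_def by auto
    show "row (Suc i) \<le> row i" if "1 \<le> i" for i
    proof (cases "Suc i \<le> length l")
      case True
      then have "l ! i \<le> l ! (i - 1)"
        using l(1) that by (simp add: is_partition_def sorted_wrt_iff_nth_less)
      then show ?thesis using True that by (simp add: row_def)
    qed (simp add: row_def)
  qed
qed

lemma one_dominant_dominant:
  assumes \<pi>: "\<pi> permutes {1..Suc n}" and \<pi>1: "\<pi> 1 = 1" and \<sigma>: "\<sigma> permutes {1..n}"
    and \<pi>\<sigma>: "\<And>i. i \<in> {1..n} \<Longrightarrow> \<pi> (Suc i) = Suc (\<sigma> i)" and dom: "dominant n \<sigma>"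
  shows "\<exists>mu. one_dominant n \<pi> mu"
proof -
  obtain row where rothe: "\<And>i j. (i, j) \<in> rothe_diagram n \<sigma> \<longleftrightarrow> 1 \<le> i \<and> 1 \<le> j \<and> j \<le> row i"
    and row: "\<And>i. 1 \<le> i \<Longrightarrow> row (Suc i) \<le> row i"
    using dominant_row_lengths[OF \<sigma> dom] by blast
  \<comment> \<open>The shift of the index inserts the extra row and \<open>Suc\<close> the extra
    column. The maximum repeats the first row length in row 1 and at index 0, so that the sequence
    decreases everywhere.\<close>
  define mu where "mu i = Suc (row (max 1 (i - 1)))" for i
  have mu_Suc: "mu (Suc r) = Suc (row r)" if "1 \<le> r" for r
    using that by (simp add: mu_def max_absorb2)
  have cell: "i \<in> {1..n} \<and> j \<in> {1..n} \<and> j < \<sigma> i \<and> i < inv \<sigma> j" if "1 \<le> i" "1 \<le> j" "j \<le> row i" for i j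
    using rothe[of i j] that by (auto simp: rothe_diagram_def)
  have inv_in: "inv \<sigma> j \<in> {1..n}" if "j \<in> {1..n}" for j
    using permutes_in_image[OF permutes_inv[OF \<sigma>], of j] that by simp
  \<comment> \<open>The letters 1, ..., \<open>row r\<close> all occur after position r in
    \<sigma>.\<close>
  have bound: "r + row r \<le> n" if "1 \<le> r" "r \<le> n" for r
  proof -
    have "inv \<sigma> ` {1..row r} \<subseteq> {Suc r..n}"
      using cell[of r] inv_in that by force
    moreover have "inj_on (inv \<sigma>) {1..row r}"
      using permutes_inj[OF permutes_inv[OF \<sigma>]] by (rule inj_on_subset) simp
    ultimately have "card {1..row r} \<le> card {Suc r..n}" by (intro card_inj_on_le) auto
    then show ?thesis using that by simp
  qed
  have last: "row r = 0" if "1 \<le> r" "n \<le> r" for r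
  proof (rule ccontr)
    assume "row r \<noteq> 0"
    then have "r \<in> {1..n} \<and> r < inv \<sigma> 1" "inv \<sigma> 1 \<in> {1..n}"
      using cell[of r 1] inv_in[of 1] that by auto
    then show False using that by simp
  qed
  have "one_dominant n \<pi> mu"
  proof
    show "\<pi> permutes {1..Suc n}" by fact
    show "\<pi> (Suc 0) = Suc 0" using \<pi>1 by simp
    show "0 < mu i" for i by (simp add: mu_def)
    show "mu (Suc i) \<le> mu i" for i
      using row[of "i - 1"] by (cases "i \<le> 1") (auto simp: mu_def max_def)
    show "mu (Suc n) = Suc 0" using last[of "max 1 n"] by (simp add: mu_def)
    show "mu (Suc 0) = mu (Suc (Suc 0))" by (simp add: mu_def)
    show "r + mu (Suc r) \<le> Suc n" if "1 \<le> r" "r \<le> n" for r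
      using bound[OF that] mu_Suc[OF that(1)] by simp
    show "{x \<in> {1..Suc n}. x < \<pi> (Suc r) \<and> x \<notin> \<pi> ` {1..Suc r}} = {2..mu (Suc r)}"
      if r: "1 \<le> r" "r \<le> n" for r
    proof (intro set_eqI)
      fix x
      have image: "\<pi> ` {1..Suc r} = insert 1 (Suc ` \<sigma> ` {1..r})"
      proof -
        have "{1..Suc r} = insert 1 (Suc ` {1..r})" unfolding image_Suc_atLeastAtMost by auto
        moreover have "\<pi> ` Suc ` {1..r} = Suc ` \<sigma> ` {1..r}"
          unfolding image_image using \<pi>\<sigma> r by (intro image_cong) auto
        ultimately show ?thesis using \<pi>1 by simp
      qed
      have \<pi>r: "\<pi> (Suc r) = Suc (\<sigma> r)" using \<pi>\<sigma> r by simp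
      have \<sigma>r: "\<sigma> r \<in> {1..n}" using permutes_in_image[OF \<sigma>, of r] r by simp
      show "x \<in> {x \<in> {1..Suc n}. x < \<pi> (Suc r) \<and> x \<notin> \<pi> ` {1..Suc r}} \<longleftrightarrow> x \<in> {2..mu (Suc r)}"
      proof (cases "x \<le> 1")
        case True
        then show ?thesis unfolding image by (cases x) auto
      next
        case False
        then obtain y where y: "x = Suc y" "1 \<le> y" by (cases x) auto
        have "y \<notin> \<sigma> ` {1..r} \<longleftrightarrow> r < inv \<sigma> y" if "y \<in> {1..n}"
        proof -
          have "y \<in> \<sigma> ` {1..r} \<longleftrightarrow> inv \<sigma> y \<in> {1..r}"
            using permutes_inverses[OF \<sigma>] by (metis image_iff)
          then show ?thesis using inv_in[OF that] by auto
        qed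
        then have "y \<in> {1..n} \<and> y < \<sigma> r \<and> y \<notin> \<sigma> ` {1..r} \<longleftrightarrow> (r, y) \<in> rothe_diagram n \<sigma>"
          using r by (auto simp: rothe_diagram_def)
        also have "\<dots> \<longleftrightarrow> y \<le> row r" using rothe r y by simp
        finally show ?thesis
          unfolding image \<pi>r mu_Suc[OF r(1)] y(1) using y(2) by auto
      qed
    qed
  qed
  then show ?thesis by blast
qed

theorem theoremC:
  fixes n :: nat and \<pi> \<sigma> :: "nat \<Rightarrow> nat"
  assumes "\<pi> permutes {1..n + 1}"
    and "\<pi> 1 = 1"
    and "\<sigma> permutes {1..n}"
    and "\<And>i. i \<in> {1..n} \<Longrightarrow> \<pi> (i + 1) = \<sigma> i + 1"
    and "dominant n \<sigma>"
  shows "SNP (grothendieck (n + 1) \<pi>) \<and>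
    (\<forall>d. homogeneous_component d (grothendieck (n + 1) \<pi>) \<noteq> 0 \<longrightarrow>
         generalized_permutahedron n (newton (homogeneous_component d (grothendieck (n + 1) \<pi>)))) \<and>
    SNP (schubert (n + 1) \<pi>) \<and>
    generalized_permutahedron n (newton (schubert (n + 1) \<pi>)) \<and>
    schubert (n + 1) \<pi> = integer_point_transform (newton (schubert (n + 1) \<pi>))"
proof -
  obtain mu where "one_dominant n \<pi> mu"
    using one_dominant_dominant[of \<pi> n \<sigma>] assms by auto
  then interpret one_dominant n \<pi> mu .
  show ?thesis
    unfolding Suc_eq_plus1[symmetric] SNP_def[of "schubert _ _"]
    using SNP_grothendieck generalized_permutahedron_component integer_points_schubert
      generalized_permutahedron_schubert schubert_integer_point_transform by blast
qed

end
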